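(* Let $\xi_0,\xi_1,\ldots$ be nondegenerate i.i.d. complex-valued random variables with $\mathbb{E}\log(1+|\xi_0|)<\infty$. Let $\alpha>0$, $\beta\in\mathbb{R}$, and let $w_0,w_1,\ldots\in\mathbb{C}\setminus\{0\}$ be a deterministic sequence satisfying $$\log|w_k|=-\alpha(k\log k-k)-\beta k+o(k),\qquad k\to\infty.$$ Let $\mathbf{W}_n(z)=\sum_{k=0}^n\xi_kw_kz^k$, and define the random measure $\mu_n$ by $\mu_n(B)=\mu_{\mathbf{W}_n}(e^{\beta}n^{\alpha}B)$ for Borel sets $B\subset\mathbb{C}$. Then, with probability $1$, the sequence of random measures $\frac1n\mu_n$ converges, as $n\to\infty$, to the deterministic probability measure having the density $$z\mapsto\frac1{2\pi\alpha}|z|^{(1/\alpha)-2}\mathbf{1}_{\{|z|<1\}}$$ with respect to Lebesgue measure on $\mathbb{C}$.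
   Context: "Nondegenerate" means not a.s. constant. For an entire function $G$ not identically zero, $\mu_G=\sum_{z\in\mathbb{C}: G(z)=0}n_G(z)\,\delta(z)$, where $n_G(z)$ is the multiplicity of the zero $z$ and $\delta(z)$ is the unit mass at $z$; if $G\equiv 0$, then $\mu_G=0$. Thus $\mu_n$ counts (with multiplicity) the points $e^{-\beta}n^{-\alpha}z$, where $z$ runs over the zeros of $\mathbf{W}_n$. Convergence of locally finite measures on $\mathbb{C}$ is vague convergence, i.e. convergence of integrals of all continuous compactly supported functions. *)

theory Defs
  imports
    "HOL-Probability.Probability"
    "HOL-Complex_Analysis.Complex_Analysis"
    "HOL-Library.Landau_Symbols"
begin

text \<open>
  The zero-counting measure of an entire function: the sum, over the zeros \<open>z\<close>, of
  the multiplicity of \<open>z\<close> times the unit mass at \<open>z\<close>. It is built as a weighted counting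
  measure on the zero set, pushed forward to the Borel sets of the plane, so that it is a measure
  without further proof; see \<open>emeasure_zero_measure\<close> for its values.
\<close>

definition zero_measure :: "(complex \<Rightarrow> complex) \<Rightarrow> complex measure" where
  "zero_measure G =
     (if \<forall>z. G z = 0 then null_measure borel
      else distr (density (count_space {z. G z = 0}) (\<lambda>z. of_nat (nat (zorder G z)))) borel (\<lambda>z. z))"

lemma sets_zero_measure [simp]: "sets (zero_measure G) = sets borel"
  by (simp add: zero_measure_def)

lemma emeasure_zero_measure:
  assumes "\<exists>z. G z \<noteq> 0" and B: "B \<in> sets borel"
  shows "emeasure (zero_measure G) B =
    (\<integral>\<^sup>+z. of_nat (nat (zorder G z)) * emeasure (return borel z) B \<partial>count_space {z. G z = 0})"
proof -
  have eq: "zero_measure G =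
      distr (density (count_space {z. G z = 0}) (\<lambda>z. of_nat (nat (zorder G z)))) borel (\<lambda>z. z)"
    using assms(1) unfolding zero_measure_def by presburger
  have "emeasure (zero_measure G) B =
      (\<integral>\<^sup>+z. of_nat (nat (zorder G z)) * indicator (B \<inter> {z. G z = 0}) z \<partial>count_space {z. G z = 0})"
    using B unfolding eq by (subst emeasure_distr) (simp_all add: emeasure_density)
  also have "\<dots> = (\<integral>\<^sup>+z. of_nat (nat (zorder G z)) * emeasure (return borel z) B \<partial>count_space {z. G z = 0})"
    using B by (intro nn_integral_cong) (auto simp: indicator_def)
  finally show ?thesis .
qed

definition random_poly ::
    "(nat \<Rightarrow> 'a \<Rightarrow> complex) \<Rightarrow> (nat \<Rightarrow> complex) \<Rightarrow> nat \<Rightarrow> 'a \<Rightarrow> complex \<Rightarrow> complex" where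
  "random_poly \<xi> w n \<omega> z = (\<Sum>k\<le>n. \<xi> k \<omega> * w k * z ^ k)"

text \<open>
  The measure \<open>B \<mapsto> \<mu>(c B)\<close>, for \<open>c > 0\<close>, as the image of \<open>\<mu>\<close> under \<open>z \<mapsto> z / c\<close>.
\<close>

definition rescaled_measure :: "real \<Rightarrow> complex measure \<Rightarrow> complex measure" where
  "rescaled_measure c \<mu> = distr \<mu> borel (\<lambda>z. z / of_real c)"

lemma emeasure_rescaled_measure:
  assumes "c > 0" and "sets \<mu> = sets borel" and "B \<in> sets borel"
  shows "emeasure (rescaled_measure c \<mu>) B = emeasure \<mu> ((\<lambda>z. of_real c * z) ` B)"
proof -
  have "(\<lambda>z. z / of_real c) -` B = (\<lambda>z. of_real c * z) ` B"
    using assms(1) by (auto simp: image_iff intro!: bexI[of _ "_ / of_real c"])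
  moreover have "space \<mu> = UNIV"
    using sets_eq_imp_space_eq[OF assms(2)] by simp
  ultimately show ?thesis
    using assms unfolding rescaled_measure_def
    by (subst emeasure_distr) (auto simp: measurable_cong_sets[OF assms(2) refl])
qed

definition scaled_zero_measure ::
    "real \<Rightarrow> real \<Rightarrow> (nat \<Rightarrow> 'a \<Rightarrow> complex) \<Rightarrow> (nat \<Rightarrow> complex) \<Rightarrow> nat \<Rightarrow> 'a \<Rightarrow> complex measure" where
  "scaled_zero_measure \<alpha> \<beta> \<xi> w n \<omega> =
     rescaled_measure (exp \<beta> * real n powr \<alpha>) (zero_measure (random_poly \<xi> w n \<omega>))"

definition locally_finite_measure :: "complex measure \<Rightarrow> bool" where
  "locally_finite_measure \<mu> \<longleftrightarrow>
     sets \<mu> = sets borel \<and> (\<forall>K. compact K \<longrightarrow> emeasure \<mu> K < \<infinity>)"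

text \<open>
  Local finiteness is part of the definition: it makes every test function integrable, so that
  none of the integrals below takes the default value 0.
\<close>

definition vaguely_converges :: "(nat \<Rightarrow> complex measure) \<Rightarrow> complex measure \<Rightarrow> bool" where
  "vaguely_converges \<mu> \<nu> \<longleftrightarrow>
     (\<forall>n. locally_finite_measure (\<mu> n)) \<and> locally_finite_measure \<nu> \<and>
     (\<forall>f :: complex \<Rightarrow> real. continuous_on UNIV f \<longrightarrow> compact (closure {z. f z \<noteq> 0}) \<longrightarrow>
        (\<lambda>n. integral\<^sup>L (\<mu> n) f) \<longlonglongrightarrow> integral\<^sup>L \<nu> f)"

definition limit_measure :: "real \<Rightarrow> complex measure" where
  "limit_measure \<alpha> =
     density lborel (\<lambda>z. ennreal (1 / (2 * pi * \<alpha>) * cmod z powr (1 / \<alpha> - 2) * indicator {z. cmod z < 1} z))"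

end

theory Submission
  imports Defs "HOL-Computational_Algebra.Fundamental_Theorem_Algebra" "HOL-Real_Asymp.Real_Asymp"
begin

text \<open>
  In the variable \<open>z\<close> rescaled by \<open>e\<^sup>\<beta> n\<^sup>\<alpha>\<close>, the \<open>k\<close>-th term of the polynomial has modulus
  \<open>exp (n (t ln (cmod z) - \<alpha> (t ln t - t)) + o(n))\<close> with \<open>t = k / n\<close>, and the maximum \<open>\<phi> z\<close> of the
  exponent over \<open>t \<in> [0, 1]\<close> is, up to an additive constant, the logarithmic potential of the limit.
  The logarithmic moment makes the coefficients almost surely subexponential, hence
  \<open>u\<^sub>n = ln (cmod (f\<^sub>n)) / n \<le> \<phi> + o(1)\<close> locally uniformly. Conversely, in any disc \<open>u\<^sub>n\<close> exceeds
  \<open>\<phi> - \<epsilon>\<close> somewhere: the terms near the maximising index form a polynomial of small degree, whose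
  coefficients are controlled by its size on the disc, so smallness confines a number of independent
  coefficients proportional to \<open>n\<close> to tiny balls, an exponentially unlikely event. Since \<open>u\<^sub>n\<close> is
  subharmonic, its values at these points bound its means over small discs from below, and with the
  upper bound the means of \<open>u\<^sub>n\<close> over discs converge to those of \<open>\<phi>\<close>. Differences of means over
  concentric discs are the integrals of radial bumps against the zero-counting measure, and
  convolutions with these bumps approximate every test function.
\<close>

section \<open>Rotation invariance and logarithmic integrals over circles\<close>

text \<open>The obstacle is almost sure convergence. At a fixed point the general concentration
  inequalities for sums of independent terms give only a negative power of n such as 1 / sqrt n, too
  weak for Borel-Cantelli. Smallness on a whole disc constrains a positive fraction of the
  coefficients at once, and its probability decays geometrically. The price is that the good point
  is only known to lie somewhere in the disc, so pointwise convergence of potentials is out of reach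
  and disc means take its place. The leading coefficient enters the potential through an additive
  constant depending on n, about which nothing is known. A difference of two disc means removes it,
  has a compactly supported kernel, and avoids second derivatives of test functions. Countably many
  centres, radii and tolerances suffice, so that after discarding one null set the argument is
  deterministic.\<close>

lemma lborel_complex_eq_distr_pair:
  "distr (lborel \<Otimes>\<^sub>M lborel) borel (\<lambda>(x, y). Complex x y) = (lborel :: complex measure)"
proof (rule lborel_eqI[symmetric])
  have [measurable]: "(\<lambda>(x, y). Complex x y) \<in> borel_measurable (borel \<Otimes>\<^sub>M borel)"
    unfolding borel_prod case_prod_beta
    by (intro borel_measurable_continuous_onI) (auto intro!: continuous_intros simp: Complex_eq)
  fix l u :: complex assume lu: "\<And>b. b \<in> Basis \<Longrightarrow> l \<bullet> b \<le> u \<bullet> b"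
  have le: "Re l \<le> Re u" "Im l \<le> Im u"
    using lu[of 1] lu[of \<i>] by (auto simp: Basis_complex_def)
  have vim: "(\<lambda>(x, y). Complex x y) -` box l u = {Re l<..<Re u} \<times> {Im l<..<Im u}"
    by (auto simp: box_def Basis_complex_def)
  have "emeasure (distr (lborel \<Otimes>\<^sub>M lborel) borel (\<lambda>(x, y). Complex x y)) (box l u)
      = emeasure (lborel \<Otimes>\<^sub>M lborel) ({Re l<..<Re u} \<times> {Im l<..<Im u})"
    by (subst emeasure_distr) (auto simp: vim space_pair_measure)
  also have "\<dots> = ennreal ((Re u - Re l) * (Im u - Im l))"
    using le by (subst lborel.emeasure_pair_measure_Times) (auto simp: ennreal_mult)
  also have "\<dots> = ennreal (\<Prod>b\<in>Basis. (u - l) \<bullet> b)"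
    by (simp add: Basis_complex_def inner_complex_def)
  finally show "emeasure (distr (lborel \<Otimes>\<^sub>M lborel) borel (\<lambda>(x, y). Complex x y)) (box l u)
      = ennreal (\<Prod>b\<in>Basis. (u - l) \<bullet> b)" .
qed simp

lemma nn_integral_lborel_complex:
  fixes f :: "complex \<Rightarrow> ennreal"
  assumes [measurable]: "f \<in> borel_measurable borel"
  shows "(\<integral>\<^sup>+z. f z \<partial>lborel) = (\<integral>\<^sup>+x. \<integral>\<^sup>+y. f (Complex x y) \<partial>lborel \<partial>lborel)"
    and "(\<integral>\<^sup>+z. f z \<partial>lborel) = (\<integral>\<^sup>+y. \<integral>\<^sup>+x. f (Complex x y) \<partial>lborel \<partial>lborel)"
proof -
  have [measurable]: "(\<lambda>p. Complex (fst p) (snd p)) \<in> borel_measurable (borel \<Otimes>\<^sub>M borel)"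
    unfolding borel_prod
    by (intro borel_measurable_continuous_onI) (auto intro!: continuous_intros simp: Complex_eq)
  have *: "(\<integral>\<^sup>+z. f z \<partial>lborel) = (\<integral>\<^sup>+p. f (Complex (fst p) (snd p)) \<partial>(lborel \<Otimes>\<^sub>M lborel))"
    by (subst lborel_complex_eq_distr_pair[symmetric], subst nn_integral_distr)
       (auto simp: case_prod_beta)
  show 1: "(\<integral>\<^sup>+z. f z \<partial>lborel) = (\<integral>\<^sup>+x. \<integral>\<^sup>+y. f (Complex x y) \<partial>lborel \<partial>lborel)"
    unfolding * by (subst lborel.nn_integral_fst[symmetric]) auto
  show "(\<integral>\<^sup>+z. f z \<partial>lborel) = (\<integral>\<^sup>+y. \<integral>\<^sup>+x. f (Complex x y) \<partial>lborel \<partial>lborel)"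
    unfolding * by (subst lborel_pair.nn_integral_snd[symmetric]) (auto simp: case_prod_beta)
qed

lemma nn_integral_real_shift:
  fixes f :: "real \<Rightarrow> ennreal"
  assumes [measurable]: "f \<in> borel_measurable borel"
  shows "(\<integral>\<^sup>+x. f (x + t) \<partial>lborel) = (\<integral>\<^sup>+x. f x \<partial>lborel)"
  using nn_integral_real_affine[of f 1 t] by (simp add: add.commute)

lemma nn_integral_lborel_shear:
  fixes f :: "complex \<Rightarrow> ennreal" and p :: real
  assumes [measurable]: "f \<in> borel_measurable borel"
  shows "(\<integral>\<^sup>+z. f (z + of_real (p * Im z)) \<partial>lborel) = (\<integral>\<^sup>+z. f z \<partial>lborel)"
    and "(\<integral>\<^sup>+z. f (z + \<i> * of_real (p * Re z)) \<partial>lborel) = (\<integral>\<^sup>+z. f z \<partial>lborel)"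
proof -
  have [measurable]: "(\<lambda>x. Complex x y) \<in> borel_measurable borel"
      "(\<lambda>y. Complex x y) \<in> borel_measurable borel" for x y
    by (intro borel_measurable_continuous_onI; auto intro!: continuous_intros simp: Complex_eq)+
  have "(\<integral>\<^sup>+z. f (z + of_real (p * Im z)) \<partial>lborel)
      = (\<integral>\<^sup>+y. \<integral>\<^sup>+x. f (Complex (x + p * y) y) \<partial>lborel \<partial>lborel)"
    by (subst nn_integral_lborel_complex(2))
       (auto intro!: nn_integral_cong arg_cong[where f=f] simp: complex_eq_iff)
  also have "\<dots> = (\<integral>\<^sup>+z. f z \<partial>lborel)"
    by (subst nn_integral_lborel_complex(2)[of f], simp,
        intro nn_integral_cong nn_integral_real_shift, measurable)
  finally show "(\<integral>\<^sup>+z. f (z + of_real (p * Im z)) \<partial>lborel) = (\<integral>\<^sup>+z. f z \<partial>lborel)" .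
  have "(\<integral>\<^sup>+z. f (z + \<i> * of_real (p * Re z)) \<partial>lborel)
      = (\<integral>\<^sup>+x. \<integral>\<^sup>+y. f (Complex x (y + p * x)) \<partial>lborel \<partial>lborel)"
    by (subst nn_integral_lborel_complex(1))
       (auto intro!: nn_integral_cong arg_cong[where f=f] simp: complex_eq_iff)
  also have "\<dots> = (\<integral>\<^sup>+z. f z \<partial>lborel)"
    by (subst nn_integral_lborel_complex(1)[of f], simp,
        intro nn_integral_cong nn_integral_real_shift, measurable)
  finally show "(\<integral>\<^sup>+z. f (z + \<i> * of_real (p * Re z)) \<partial>lborel) = (\<integral>\<^sup>+z. f z \<partial>lborel)" .
qed

lemma nn_integral_lborel_rotate:
  fixes f :: "complex \<Rightarrow> ennreal"
  assumes [measurable]: "f \<in> borel_measurable borel" and u: "cmod u = 1"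
  shows "(\<integral>\<^sup>+z. f (u * z) \<partial>lborel) = (\<integral>\<^sup>+z. f z \<partial>lborel)"
proof (cases "Im u = 0")
  case True
  then have "u = 1 \<or> u = -1"
    using u by (auto simp: complex_eq_iff cmod_def abs_if split: if_splits)
  moreover have "(\<integral>\<^sup>+z. f (- z) \<partial>lborel) = (\<integral>\<^sup>+z. f z \<partial>lborel)"
    by (subst (2) lborel_affine[of "-1" 0])
       (auto simp: nn_integral_distr nn_integral_density)
  ultimately show ?thesis by auto
next
  case False
  \<comment> \<open>A plane rotation is a product of three shears.\<close>
  define p where "p = (Re u - 1) / Im u"
  have u2: "(Re u)\<^sup>2 + (Im u)\<^sup>2 = 1"
    using u by (simp add: cmod_def)
  define S where "S z = z + of_real (p * Im z)" for z
  define T where "T z = z + \<i> * of_real (Im u * Re z)" for z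
  have [measurable]: "S \<in> borel_measurable borel" "T \<in> borel_measurable borel"
    by (auto simp: S_def[abs_def] T_def[abs_def])
  \<comment> \<open>For u = cos t + i sin t the number p is - tan (t / 2); \<open>bp\<close> and
    \<open>Re2\<close> are the half-angle identities that turn the product of shears into the
    rotation.\<close>
  have bp: "Im u * p = Re u - 1"
    using False by (simp add: p_def)
  have Re2: "p * (1 + Re u) = - Im u"
    using False u2 by (simp add: p_def field_simps power2_eq_square)
  have "u * z = S (T (S z))" for z
  proof -
    have 1: "Im (T (S z)) = Im u * Re z + Re u * Im z"
      using bp by (simp add: S_def T_def algebra_simps) (metis (no_types) distrib_left mult.left_commute diff_add_cancel add.commute mult.commute mult_1_right right_diff_distrib)
    have "Re (S (T (S z))) = Re z + p * Im z + p * (Im u * Re z + Re u * Im z)"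
      using 1 by (simp add: S_def) (simp add: T_def S_def)
    also have "\<dots> = Re z * (1 + Im u * p) + Im z * (p * (1 + Re u))"
      by (simp add: algebra_simps)
    also have "\<dots> = Re u * Re z - Im u * Im z"
      by (simp add: bp Re2)
    finally have 2: "Re (S (T (S z))) = Re u * Re z - Im u * Im z" .
    have "Im (S (T (S z))) = Im (T (S z))" by (simp add: S_def)
    with 1 2 show ?thesis by (simp add: complex_eq_iff algebra_simps)
  qed
  then have "(\<integral>\<^sup>+z. f (u * z) \<partial>lborel) = (\<integral>\<^sup>+z. f (S (T (S z))) \<partial>lborel)" by simp
  also have "\<dots> = (\<integral>\<^sup>+z. f (S (T z)) \<partial>lborel)"
    using nn_integral_lborel_shear(1)[of "\<lambda>z. f (S (T z))" p] by (simp add: S_def)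
  also have "\<dots> = (\<integral>\<^sup>+z. f (S z) \<partial>lborel)"
    using nn_integral_lborel_shear(2)[of "\<lambda>z. f (S z)" "Im u"] by (simp add: T_def)
  also have "\<dots> = (\<integral>\<^sup>+z. f z \<partial>lborel)"
    using nn_integral_lborel_shear(1)[of f p] by (simp add: S_def)
  finally show ?thesis .
qed

section \<open>Polar coordinates for radial integrands\<close>

lemma emeasure_lborel_complex_ball:
  "emeasure lborel (ball (z::complex) r) = ennreal (pi * (max 0 r)\<^sup>2)"
proof (cases "r \<ge> 0")
  case True
  then show ?thesis by (simp add: emeasure_ball eval_unit_ball_vol)
next
  case False
  then show ?thesis by (simp add: ball_empty)
qed

text \<open>Discs have area pi a^2, which is the primitive of 2 pi r, and the half-lines are closed
  under intersection and generate the Borel sets. The law of the modulus replaces a full polar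
  change of variables.\<close>

lemma distr_lborel_cmod:
  "distr lborel borel cmod = density lborel (\<lambda>r. ennreal (2 * pi * r) * indicator {0..} r)"
proof (rule measure_eqI_generator_eq[where E="range lessThan" and A="\<lambda>n. {..<real n}" and \<Omega>=UNIV])
  have em: "emeasure (distr lborel borel cmod) {..<a} = ennreal (pi * (max 0 a)\<^sup>2)" for a
  proof -
    have "cmod -` {..<a} = ball 0 a" by (auto simp: dist_norm)
    then show ?thesis
      by (subst emeasure_distr) (auto simp: emeasure_lborel_complex_ball)
  qed
  show "Int_stable (range lessThan :: real set set)"
  proof (clarsimp simp: Int_stable_def)
    fix a b :: real
    have "{..<a} \<inter> {..<b} = {..<min a b}" by auto
    then show "{..<a} \<inter> {..<b} \<in> range lessThan" by simp
  qed
  show "sets (distr lborel borel cmod) = sigma_sets UNIV (range lessThan)"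
    by (simp add: borel_Iio)
  show "sets (density lborel (\<lambda>r. ennreal (2 * pi * r) * indicator {0..} r)) = sigma_sets UNIV (range lessThan)"
    by (simp add: borel_Iio)
  show "(\<Union>n. {..<real n}) = UNIV"
    by (auto simp: reals_Archimedean2)
  show "emeasure (distr lborel borel cmod) {..<real n} \<noteq> \<infinity>" for n
    by (simp add: em)
  fix X :: "real set" assume "X \<in> range lessThan"
  then obtain a where X: "X = {..<a}" by auto
  have "emeasure (density lborel (\<lambda>r. ennreal (2 * pi * r) * indicator {0..} r)) {..<a}
      = (\<integral>\<^sup>+r. ennreal (2 * pi * r) * indicator {0..<a} r \<partial>lborel)"
    by (subst emeasure_density) (auto intro!: nn_integral_cong split: split_indicator)
  also have "\<dots> = (\<integral>\<^sup>+r. ennreal (2 * pi * r) * indicator {0..max 0 a} r \<partial>lborel)"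
    using AE_lborel_singleton[of a] AE_lborel_singleton[of "0::real"]
    by (intro nn_integral_cong_AE) (auto split: split_indicator elim!: eventually_mono)
  also have "\<dots> = ennreal (pi * (max 0 a)\<^sup>2 - pi * 0\<^sup>2)"
    by (rule nn_integral_FTC_Icc) (auto intro!: derivative_eq_intros)
  finally show "emeasure (distr lborel borel cmod) X =
      emeasure (density lborel (\<lambda>r. ennreal (2 * pi * r) * indicator {0..} r)) X"
    unfolding X em by simp
qed auto

lemma nn_integral_radial:
  assumes [measurable]: "f \<in> borel_measurable borel"
  shows "(\<integral>\<^sup>+z. f (cmod z) \<partial>lborel) = (\<integral>\<^sup>+r. ennreal (2 * pi * r) * indicator {0..} r * f r \<partial>lborel)"
proof -
  have "(\<integral>\<^sup>+z. f (cmod z) \<partial>lborel) = (\<integral>\<^sup>+r. f r \<partial>distr lborel borel cmod)"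
    by (subst nn_integral_distr) auto
  then show ?thesis
    unfolding distr_lborel_cmod by (simp add: nn_integral_density)
qed

lemma AE_lborel_cmod_neq: "AE z in lborel. cmod z \<noteq> a"
proof -
  have "AE r in distr lborel borel cmod. r \<noteq> a"
    unfolding distr_lborel_cmod using AE_lborel_singleton[of a]
    by (subst AE_density) (auto elim!: eventually_mono)
  then show ?thesis by (subst (asm) AE_distr_iff) auto
qed

text \<open>Mean value property of \<open>Ln (1 - b * z)\<close>, which is holomorphic on a disc
  slightly larger than the unit disc because \<open>Re (1 - b * z) > 0\<close> there, and which
  vanishes at 0.\<close>

lemma has_integral_ln_circle:
  assumes b: "cmod b < 1"
  shows "((\<lambda>t. ln (cmod (1 - b * cis t))) has_integral 0) {0..2*pi}"
proof -
  define f where "f z = Ln (1 - b * z)" for z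
  have ex: "\<exists>r>1. \<forall>z. cmod z < r \<longrightarrow> cmod (b * z) < 1"
  proof (cases "b = 0")
    case False
    then show ?thesis using b
      by (intro exI[of _ "1 / cmod b"]) (auto simp: norm_mult field_simps)
  qed (auto intro: exI[of _ 2])
  then obtain r where r: "r > 1" "\<And>z. cmod z < r \<Longrightarrow> cmod (b * z) < 1" by blast
  have pos: "Re (1 - b * z) > 0" if "cmod z < r" for z
    using r(2)[OF that] complex_Re_le_cmod[of "b * z"] by simp
  have "f holomorphic_on ball 0 r"
    unfolding f_def
    by (intro holomorphic_intros) (use pos in \<open>auto simp: complex_nonpos_Reals_iff dest!: pos\<close>)
  moreover have sub: "cball 0 1 \<subseteq> ball 0 r" using r(1) by auto
  ultimately have "((\<lambda>u. f u / (u - 0)) has_contour_integral (2 * of_real pi * \<i> * f 0)) (circlepath 0 1)"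
    by (intro Cauchy_integral_circlepath_simple) (auto intro: holomorphic_on_subset)
  then have "((\<lambda>t. f (cis t) / cis t * \<i> * cis t) has_integral 0) {0..2*pi}"
    unfolding circlepath_def
    by (subst (asm) has_contour_integral_part_circlepath_iff) (auto simp: f_def)
  then have "((\<lambda>t. \<i> * f (cis t)) has_integral 0) {0..2*pi}"
    by (simp add: mult_ac)
  then have "((\<lambda>t. (-\<i>) * (\<i> * f (cis t))) has_integral (-\<i>) * 0) {0..2*pi}"
    by (rule has_integral_mult_right)
  then have "((\<lambda>t. f (cis t)) has_integral 0) {0..2*pi}"
    by (simp add: mult.assoc[symmetric])
  from has_integral_Re[OF this] have "((\<lambda>t. Re (f (cis t))) has_integral 0) {0..2*pi}" by simp
  moreover have "Re (f (cis t)) = ln (cmod (1 - b * cis t))" for t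
    unfolding f_def using pos[of "cis t"] r(1) by (intro Re_Ln) force
  ultimately show ?thesis by simp
qed

text \<open>Pulling the larger modulus out of \<open>cis t * z - a\<close> leaves a factor
  \<open>1 - b * cis t\<close> with \<open>cmod b < 1\<close>, whose logarithm has mean 0. At equal
  moduli the singularity lies on the circle; that case has measure zero in the applications.\<close>

lemma has_bochner_integral_ln_circle:
  assumes "cmod a \<noteq> cmod z"
  shows "has_bochner_integral lborel (\<lambda>t. indicator {0..2*pi} t * ln (cmod (cis t * z - a)))
    (2 * pi * ln (max (cmod z) (cmod a)))"
proof -
  have cont: "continuous_on {0..2*pi} (\<lambda>t. ln (cmod (cis t * z - a)))"
  proof (intro continuous_intros ballI)
    fix t show "cmod (cis t * z - a) \<noteq> 0"
    proof
      assume "cmod (cis t * z - a) = 0"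
      then have "cmod a = cmod (cis t * z)" by auto
      with assms show False by (simp add: norm_mult)
    qed
  qed
  have "((\<lambda>t. ln (cmod (cis t * z - a))) has_integral (2 * pi * ln (max (cmod z) (cmod a)))) {0..2*pi}"
  proof -
    define m where "m = max (cmod z) (cmod a)"
    have m: "m > 0" using assms unfolding m_def
      by (metis less_max_iff_disj norm_eq_zero zero_less_norm_iff)
    obtain b where b: "cmod b < 1" "\<And>t. cmod (cis t * z - a) = m * cmod (1 - b * cis t)"
    proof (cases "cmod z < cmod a")
      case True
      then have a: "a \<noteq> 0" by auto
      show ?thesis
      proof (rule that)
        show "cmod (z / a) < 1" using True a by (simp add: norm_divide)
        fix t
        have "m * cmod (1 - z / a * cis t) = cmod (a * (1 - z / a * cis t))"
          using True by (simp only: norm_mult) (simp add: m_def)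
        also have "a * (1 - z / a * cis t) = - (cis t * z - a)"
          using a by (simp add: field_simps)
        finally show "cmod (cis t * z - a) = m * cmod (1 - z / a * cis t)"
          by (simp only: norm_minus_cancel)
      qed
    next
      case False
      then have lt: "cmod a < cmod z" using assms by auto
      then have z: "z \<noteq> 0" by auto
      show ?thesis
      proof (rule that)
        \<comment> \<open>The remaining factor is \<open>1 - a / z * cis (-t)\<close>, which runs
          the other way round the circle; conjugation restores \<open>cis t\<close> without changing
          the modulus.\<close>
        show "cmod (cnj (a / z)) < 1" using lt z by (simp add: norm_divide)
        fix t
        have "m * cmod (1 - cnj (a / z) * cis t) = m * cmod (cnj (1 - cnj (a / z) * cis t))"
          by (simp only: complex_mod_cnj)
        also have "cnj (1 - cnj (a / z) * cis t) = 1 - a / z * cis (-t)"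
          by (simp add: cis_cnj)
        also have "m * cmod (1 - a / z * cis (-t)) = cmod (cis t * z * (1 - a / z * cis (-t)))"
          using lt by (simp only: norm_mult) (simp add: m_def)
        also have "cis t * z * (1 - a / z * cis (-t)) = cis t * z - a * (cis t * cis (-t))"
          using z by (simp add: field_simps)
        also have "cis t * cis (-t) = 1" by (simp add: cis_mult)
        finally show "cmod (cis t * z - a) = m * cmod (1 - cnj (a / z) * cis t)"
          by simp
      qed
    qed
    have ne: "1 - b * cis t \<noteq> 0" for t
    proof
      assume "1 - b * cis t = 0"
      then have "cmod (b * cis t) = 1" by (metis eq_iff_diff_eq_0 norm_one)
      with b(1) show False by (simp add: norm_mult)
    qed
    have "((\<lambda>t. ln m + ln (cmod (1 - b * cis t))) has_integral (2 * pi * ln m + 0)) {0..2*pi}"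
      using has_integral_const_real[of "ln m" 0 "2*pi"]
      by (intro has_integral_add has_integral_ln_circle b(1)) (simp add: mult.commute)
    moreover have "ln m + ln (cmod (1 - b * cis t)) = ln (cmod (cis t * z - a))" for t
      unfolding b(2) using m ne by (subst ln_mult) auto
    ultimately show ?thesis unfolding m_def by simp
  qed
  moreover have i: "integrable lborel (\<lambda>t. indicator {0..2*pi} t *\<^sub>R ln (cmod (cis t * z - a)))"
    using cont by (intro borel_integrable_compact) auto
  then have "set_integrable lborel {0..2*pi} (\<lambda>t. ln (cmod (cis t * z - a)))"
    by (simp add: set_integrable_def)
  from set_borel_integral_eq_integral(2)[OF this]
  have "(LINT t:{0..2*pi}|lborel. ln (cmod (cis t * z - a))) = integral {0..2*pi} (\<lambda>t. ln (cmod (cis t * z - a)))" .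
  ultimately show ?thesis
    using i by (auto simp: has_bochner_integral_iff set_lebesgue_integral_def integral_unique)
qed

section \<open>Logarithmic potentials of radial measures\<close>

text \<open>One family covers two uses: k = 1 / \<alpha>, r = 1 is the limit measure, and k = 2 is
  Lebesgue measure on a disc divided by pi, up to the null set {0}. The factor k / (2 pi) makes the
  total mass \<open>r powr k\<close>.\<close>

definition radial_measure :: "real \<Rightarrow> real \<Rightarrow> complex measure" where
  "radial_measure k r = density lborel
     (\<lambda>z. ennreal (k / (2 * pi) * cmod z powr (k - 2) * indicator {z. cmod z < r} z))"

lemma sets_radial_measure [simp, measurable_cong]: "sets (radial_measure k r) = sets borel"
  by (simp add: radial_measure_def)

lemma space_radial_measure [simp]: "space (radial_measure k r) = UNIV"
  by (simp add: radial_measure_def)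

lemma limit_measure_eq_radial_measure: "limit_measure \<alpha> = radial_measure (1 / \<alpha>) 1"
  unfolding limit_measure_def radial_measure_def
  by (intro arg_cong2[where f=density] refl ext) (simp add: mult_ac)

lemma distr_radial_measure_cmod:
  assumes k: "k > 0"
  shows "distr (radial_measure k r) borel cmod =
    density lborel (\<lambda>x. ennreal (k * x powr (k - 1) * indicator {0<..<r} x))"
proof (rule measure_eqI)
  fix X assume "X \<in> sets (distr (radial_measure k r) borel cmod)"
  then have [measurable]: "X \<in> sets borel" by simp
  have "emeasure (distr (radial_measure k r) borel cmod) X = (\<integral>\<^sup>+x. indicator X x \<partial>distr (radial_measure k r) borel cmod)"
    by simp
  also have "\<dots> = (\<integral>\<^sup>+z. indicator X (cmod z) \<partial>radial_measure k r)"
    by (subst nn_integral_distr) auto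
  also have "\<dots> = (\<integral>\<^sup>+z. ennreal (k / (2 * pi) * cmod z powr (k - 2) * indicator {..<r} (cmod z)) * indicator X (cmod z) \<partial>lborel)"
    unfolding radial_measure_def
    by (subst nn_integral_density) (auto intro!: nn_integral_cong simp: indicator_def)
  also have "\<dots> = (\<integral>\<^sup>+x. ennreal (2 * pi * x) * indicator {0..} x * (ennreal (k / (2 * pi) * x powr (k - 2) * indicator {..<r} x) * indicator X x) \<partial>lborel)"
    by (subst nn_integral_radial) auto
  also have "\<dots> = (\<integral>\<^sup>+x. ennreal (k * x powr (k - 1) * indicator {0<..<r} x) * indicator X x \<partial>lborel)"
  proof (intro nn_integral_cong)
    fix x :: real
    show "ennreal (2 * pi * x) * indicator {0..} x * (ennreal (k / (2 * pi) * x powr (k - 2) * indicator {..<r} x) * indicator X x)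
        = ennreal (k * x powr (k - 1) * indicator {0<..<r} x) * indicator X x"
    proof (cases "0 < x \<and> x < r")
      case True
      then have "x * x powr (k - 2) = x powr (k - 1)"
        by (simp add: powr_mult_base)
      then have "2 * pi * x * (k / (2 * pi) * x powr (k - 2)) = k * x powr (k - 1)"
        by (simp add: field_simps)
      then show ?thesis using True k
        by (auto simp: mult.assoc[symmetric] ennreal_mult[symmetric] split: split_indicator)
    qed (auto simp: indicator_def)
  qed
  also have "\<dots> = emeasure (density lborel (\<lambda>x. ennreal (k * x powr (k - 1) * indicator {0<..<r} x))) X"
    by (subst emeasure_density) auto
  finally show "emeasure (distr (radial_measure k r) borel cmod) X =
    emeasure (density lborel (\<lambda>x. ennreal (k * x powr (k - 1) * indicator {0<..<r} x))) X" .
qed simp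

text \<open>For k < 1 the integrand is unbounded at 0, so the value is taken from the gauge integral
  over a closed interval and carried over by nonnegativity; the endpoints are null.\<close>

lemma has_bochner_integral_powr:
  fixes k c :: real
  assumes "k > 0" "c \<ge> 0"
  shows "has_bochner_integral lborel (\<lambda>x. k * x powr (k - 1) * indicator {0<..<c} x) (c powr k)"
proof -
  have "((\<lambda>x. k * x powr (k - 1)) has_integral c powr k) {0..c}"
    using has_integral_mult_right[OF has_integral_powr_from_0[of "k - 1" c], of k] assms by simp
  then have "((\<lambda>x. k * x powr (k - 1) * indicator {0..c} x) has_integral c powr k) UNIV"
    unfolding indicator_def of_bool_def if_distrib[where f="\<lambda>x. a * x" for a]
    by (simp cong del: if_weak_cong del: atLeastAtMost_iff)
  then have "integral\<^sup>N lborel (\<lambda>x. ennreal (k * x powr (k - 1) * indicator {0..c} x)) = ennreal (c powr k)"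
    using assms by (intro nn_integral_has_integral_lborel) auto
  also have "integral\<^sup>N lborel (\<lambda>x. ennreal (k * x powr (k - 1) * indicator {0..c} x))
      = integral\<^sup>N lborel (\<lambda>x. ennreal (k * x powr (k - 1) * indicator {0<..<c} x))"
    using AE_lborel_singleton[of c] AE_lborel_singleton[of "0::real"]
    by (intro nn_integral_cong_AE) (auto split: split_indicator elim!: eventually_mono)
  finally show ?thesis
    using assms by (intro has_bochner_integral_nn_integral) (auto split: split_indicator)
qed

lemma emeasure_radial_measure:
  assumes "k > 0" "r \<ge> 0"
  shows "emeasure (radial_measure k r) UNIV = ennreal (r powr k)"
proof -
  have "emeasure (radial_measure k r) UNIV = emeasure (distr (radial_measure k r) borel cmod) UNIV"
    by (subst emeasure_distr) auto
  also have "\<dots> = (\<integral>\<^sup>+x. ennreal (k * x powr (k - 1) * indicator {0<..<r} x) \<partial>lborel)"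
    unfolding distr_radial_measure_cmod[OF assms(1)] by (subst emeasure_density) auto
  also have "\<dots> = ennreal (r powr k)"
    using has_bochner_integral_powr[OF assms] assms
    by (subst nn_integral_eq_integral) (auto simp: has_bochner_integral_iff split: split_indicator)
  finally show ?thesis .
qed

lemma finite_measure_radial_measure:
  "k > 0 \<Longrightarrow> r \<ge> 0 \<Longrightarrow> finite_measure (radial_measure k r)"
  by (rule finite_measureI) (simp add: emeasure_radial_measure)

lemma distr_radial_measure_rotate:
  assumes u: "cmod u = 1"
  shows "distr (radial_measure k r) borel (\<lambda>z. u * z) = radial_measure k r"
proof (rule measure_eqI)
  fix X assume "X \<in> sets (distr (radial_measure k r) borel (\<lambda>z. u * z))"
  then have [measurable]: "X \<in> sets borel" by simp
  let ?h = "\<lambda>z. ennreal (k / (2 * pi) * cmod z powr (k - 2) * indicator {z. cmod z < r} z)"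
  have "emeasure (distr (radial_measure k r) borel (\<lambda>z. u * z)) X
      = (\<integral>\<^sup>+z. indicator X z \<partial>distr (radial_measure k r) borel (\<lambda>z. u * z))" by simp
  also have "\<dots> = (\<integral>\<^sup>+z. indicator X (u * z) \<partial>radial_measure k r)"
    by (subst nn_integral_distr) auto
  also have "\<dots> = (\<integral>\<^sup>+z. ?h (u * z) * indicator X (u * z) \<partial>lborel)"
    unfolding radial_measure_def
    by (subst nn_integral_density) (auto simp: norm_mult u indicator_def)
  also have "\<dots> = (\<integral>\<^sup>+z. ?h z * indicator X z \<partial>lborel)"
    by (rule nn_integral_lborel_rotate[OF _ u]) measurable
  also have "\<dots> = emeasure (radial_measure k r) X"
    unfolding radial_measure_def by (subst emeasure_density) auto
  finally show "emeasure (distr (radial_measure k r) borel (\<lambda>z. u * z)) X = emeasure (radial_measure k r) X" .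
qed simp

lemma AE_radial_measure_cmod_neq: "AE z in radial_measure k r. cmod z \<noteq> a"
  unfolding radial_measure_def using AE_lborel_cmod_neq[of a]
  by (subst AE_density) (auto elim!: eventually_mono)

text \<open>Invariance allows z to be replaced by \<open>cis t * z\<close>. Integrating over t and
  exchanging the integrals leaves, for every z off the circle through a, the circle mean of the
  logarithm.\<close>

lemma integral_ln_rotation_invariant:
  fixes \<mu> :: "complex measure"
  assumes fin: "finite_measure \<mu>" and sets [measurable_cong]: "sets \<mu> = sets borel"
    and rot: "\<And>u. cmod u = 1 \<Longrightarrow> distr \<mu> borel (\<lambda>z. u * z) = \<mu>"
    and AE: "AE z in \<mu>. cmod z \<noteq> cmod a"
    and int: "integrable \<mu> (\<lambda>z. ln (cmod (z - a)))"
  shows "(LINT z|\<mu>. ln (cmod (z - a))) = (LINT z|\<mu>. ln (max (cmod z) (cmod a)))"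
proof -
  interpret finite_measure \<mu> by fact
  interpret P: pair_sigma_finite "lborel :: real measure" \<mu> ..
  define F where "F t z = indicator {0..2*pi} t * ln (cmod (cis t * z - a))" for t :: real and z
  have cis_m: "cis \<in> borel_measurable borel"
    by (intro borel_measurable_continuous_onI continuous_intros)
  have [measurable]: "(\<lambda>(t, z). F t z) \<in> borel_measurable (lborel \<Otimes>\<^sub>M \<mu>)"
    unfolding F_def case_prod_beta using cis_m by measurable
  have meas_ln: "(\<lambda>z. ln (cmod (z - a))) \<in> borel_measurable borel" by measurable
  have rot_int: "integrable \<mu> (\<lambda>z. ln (cmod (u * z - a)))" if "cmod u = 1" for u
  proof -
    have "integrable (distr \<mu> borel (\<lambda>z. u * z)) (\<lambda>z. ln (cmod (z - a)))"
      using int rot[OF that] by simp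
    then show ?thesis by (subst (asm) integrable_distr_eq) auto
  qed
  have rot_eq: "(LINT z|\<mu>. g (u * z)) = (LINT z|\<mu>. g z)"
    if "cmod u = 1" "g \<in> borel_measurable borel" for u and g :: "complex \<Rightarrow> real"
    using integral_distr[of "\<lambda>z. u * z" \<mu> borel g] rot[OF that(1)] that(2) by simp
  have "integrable (lborel \<Otimes>\<^sub>M \<mu>) (\<lambda>(t, z). F t z)"
  proof (rule P.Fubini_integrable)
    have "(\<integral>z. norm (case (t, z) of (t, z) \<Rightarrow> F t z) \<partial>\<mu>)
        = indicator {0..2*pi} t * (LINT z|\<mu>. \<bar>ln (cmod (z - a))\<bar>)" for t
      using rot_eq[of "cis t" "\<lambda>z. \<bar>ln (cmod (z - a))\<bar>"]
      by (auto simp: F_def abs_mult)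
    moreover have "integrable lborel (\<lambda>t. indicator {0..2*pi} t * (LINT z|\<mu>. \<bar>ln (cmod (z - a))\<bar>))"
      by (intro integrable_mult_left) (auto intro!: integrable_real_indicator)
    ultimately show "integrable lborel (\<lambda>t. \<integral>z. norm (case (t, z) of (t, z) \<Rightarrow> F t z) \<partial>\<mu>)"
      by simp
    show "AE t in lborel. integrable \<mu> (\<lambda>z. case (t, z) of (t, z) \<Rightarrow> F t z)"
      unfolding F_def by (intro AE_I2) (auto intro!: integrable_mult_right rot_int)
  qed measurable
  from P.Fubini_integral[OF this]
  have "(LINT z|\<mu>. LINT t|lborel. F t z) = (LINT t|lborel. LINT z|\<mu>. F t z)" .
  also have "(LINT t|lborel. LINT z|\<mu>. F t z)
      = (LINT t|lborel. indicator {0..2*pi} t * (LINT z|\<mu>. ln (cmod (z - a))))"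
    unfolding F_def using rot_eq[OF _ meas_ln] by (intro Bochner_Integration.integral_cong) auto
  also have "\<dots> = 2 * pi * (LINT z|\<mu>. ln (cmod (z - a)))"
    by simp
  also have "(LINT z|\<mu>. LINT t|lborel. F t z) = (LINT z|\<mu>. 2 * pi * ln (max (cmod z) (cmod a)))"
  proof (rule integral_cong_AE)
    show "AE z in \<mu>. (LINT t|lborel. F t z) = 2 * pi * ln (max (cmod z) (cmod a))"
      using AE
    proof eventually_elim
      case (elim z)
      show ?case
        using has_bochner_integral_ln_circle[of a z] elim
        by (auto simp: F_def has_bochner_integral_iff)
    qed
  qed measurable
  finally show ?thesis by simp
qed

text \<open>The integral of ln (max x t) against k x^(k-1) on (0, r), that is, the logarithmic
  potential of \<open>radial_measure k r\<close> at distance t from the centre. Outside the disc it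
  is the potential of the whole mass placed at the centre.\<close>

definition radial_potential :: "real \<Rightarrow> real \<Rightarrow> real \<Rightarrow> real" where
  "radial_potential k r t = (if t < r then r powr k * ln r - (r powr k - t powr k) / k else r powr k * ln t)"

lemma has_bochner_integral_ln_max_radial_measure:
  assumes k: "k > 0" and r: "r > 0" and t: "t > 0"
  shows "has_bochner_integral (radial_measure k r) (\<lambda>z. ln (max (cmod z) t)) (radial_potential k r t)"
proof -
  let ?w = "\<lambda>x. k * x powr (k - 1) * indicator {0<..<r} x"
  have "has_bochner_integral lborel (\<lambda>x. ?w x * ln (max x t)) (radial_potential k r t)"
  proof (cases "t < r")
    case False
    have "has_bochner_integral lborel (\<lambda>x. ?w x * ln t) (r powr k * ln t)"
      using has_bochner_integral_powr[OF k, of r] r by (intro has_bochner_integral_mult_left) auto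
    moreover have "(\<lambda>x. ?w x * ln (max x t)) = (\<lambda>x. ?w x * ln t)"
      using False by (auto simp: indicator_def max_def)
    ultimately show ?thesis using False by (simp add: radial_potential_def)
  next
    case True
    let ?F = "\<lambda>x. x powr k * ln x - x powr k / k"
    have 1: "has_bochner_integral lborel (\<lambda>x. k * x powr (k - 1) * indicator {0<..<t} x * ln t) (t powr k * ln t)"
      using has_bochner_integral_powr[OF k, of t] t by (intro has_bochner_integral_mult_left) auto
    have 2: "has_bochner_integral lborel (\<lambda>x. (k * x powr (k - 1) * ln x) * indicator {t..r} x) (?F r - ?F t)"
    proof (rule has_bochner_integral_FTC_Icc_real)
      fix x assume "t \<le> x"
      then have x: "x > 0" using t by auto
      have e: "x powr k / x = x powr (k - 1)" using x by (simp add: powr_diff)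
      show "DERIV ?F x :> k * x powr (k - 1) * ln x"
        using x k by (auto intro!: derivative_eq_intros simp: field_simps e[symmetric])
      show "isCont (\<lambda>x. k * x powr (k - 1) * ln x) x"
        using x by (intro continuous_intros) auto
    qed (use True in simp)
    have "has_bochner_integral lborel (\<lambda>x. k * x powr (k - 1) * indicator {0<..<t} x * ln t
        + (k * x powr (k - 1) * ln x) * indicator {t..r} x) (t powr k * ln t + (?F r - ?F t))"
      by (rule has_bochner_integral_add[OF 1 2])
    moreover have "t powr k * ln t + (?F r - ?F t) = radial_potential k r t"
      using True by (simp add: radial_potential_def diff_divide_distrib)
    moreover have "AE x in lborel. k * x powr (k - 1) * indicator {0<..<t} x * ln t
        + (k * x powr (k - 1) * ln x) * indicator {t..r} x = ?w x * ln (max x t)"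
      using AE_lborel_singleton[of r] t True by (auto split: split_indicator elim!: eventually_mono simp: max_def)
    ultimately show ?thesis
      by (subst has_bochner_integral_cong_AE[symmetric]) auto
  qed
  then have "has_bochner_integral (density lborel (\<lambda>x. ennreal (?w x))) (\<lambda>x. ln (max x t)) (radial_potential k r t)"
    using k by (intro has_bochner_integral_density) (auto split: split_indicator)
  then have "has_bochner_integral (distr (radial_measure k r) borel cmod) (\<lambda>x. ln (max x t)) (radial_potential k r t)"
    by (simp add: distr_radial_measure_cmod[OF k])
  then show ?thesis
    by (auto simp: has_bochner_integral_iff integrable_distr_eq integral_distr)
qed

text \<open>Integrability is left to the caller: for discs (k = 2) it comes from a direct estimate,
  for the limit measure from Fubini at almost every a.\<close>

lemma integral_ln_radial_measure:
  assumes "k > 0" "r > 0" "a \<noteq> 0" "integrable (radial_measure k r) (\<lambda>z. ln (cmod (z - a)))"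
  shows "(LINT z|radial_measure k r. ln (cmod (z - a))) = radial_potential k r (cmod a)"
  using has_bochner_integral_ln_max_radial_measure[of k r "cmod a"] assms
  by (subst integral_ln_rotation_invariant)
     (auto simp: has_bochner_integral_iff finite_measure_radial_measure distr_radial_measure_rotate
           AE_radial_measure_cmod_neq)

section \<open>Local integrability of the logarithm in the plane\<close>

lemma abs_ln_le:
  assumes "x > (0::real)" shows "\<bar>ln x\<bar> \<le> 1 / x + x"
proof -
  have "1 / x > 0" using assms by simp
  then have "ln x \<le> x" "- ln x \<le> 1 / x" "0 < 1 / x"
    using ln_le_minus_one[of x] ln_le_minus_one[of "1/x"] assms
    by (simp_all add: ln_div)
  then show ?thesis using assms by linarith
qed

lemma ball_in_sets_borel [measurable]: "ball (z::'a::metric_space) r \<in> sets borel"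
  by simp

lemma nn_integral_lborel_translate:
  fixes f :: "complex \<Rightarrow> ennreal"
  assumes [measurable]: "f \<in> borel_measurable borel"
  shows "(\<integral>\<^sup>+x. f (a + x) \<partial>lborel) = (\<integral>\<^sup>+x. f x \<partial>lborel)"
  by (subst (2) lborel_distr_plus[of a, symmetric]) (simp add: nn_integral_distr)

text \<open>In polar coordinates about a, the Jacobian cancels the 1 / x of
  \<open>abs_ln_le\<close>. The bound involves z and a only through \<rho>, so it is uniform for a
  in a bounded set; this allows Fubini against measures of bounded support.\<close>

lemma nn_integral_abs_ln_le:
  fixes z a :: complex and R \<rho> :: real
  assumes \<rho>: "R + cmod (z - a) \<le> \<rho>" "\<rho> \<ge> 0"
  shows "(\<integral>\<^sup>+x. ennreal \<bar>ln (cmod (x - a))\<bar> * indicator (ball z R) x \<partial>lborel)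
    \<le> ennreal (2 * pi * (1 + \<rho>\<^sup>2) * \<rho>)"
proof -
  have "(\<integral>\<^sup>+x. ennreal \<bar>ln (cmod (x - a))\<bar> * indicator (ball z R) x \<partial>lborel)
      = (\<integral>\<^sup>+x. ennreal \<bar>ln (cmod (a + x - a))\<bar> * indicator (ball z R) (a + x) \<partial>lborel)"
    by (rule nn_integral_lborel_translate[symmetric]) measurable
  also have "\<dots> \<le> (\<integral>\<^sup>+x. ennreal \<bar>ln (cmod x)\<bar> * indicator {..<\<rho>} (cmod x) \<partial>lborel)"
  proof (intro nn_integral_mono)
    fix x
    have "cmod x < \<rho>" if "a + x \<in> ball z R"
    proof -
      have "cmod x \<le> cmod (z - a) + cmod (a + x - z)"
        using norm_triangle_ineq[of "z - a" "a + x - z"] by simp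
      with that \<rho> show ?thesis by (auto simp: dist_norm norm_minus_commute)
    qed
    then show "ennreal \<bar>ln (cmod (a + x - a))\<bar> * indicator (ball z R) (a + x)
        \<le> ennreal \<bar>ln (cmod x)\<bar> * indicator {..<\<rho>} (cmod x)"
      by (auto split: split_indicator)
  qed
  also have "\<dots> = (\<integral>\<^sup>+x. ennreal (2 * pi * x) * indicator {0..} x * (ennreal \<bar>ln x\<bar> * indicator {..<\<rho>} x) \<partial>lborel)"
    by (subst nn_integral_radial) auto
  also have "\<dots> \<le> (\<integral>\<^sup>+x. ennreal (2 * pi * (1 + \<rho>\<^sup>2)) * indicator {0..\<rho>} x \<partial>lborel)"
  proof (intro nn_integral_mono)
    fix x :: real
    show "ennreal (2 * pi * x) * indicator {0..} x * (ennreal \<bar>ln x\<bar> * indicator {..<\<rho>} x)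
        \<le> ennreal (2 * pi * (1 + \<rho>\<^sup>2)) * indicator {0..\<rho>} x"
    proof (cases "0 < x \<and> x < \<rho>")
      case True
      have "x * \<bar>ln x\<bar> \<le> x * (1 / x + x)"
        using True abs_ln_le[of x] by (intro mult_left_mono) auto
      also have "\<dots> = 1 + x\<^sup>2" using True by (simp add: field_simps power2_eq_square)
      also have "\<dots> \<le> 1 + \<rho>\<^sup>2" using True by (auto intro: power_mono)
      finally have "2 * pi * x * \<bar>ln x\<bar> \<le> 2 * pi * (1 + \<rho>\<^sup>2)" by simp
      then show ?thesis using True by (auto simp: ennreal_mult[symmetric] intro!: ennreal_leI)
    qed (auto simp: indicator_def)
  qed
  also have "\<dots> = ennreal (2 * pi * (1 + \<rho>\<^sup>2) * \<rho>)"
    using \<rho>(2) by (subst nn_integral_cmult_indicator) (auto simp: ennreal_mult[symmetric])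
  finally show ?thesis .
qed

lemma set_integrable_ln_ball: "set_integrable lborel (ball z R) (\<lambda>x. ln (cmod (x - a)))"
proof -
  define \<rho> where "\<rho> = max 0 (R + cmod (z - a))"
  have "(\<integral>\<^sup>+x. ennreal (norm (indicator (ball z R) x *\<^sub>R ln (cmod (x - a)))) \<partial>lborel)
      = (\<integral>\<^sup>+x. ennreal \<bar>ln (cmod (x - a))\<bar> * indicator (ball z R) x \<partial>lborel)"
    by (intro nn_integral_cong) (auto split: split_indicator)
  also have "\<dots> \<le> ennreal (2 * pi * (1 + \<rho>\<^sup>2) * \<rho>)"
    by (rule nn_integral_abs_ln_le) (auto simp: \<rho>_def)
  also have "\<dots> < \<infinity>" by simp
  finally show ?thesis
    unfolding set_integrable_def by (intro integrableI_bounded) auto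
qed

lemma set_integral_ln_ball:
  assumes "R > 0" "a \<noteq> z"
  shows "(LINT x:ball z R|lborel. ln (cmod (x - a))) = pi * radial_potential 2 R (cmod (a - z))"
proof -
  \<comment> \<open>The densities differ at the origin, where \<open>0 powr 0 = 0\<close>, so they
    agree only almost everywhere.\<close>
  have w: "AE x in lborel. ennreal (2 / (2 * pi) * cmod x powr (2 - 2) * indicator {z. cmod z < R} x)
      = ennreal (1 / pi * indicator (ball 0 R) x)"
    using AE_lborel_singleton[of "0::complex"] by eventually_elim (auto simp: indicator_def)
  have rm: "radial_measure 2 R = density lborel (\<lambda>x. ennreal (1 / pi * indicator (ball 0 R) x))"
    unfolding radial_measure_def by (rule density_cong[OF _ _ w]) auto
  have i: "integrable lborel (\<lambda>x. indicator (ball 0 R) x * ln (cmod (x - (a - z))))"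
    using set_integrable_ln_ball[of 0 R "a - z"] by (simp add: set_integrable_def)
  then have "integrable (radial_measure 2 R) (\<lambda>x. ln (cmod (x - (a - z))))"
    unfolding rm by (subst integrable_real_density) (auto simp: mult.assoc)
  from integral_ln_radial_measure[OF _ assms(1) _ this] assms(2)
  have "radial_potential 2 R (cmod (a - z)) = (LINT x|density lborel (\<lambda>x. ennreal (1 / pi * indicator (ball 0 R) x)). ln (cmod (x - (a - z))))"
    unfolding rm by simp
  then have "radial_potential 2 R (cmod (a - z)) = (LINT x|lborel. 1 / pi * indicator (ball 0 R) x * ln (cmod (x - (a - z))))"
    by (subst (asm) integral_real_density) auto
  also have "\<dots> = 1 / pi * (LINT x|lborel. indicator (ball 0 R) x * ln (cmod (x - (a - z))))"
    by (simp only: mult.assoc) simp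
  also have "(LINT x|lborel. indicator (ball 0 R) x * ln (cmod (x - (a - z))))
      = (LINT x|lborel. indicator (ball z R) (z + x) * ln (cmod (z + x - a)))"
    by (intro Bochner_Integration.integral_cong refl)
       (auto simp: dist_norm algebra_simps split: split_indicator)
  also have "\<dots> = (LINT x|distr lborel borel ((+) z). indicator (ball z R) x * ln (cmod (x - a)))"
    by (subst integral_distr) auto
  also have "\<dots> = (LINT x:ball z R|lborel. ln (cmod (x - a)))"
    by (simp add: lborel_distr_plus set_lebesgue_integral_def)
  finally show ?thesis by (simp add: field_simps)
qed

section \<open>Vague convergence from convergence of potentials\<close>

lemma borel_measurable_radial_potential [measurable]:
  "radial_potential k r \<in> borel_measurable borel"
  unfolding radial_potential_def[abs_def] by measurable

lemma radial_potential_2: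
  "r > 0 \<Longrightarrow> t \<ge> 0 \<Longrightarrow>
    radial_potential 2 r t = (if t < r then r\<^sup>2 * ln r - (r\<^sup>2 - t\<^sup>2) / 2 else r\<^sup>2 * ln t)"
  by (cases "t = 0") (auto simp: radial_potential_def)

text \<open>The sub-mean-value inequality of the logarithm over a disc whose centre has distance t
  from the singularity. For t < r it is ln q \<le> q - 1 with q = (t / r)^2; for t \<ge> r the
  logarithm is harmonic in the disc and equality holds.\<close>

lemma ln_le_radial_potential_2:
  assumes r: "r > 0" and t: "t > 0"
  shows "r\<^sup>2 * ln t \<le> radial_potential 2 r t"
proof (cases "t < r")
  case True
  have "ln ((t / r)\<^sup>2) \<le> (t / r)\<^sup>2 - 1"
    using r t by (intro ln_le_minus_one) auto
  then have "r\<^sup>2 * (2 * (ln t - ln r)) \<le> r\<^sup>2 * ((t / r)\<^sup>2 - 1)"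
    using r t by (intro mult_left_mono) (auto simp: ln_realpow ln_div)
  also have "\<dots> = t\<^sup>2 - r\<^sup>2" using r by (simp add: field_simps)
  finally show ?thesis using True r t by (simp add: radial_potential_2 field_simps)
qed (use r t in \<open>simp add: radial_potential_2\<close>)

text \<open>The logarithmic potential at distance \<open>t\<close> of the uniform distribution on a disc of radius
  \<open>s\<close> minus that of the uniform distribution on the concentric disc of radius \<open>s / 2\<close>.\<close>

definition tent :: "real \<Rightarrow> real \<Rightarrow> real" where
  "tent s t = radial_potential 2 s t / s\<^sup>2 - radial_potential 2 (s / 2) t / (s / 2)\<^sup>2"

lemma borel_measurable_tent [measurable]: "tent s \<in> borel_measurable borel"
  unfolding tent_def[abs_def] by measurable

lemma tent_eq:
  assumes "s > 0" "t \<ge> 0"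
  shows "tent s t = (if t < s / 2 then ln 2 - 3 * t\<^sup>2 / (2 * s\<^sup>2)
    else if t < s then ln s - ln t - (1 - (t / s)\<^sup>2) / 2 else 0)"
proof -
  have 1: "radial_potential 2 s t / s\<^sup>2 = (if t < s then ln s - (1 - (t / s)\<^sup>2) / 2 else ln t)" if "s > 0" for s
    using that assms(2) by (simp add: radial_potential_2 field_simps)
  have "s / 2 > 0" using assms by simp
  from 1[OF this] 1[OF assms(1)] assms show ?thesis
    unfolding tent_def
    by (auto simp: ln_div power_divide field_simps)
qed

text \<open>Nonnegativity reflects that disc means of the logarithm grow with the radius. The value
  1/8 is 1/2 - 3/8, from ln 2 \<ge> 1/2 and (t / s)^2 \<le> 1/4; it serves to make the integral of
  the tent positive.\<close>

lemma tent_bounds: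
  assumes s: "s > 0" and t: "t \<ge> 0"
  shows "0 \<le> tent s t" "tent s t \<le> 1" "t < s / 2 \<Longrightarrow> tent s t \<ge> 1 / 8" "t \<ge> s \<Longrightarrow> tent s t = 0"
proof -
  have ln2: "1 / 2 \<le> ln (2::real)" "ln 2 \<le> (1::real)"
    using ln_le_minus_one[of "1/2"] ln_le_minus_one[of "2"] by (auto simp: ln_div)
  have a: "1 / 8 \<le> tent s t" if "t < s / 2"
  proof -
    have "(t / s)\<^sup>2 \<le> (1/2)\<^sup>2"
      using that s t by (intro power_mono) (auto simp: field_simps)
    then have "3 * t\<^sup>2 / (2 * s\<^sup>2) \<le> 3 / 8" by (simp add: power_divide)
    with that s t ln2 show ?thesis by (simp add: tent_eq)
  qed
  then show "t < s / 2 \<Longrightarrow> tent s t \<ge> 1 / 8" .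
  show "t \<ge> s \<Longrightarrow> tent s t = 0"
    using s t by (simp add: tent_eq)
  have b: "0 \<le> tent s t \<and> tent s t \<le> 1" if "\<not> t < s / 2" "t < s"
  proof
    have t: "t > 0" using that s by simp
    have "ln ((t / s)\<^sup>2) \<le> (t / s)\<^sup>2 - 1" using s t by (intro ln_le_minus_one) auto
    then show "0 \<le> tent s t" using that s t by (simp add: tent_eq ln_realpow ln_div)
    have "ln (s / t) \<le> ln 2" using that s t by (intro ln_mono) (auto simp: field_simps)
    moreover have "(t / s)\<^sup>2 \<le> 1\<^sup>2" using that s t by (intro power_mono) auto
    moreover have "tent s t = ln (s / t) - (1 - (t / s)\<^sup>2) / 2"
      using that s t by (simp add: tent_eq ln_div)
    moreover have "(1 - q) / 2 \<ge> 0" if "q \<le> 1" for q :: real using that by simp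
    ultimately show "tent s t \<le> 1" using ln2(2) by (smt (verit) one_power2)
  qed
  have c: "tent s t \<le> 1" if "t < s / 2"
    using that s t ln2 by (simp add: tent_eq) (smt (verit) divide_nonneg_nonneg zero_le_power2)
  show "0 \<le> tent s t" "tent s t \<le> 1"
    using a b c \<open>t \<ge> s \<Longrightarrow> tent s t = 0\<close> by force+
qed

lemma integrable_tent:
  assumes s: "s > 0"
  shows "integrable lborel (\<lambda>z::complex. tent s (cmod (a - z)))"
proof (rule Bochner_Integration.integrable_bound[of lborel "\<lambda>z. indicator (ball a s) z :: real"])
  show "integrable lborel (indicator (ball a s) :: complex \<Rightarrow> real)"
    by (intro integrable_real_indicator) (auto simp: emeasure_lborel_complex_ball)
  show "AE x in lborel. norm (tent s (cmod (a - x))) \<le> norm (indicat_real (ball a s) x)"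
    using tent_bounds[OF s] by (auto simp: dist_norm split: split_indicator)
qed measurable

lemma integral_tent_shift:
  "(LINT z|lborel. tent s (cmod (a - z))) = (LINT z|lborel. tent s (cmod (z::complex)))"
proof -
  have "(LINT z|lborel. tent s (cmod z)) = (LINT z|distr lborel borel ((+) (-a)). tent s (cmod z))"
    by (simp only: lborel_distr_plus)
  also have "\<dots> = (LINT z|lborel. tent s (cmod (a - z)))"
    by (subst integral_distr) (auto simp: norm_minus_commute)
  finally show ?thesis by simp
qed

lemma integral_tent_pos:
  assumes s: "s > 0"
  shows "(LINT z|lborel. tent s (cmod (z::complex))) > 0"
proof -
  have "0 < pi * (s / 2)\<^sup>2 / 8" using s by simp
  also have "\<dots> = (LINT z|lborel. indicator (ball (0::complex) (s / 2)) z * (1 / 8))"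
    using emeasure_lborel_complex_ball[of 0 "s/2"] s by (simp add: measure_def)
  also have "\<dots> \<le> (LINT z|lborel. tent s (cmod (z::complex)))"
  proof (rule integral_mono)
    show "integrable lborel (\<lambda>z. indicator (ball (0::complex) (s / 2)) z * (1 / 8 :: real))"
      by (intro integrable_mult_left integrable_real_indicator) (auto simp: emeasure_lborel_complex_ball)
    show "integrable lborel (\<lambda>z::complex. tent s (cmod z))"
      using integrable_tent[OF s, of 0] by simp
  qed (use tent_bounds[OF s] in \<open>auto split: split_indicator\<close>)
  finally show ?thesis .
qed

section \<open>Tent means and vague convergence\<close>

definition tent_mean :: "real \<Rightarrow> complex measure \<Rightarrow> complex \<Rightarrow> real" where
  "tent_mean s \<mu> z = (LINT \<zeta>|\<mu>. tent s (cmod (\<zeta> - z)))"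

text \<open>Mass below one has to be allowed: a vanishing leading coefficient lowers the degree, and
  the zero polynomial and n = 0 give the null measure.\<close>

locale subprob_complex = finite_measure \<mu> for \<mu> :: "complex measure" +
  assumes sets_borel [simp, measurable_cong]: "sets \<mu> = sets borel"
    and mass_le_1: "measure \<mu> UNIV \<le> 1"
begin

lemma space_UNIV [simp]: "space \<mu> = UNIV"
  using sets_eq_imp_space_eq[OF sets_borel] by simp

lemma integrable_bounded:
  fixes f :: "complex \<Rightarrow> real"
  assumes [measurable]: "f \<in> borel_measurable borel" and "\<And>x. \<bar>f x\<bar> \<le> B"
  shows "integrable \<mu> f"
  using assms(2) by (intro integrable_const_bound[of _ B]) auto

lemma abs_integral_le:
  fixes f :: "complex \<Rightarrow> real"
  assumes [measurable]: "f \<in> borel_measurable borel" and B: "\<And>x. \<bar>f x\<bar> \<le> B"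
  shows "\<bar>integral\<^sup>L \<mu> f\<bar> \<le> B"
proof -
  have B0: "B \<ge> 0" by (rule order_trans[OF abs_ge_zero B[of 0]])
  have "\<bar>integral\<^sup>L \<mu> f\<bar> \<le> (LINT x|\<mu>. \<bar>f x\<bar>)" by (rule integral_abs_bound)
  also have "\<dots> \<le> (LINT x|\<mu>. B)"
    using B B0 by (intro integral_mono integrable_bounded[where B=B]) auto
  also have "\<dots> = B * measure \<mu> UNIV" by simp
  also have "\<dots> \<le> B * 1" using B0 mass_le_1 by (intro mult_left_mono) auto
  finally show ?thesis by simp
qed

lemma tent_mean_bounds:
  assumes "s > 0"
  shows "\<bar>tent_mean s \<mu> z\<bar> \<le> 1"
  unfolding tent_mean_def using tent_bounds[OF assms] by (intro abs_integral_le) auto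

lemma borel_measurable_tent_mean [measurable]: "tent_mean s \<mu> \<in> borel_measurable borel"
  unfolding tent_mean_def[abs_def] by measurable

text \<open>By Fubini the integral of g against the tent means is the integral against \<mu> of the
  convolution of g with the tent. The tent has integral \<tau> and lives on a disc of radius s, on
  which g differs from its value at the centre by at most \<epsilon>.\<close>

lemma integral_tent_mean_approx:
  fixes g :: "complex \<Rightarrow> real"
  assumes s: "s > 0" and g [measurable]: "g \<in> borel_measurable borel" and gi: "integrable lborel g"
    and B: "\<And>x. \<bar>g x\<bar> \<le> B"
    and \<epsilon>: "\<And>x y. cmod (x - y) < s \<Longrightarrow> \<bar>g x - g y\<bar> \<le> \<epsilon>"
  defines "\<tau> \<equiv> (LINT z|lborel. tent s (cmod (z::complex)))"
  shows "\<bar>(LINT z|lborel. g z * tent_mean s \<mu> z) - \<tau> * integral\<^sup>L \<mu> g\<bar> \<le> \<tau> * \<epsilon>"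
proof -
  interpret P: pair_sigma_finite \<mu> "lborel :: complex measure" ..
  have \<tau>: "\<tau> > 0" unfolding \<tau>_def by (rule integral_tent_pos[OF s])
  have B0: "B \<ge> 0" by (rule order_trans[OF abs_ge_zero B[of 0]])
  have gt: "integrable lborel (\<lambda>z. g z * tent s (cmod (\<zeta> - z)))" for \<zeta>
  proof (rule Bochner_Integration.integrable_bound[OF gi])
    show "AE x in lborel. norm (g x * tent s (cmod (\<zeta> - x))) \<le> norm (g x)"
      using tent_bounds[OF s] by (auto simp: abs_mult intro!: mult_left_le)
  qed measurable
  have "integrable (\<mu> \<Otimes>\<^sub>M lborel) (\<lambda>(\<zeta>, z). g z * tent s (cmod (\<zeta> - z)))"
  proof (rule P.Fubini_integrable)
    have "\<bar>LINT z|lborel. norm (g z * tent s (cmod (\<zeta> - z)))\<bar> \<le> (LINT z|lborel. \<bar>g z\<bar>)" for \<zeta>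
    proof -
      have "(LINT z|lborel. norm (g z * tent s (cmod (\<zeta> - z)))) \<le> (LINT z|lborel. \<bar>g z\<bar>)"
        using tent_bounds[OF s] gi
        by (intro integral_mono integrable_norm gt integrable_abs) (auto simp: abs_mult intro!: mult_left_le)
      then show ?thesis by simp
    qed
    then show "integrable \<mu> (\<lambda>\<zeta>. LINT z|lborel. norm (case (\<zeta>, z) of (\<zeta>, z) \<Rightarrow> g z * tent s (cmod (\<zeta> - z))))"
      by (intro integrable_bounded[where B="LINT z|lborel. \<bar>g z\<bar>"]) auto
    show "AE \<zeta> in \<mu>. integrable lborel (\<lambda>z. case (\<zeta>, z) of (\<zeta>, z) \<Rightarrow> g z * tent s (cmod (\<zeta> - z)))"
      using gt by simp
  qed measurable
  from P.Fubini_integral[OF this]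
  have eq: "(LINT z|lborel. g z * tent_mean s \<mu> z) = (LINT \<zeta>|\<mu>. LINT z|lborel. g z * tent s (cmod (\<zeta> - z)))"
    by (simp add: tent_mean_def)
  have bd: "\<bar>(LINT z|lborel. g z * tent s (cmod (\<zeta> - z))) - \<tau> * g \<zeta>\<bar> \<le> \<tau> * \<epsilon>" for \<zeta>
  proof -
    have t: "integrable lborel (\<lambda>z. tent s (cmod (\<zeta> - z)))" by (rule integrable_tent[OF s])
    have "\<tau> * g \<zeta> = (LINT z|lborel. g \<zeta> * tent s (cmod (\<zeta> - z)))"
      by (simp add: \<tau>_def integral_tent_shift)
    then have "(LINT z|lborel. g z * tent s (cmod (\<zeta> - z))) - \<tau> * g \<zeta>
        = (LINT z|lborel. (g z - g \<zeta>) * tent s (cmod (\<zeta> - z)))"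
      using gt t by (simp add: left_diff_distrib)
    also have "\<bar>\<dots>\<bar> \<le> (LINT z|lborel. \<bar>(g z - g \<zeta>) * tent s (cmod (\<zeta> - z))\<bar>)"
      by (rule integral_abs_bound)
    also have "\<dots> \<le> (LINT z|lborel. \<epsilon> * tent s (cmod (\<zeta> - z)))"
    proof (rule integral_mono)
      show "integrable lborel (\<lambda>z. \<bar>(g z - g \<zeta>) * tent s (cmod (\<zeta> - z))\<bar>)"
        using gt t by (intro integrable_abs) (simp add: left_diff_distrib)
      show "integrable lborel (\<lambda>z. \<epsilon> * tent s (cmod (\<zeta> - z)))" using t by simp
      show "\<bar>(g z - g \<zeta>) * tent s (cmod (\<zeta> - z))\<bar> \<le> \<epsilon> * tent s (cmod (\<zeta> - z))" for z
        using \<epsilon>[of z \<zeta>] tent_bounds[OF s, of "cmod (\<zeta> - z)"]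
        by (cases "cmod (\<zeta> - z) < s") (auto simp: abs_mult norm_minus_commute intro!: mult_right_mono)
    qed
    also have "\<dots> = \<tau> * \<epsilon>" by (simp add: \<tau>_def integral_tent_shift)
    finally show ?thesis .
  qed
  have gm: "integrable \<mu> (\<lambda>\<zeta>. \<tau> * g \<zeta>)"
    using integrable_bounded[OF g B] by simp
  have dm: "integrable \<mu> (\<lambda>\<zeta>. (LINT z|lborel. g z * tent s (cmod (\<zeta> - z))) - \<tau> * g \<zeta>)"
    using bd by (intro integrable_bounded[where B="\<tau> * \<epsilon>"]) auto
  have "(LINT z|lborel. g z * tent_mean s \<mu> z) - \<tau> * integral\<^sup>L \<mu> g
     = (LINT \<zeta>|\<mu>. (LINT z|lborel. g z * tent s (cmod (\<zeta> - z))) - \<tau> * g \<zeta>)"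
    using Bochner_Integration.integrable_add[OF dm gm] gm by (simp add: eq)
  also have "\<bar>\<dots>\<bar> \<le> \<tau> * \<epsilon>"
    using bd by (intro abs_integral_le) auto
  finally show ?thesis .
qed

end

text \<open>Convolutions with tents approximate a test function uniformly.\<close>

lemma tendsto_integral_of_tent_mean:
  fixes \<mu> :: "nat \<Rightarrow> complex measure" and g :: "complex \<Rightarrow> real"
  assumes \<mu>: "\<And>n. subprob_complex (\<mu> n)" and \<nu>: "subprob_complex \<nu>"
    and conv: "\<And>s. s > 0 \<Longrightarrow> AE z in lborel. (\<lambda>n. tent_mean s (\<mu> n) z) \<longlonglongrightarrow> tent_mean s \<nu> z"
    and g: "continuous_on UNIV g" and supp: "compact (closure {z. g z \<noteq> 0})"
  shows "(\<lambda>n. integral\<^sup>L (\<mu> n) g) \<longlonglongrightarrow> integral\<^sup>L \<nu> g"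
proof -
  interpret \<nu>: subprob_complex \<nu> by fact
  have [measurable]: "g \<in> borel_measurable borel"
    using g by (rule borel_measurable_continuous_onI)
  obtain R where R: "\<And>z. g z \<noteq> 0 \<Longrightarrow> cmod z \<le> R"
    using compact_imp_bounded[OF supp] closure_subset[of "{z. g z \<noteq> 0}"]
    by (auto simp: bounded_iff)
  have cg: "continuous_on (cball 0 (max R 0 + 1)) g" using g by (rule continuous_on_subset) auto
  have "compact (g ` cball 0 (max R 0 + 1))"
    by (rule compact_continuous_image[OF cg]) auto
  then obtain B where B': "\<And>z. z \<in> cball 0 (max R 0 + 1) \<Longrightarrow> \<bar>g z\<bar> \<le> B"
    using compact_imp_bounded by (force simp: bounded_iff)
  have B: "\<bar>g z\<bar> \<le> B" for z
  proof (cases "g z = 0")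
    case True
    then show ?thesis using B'[of 0] by (simp; smt (verit))
  next
    case False
    then show ?thesis using B'[of z] R[of z] by auto
  qed
  have gi: "integrable lborel g"
  proof -
    have "integrable lborel (\<lambda>x. indicator (cball 0 (max R 0 + 1)) x *\<^sub>R g x)"
      by (rule borel_integrable_compact[OF _ cg]) auto
    moreover have "(\<lambda>x. indicator (cball 0 (max R 0 + 1)) x *\<^sub>R g x) = g"
      using R by (force simp: indicator_def)
    ultimately show ?thesis by simp
  qed
  have uc: "uniformly_continuous_on (cball 0 (max R 0 + 1)) g"
    by (rule compact_uniformly_continuous[OF cg]) auto
  show ?thesis
  proof (rule LIMSEQ_I)
    fix \<epsilon> :: real assume "\<epsilon> > 0"
    define e where "e = \<epsilon> / 3"
    have e: "e > 0" using \<open>\<epsilon> > 0\<close> by (simp add: e_def)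
    obtain d where d: "d > 0" "\<And>x y. x \<in> cball 0 (max R 0 + 1) \<Longrightarrow> y \<in> cball 0 (max R 0 + 1) \<Longrightarrow> dist y x < d \<Longrightarrow> dist (g y) (g x) < e"
      using uc e unfolding uniformly_continuous_on_def by metis
    \<comment> \<open>The margin 1 in the radius and s \<le> 1 work together: if one of two points
      at distance below s leaves the larger disc, both lie outside the support of g.\<close>
    define s where "s = min d 1"
    have s: "s > 0" using d by (simp add: s_def)
    have \<epsilon>: "\<bar>g x - g y\<bar> \<le> e" if "cmod (x - y) < s" for x y
    proof (cases "cmod x \<le> max R 0 + 1 \<and> cmod y \<le> max R 0 + 1")
      case True
      then show ?thesis using d(2)[of y x] that by (auto simp: dist_norm s_def)
    next
      case False
      then have "cmod x > R" "cmod y > R"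
        using that norm_triangle_ineq2[of x y] norm_triangle_ineq2[of y x]
        by (auto simp: s_def norm_minus_commute)
      then have "g x = 0" "g y = 0" using R by force+
      then show ?thesis using e by simp
    qed
    define \<tau> where "\<tau> = (LINT z|lborel. tent s (cmod (z::complex)))"
    have \<tau>: "\<tau> > 0" unfolding \<tau>_def by (rule integral_tent_pos[OF s])
    \<comment> \<open>Masses at most 1 and tents at most 1 bound the tent means by 1, so the
      absolute value of g dominates, and convergence at almost every point is enough.\<close>
    have lim: "(\<lambda>n. LINT z|lborel. g z * tent_mean s (\<mu> n) z) \<longlonglongrightarrow> (LINT z|lborel. g z * tent_mean s \<nu> z)"
    proof (rule integral_dominated_convergence[where w="\<lambda>z. \<bar>g z\<bar>"])
      show "AE z in lborel. (\<lambda>n. g z * tent_mean s (\<mu> n) z) \<longlonglongrightarrow> g z * tent_mean s \<nu> z"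
        using conv[OF s] by eventually_elim (intro tendsto_intros)
      show "(\<lambda>z. g z * tent_mean s (\<mu> n) z) \<in> borel_measurable lborel" for n
        using subprob_complex.borel_measurable_tent_mean[OF \<mu>, of s n] by measurable
      show "AE z in lborel. norm (g z * tent_mean s (\<mu> n) z) \<le> \<bar>g z\<bar>" for n
        using subprob_complex.tent_mean_bounds[OF \<mu> s] by (auto simp: abs_mult intro!: mult_left_le)
    qed (use gi in auto)
    have te: "0 < \<tau> * e" using \<tau> e by simp
    obtain N where N: "\<And>n. n \<ge> N \<Longrightarrow>
        \<bar>(LINT z|lborel. g z * tent_mean s (\<mu> n) z) - (LINT z|lborel. g z * tent_mean s \<nu> z)\<bar> < \<tau> * e"
      using LIMSEQ_D[OF lim te] unfolding real_norm_def by auto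
    show "\<exists>N. \<forall>n\<ge>N. norm (integral\<^sup>L (\<mu> n) g - integral\<^sup>L \<nu> g) < \<epsilon>"
    proof (intro exI allI impI)
      fix n assume "n \<ge> N"
      have 1: "\<bar>(LINT z|lborel. g z * tent_mean s (\<mu> n) z) - \<tau> * integral\<^sup>L (\<mu> n) g\<bar> \<le> \<tau> * e"
        unfolding \<tau>_def using s gi B \<epsilon>
        by (intro subprob_complex.integral_tent_mean_approx[OF \<mu>]) auto
      have 2: "\<bar>(LINT z|lborel. g z * tent_mean s \<nu> z) - \<tau> * integral\<^sup>L \<nu> g\<bar> \<le> \<tau> * e"
        unfolding \<tau>_def using s gi B \<epsilon>
        by (intro \<nu>.integral_tent_mean_approx) auto
      have "\<tau> * \<bar>integral\<^sup>L (\<mu> n) g - integral\<^sup>L \<nu> g\<bar> = \<bar>\<tau> * integral\<^sup>L (\<mu> n) g - \<tau> * integral\<^sup>L \<nu> g\<bar>"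
        using \<tau> by (simp add: right_diff_distrib[symmetric] abs_mult)
      also have "\<dots> < \<tau> * \<epsilon>"
      proof -
        have "\<tau> * \<epsilon> = \<tau> * e + \<tau> * e + \<tau> * e" by (simp add: e_def)
        with 1 2 N[OF \<open>n \<ge> N\<close>] show ?thesis
          unfolding abs_le_iff abs_less_iff by linarith
      qed
      finally show "norm (integral\<^sup>L (\<mu> n) g - integral\<^sup>L \<nu> g) < \<epsilon>" using \<tau> by simp
    qed
  qed
qed

section \<open>Logarithmic potentials and their disc means\<close>

definition log_potential :: "complex measure \<Rightarrow> complex \<Rightarrow> real" where
  "log_potential \<mu> x = (LINT \<zeta>|\<mu>. ln (cmod (x - \<zeta>)))"

context subprob_complex
begin

lemma borel_measurable_log_potential [measurable]: "log_potential \<mu> \<in> borel_measurable borel"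
  unfolding log_potential_def[abs_def] by measurable

text \<open>All parts follow from joint integrability on the disc times \<mu>, which holds because
  the integral over x is bounded uniformly on the bounded support. The last two use the closed form
  of the disc integral, in which the singularity must not be the centre.\<close>

lemma log_potential_ball:
  assumes bdd: "AE \<zeta> in \<mu>. cmod \<zeta> \<le> K" and R: "R > 0"
  shows "AE x in lborel. x \<in> ball z R \<longrightarrow> integrable \<mu> (\<lambda>\<zeta>. ln (cmod (x - \<zeta>)))"
    and "set_integrable lborel (ball z R) (log_potential \<mu>)"
    and "AE \<zeta> in \<mu>. \<zeta> \<noteq> z \<Longrightarrow> integrable \<mu> (\<lambda>\<zeta>. radial_potential 2 R (cmod (\<zeta> - z)))"
    and "AE \<zeta> in \<mu>. \<zeta> \<noteq> z \<Longrightarrow> (LINT x:ball z R|lborel. log_potential \<mu> x)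
      = pi * (LINT \<zeta>|\<mu>. radial_potential 2 R (cmod (\<zeta> - z)))"
proof -
  interpret P: pair_sigma_finite "lborel :: complex measure" \<mu> ..
  define F where "F x \<zeta> = indicator (ball z R) x * ln (cmod (x - \<zeta>))" for x \<zeta> :: complex
  define \<rho> where "\<rho> = R + cmod z + max 0 K"
  have \<rho>: "\<rho> \<ge> 0" using R by (simp add: \<rho>_def)
  have [measurable]: "(\<lambda>(x, \<zeta>). F x \<zeta>) \<in> borel_measurable (lborel \<Otimes>\<^sub>M \<mu>)"
    unfolding F_def case_prod_beta by measurable
  have int: "integrable (lborel \<Otimes>\<^sub>M \<mu>) (\<lambda>(x, \<zeta>). F x \<zeta>)"
  proof (rule integrableI_bounded)
    have "(\<integral>\<^sup>+p. ennreal (norm (case p of (x, \<zeta>) \<Rightarrow> F x \<zeta>)) \<partial>(lborel \<Otimes>\<^sub>M \<mu>))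
        = (\<integral>\<^sup>+\<zeta>. \<integral>\<^sup>+x. ennreal (norm (F x \<zeta>)) \<partial>lborel \<partial>\<mu>)"
      by (subst P.nn_integral_snd[symmetric]) auto
    also have "\<dots> \<le> (\<integral>\<^sup>+\<zeta>. ennreal (2 * pi * (1 + \<rho>\<^sup>2) * \<rho>) \<partial>\<mu>)"
      using bdd
    proof (intro nn_integral_mono_AE, eventually_elim)
      case (elim \<zeta>)
      have "(\<integral>\<^sup>+x. ennreal (norm (F x \<zeta>)) \<partial>lborel)
          = (\<integral>\<^sup>+x. ennreal \<bar>ln (cmod (x - \<zeta>))\<bar> * indicator (ball z R) x \<partial>lborel)"
        by (intro nn_integral_cong) (auto simp: F_def split: split_indicator)
      also have "\<dots> \<le> ennreal (2 * pi * (1 + \<rho>\<^sup>2) * \<rho>)"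
        using elim norm_triangle_ineq4[of z \<zeta>] by (intro nn_integral_abs_ln_le \<rho>) (auto simp: \<rho>_def)
      finally show ?case .
    qed
    also have "\<dots> < \<infinity>"
      by (simp add: emeasure_eq_measure ennreal_mult_less_top)
    finally show "(\<integral>\<^sup>+p. ennreal (norm (case p of (x, \<zeta>) \<Rightarrow> F x \<zeta>)) \<partial>(lborel \<Otimes>\<^sub>M \<mu>)) < \<infinity>" .
  qed measurable
  have fst: "AE x in lborel. integrable \<mu> (F x)"
    using P.AE_integrable_fst[OF int] .
  then show "AE x in lborel. x \<in> ball z R \<longrightarrow> integrable \<mu> (\<lambda>\<zeta>. ln (cmod (x - \<zeta>)))"
    by eventually_elim (auto simp: F_def[abs_def])
  have Fl: "(LINT \<zeta>|\<mu>. F x \<zeta>) = indicator (ball z R) x *\<^sub>R log_potential \<mu> x" for x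
    by (simp add: F_def log_potential_def)
  show "set_integrable lborel (ball z R) (log_potential \<mu>)"
    using P.integrable_fst[OF int] by (simp add: Fl set_integrable_def)
  {
    assume ne: "AE \<zeta> in \<mu>. \<zeta> \<noteq> z"
    have snd: "AE \<zeta> in \<mu>. (LINT x|lborel. F x \<zeta>) = pi * radial_potential 2 R (cmod (\<zeta> - z))"
      using ne by eventually_elim
        (use set_integral_ln_ball[OF R] in \<open>simp add: F_def set_lebesgue_integral_def\<close>)
    have "integrable \<mu> (\<lambda>\<zeta>. LINT x|lborel. F x \<zeta>)"
      by (rule P.integrable_snd[OF int])
    then have "integrable \<mu> (\<lambda>\<zeta>. pi * radial_potential 2 R (cmod (\<zeta> - z)))"
      by (subst (asm) integrable_cong_AE[OF _ _ snd]) auto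
    then show "integrable \<mu> (\<lambda>\<zeta>. radial_potential 2 R (cmod (\<zeta> - z)))" by simp
    have "(LINT x:ball z R|lborel. log_potential \<mu> x) = (LINT x|lborel. LINT \<zeta>|\<mu>. F x \<zeta>)"
      by (simp add: Fl set_lebesgue_integral_def)
    also have "\<dots> = (LINT \<zeta>|\<mu>. LINT x|lborel. F x \<zeta>)"
      by (rule P.Fubini_integral[OF int, symmetric])
    also have "\<dots> = (LINT \<zeta>|\<mu>. pi * radial_potential 2 R (cmod (\<zeta> - z)))"
      by (rule integral_cong_AE[OF _ _ snd]) auto
    finally show "(LINT x:ball z R|lborel. log_potential \<mu> x)
      = pi * (LINT \<zeta>|\<mu>. radial_potential 2 R (cmod (\<zeta> - z)))" by simp
  }
qed

text \<open>Integrates \<open>ln_le_radial_potential_2\<close> over \<mu>. Integrability at the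
  centre matters: without it \<open>log_potential \<mu> z\<close> would be the default value 0 and
  carry no information.\<close>

lemma submean:
  assumes bdd: "AE \<zeta> in \<mu>. cmod \<zeta> \<le> K" and R: "R > 0" and ne: "AE \<zeta> in \<mu>. \<zeta> \<noteq> z"
    and int: "integrable \<mu> (\<lambda>\<zeta>. ln (cmod (z - \<zeta>)))"
  shows "pi * R\<^sup>2 * log_potential \<mu> z \<le> (LINT x:ball z R|lborel. log_potential \<mu> x)"
proof -
  have "R\<^sup>2 * log_potential \<mu> z = (LINT \<zeta>|\<mu>. R\<^sup>2 * ln (cmod (z - \<zeta>)))"
    by (simp add: log_potential_def)
  also have "\<dots> \<le> (LINT \<zeta>|\<mu>. radial_potential 2 R (cmod (\<zeta> - z)))"
  proof (rule integral_mono_AE)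
    show "AE \<zeta> in \<mu>. R\<^sup>2 * ln (cmod (z - \<zeta>)) \<le> radial_potential 2 R (cmod (\<zeta> - z))"
      using ne by eventually_elim
        (use ln_le_radial_potential_2[OF R] in \<open>auto simp: norm_minus_commute\<close>)
  qed (use int log_potential_ball(3)[OF bdd R ne] in auto)
  finally show ?thesis
    using log_potential_ball(4)[OF bdd R ne] by (simp add: mult.assoc)
qed

text \<open>The passage from the potential back to the measure, a role usually played by the
  distributional Laplacian.\<close>

lemma tent_mean_eq:
  assumes bdd: "AE \<zeta> in \<mu>. cmod \<zeta> \<le> K" and s: "s > 0" and ne: "AE \<zeta> in \<mu>. \<zeta> \<noteq> z"
  shows "tent_mean s \<mu> z = (LINT x:ball z s|lborel. log_potential \<mu> x) / (pi * s\<^sup>2)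
    - (LINT x:ball z (s / 2)|lborel. log_potential \<mu> x) / (pi * (s / 2)\<^sup>2)"
proof -
  have s2: "s / 2 > 0" using s by simp
  show ?thesis
    unfolding tent_mean_def tent_def log_potential_ball(4)[OF bdd s ne] log_potential_ball(4)[OF bdd s2 ne]
    using log_potential_ball(3)[OF bdd s ne] log_potential_ball(3)[OF bdd s2 ne]
    by (subst Bochner_Integration.integral_diff) auto
qed

end

text \<open>Averaging over centres: by Tonelli each x is counted with weight pi s^2, the area of the
  set of centres within s of it, and all these centres lie in \<open>ball 0 (R + s)\<close>. This
  replaces a covering by small discs whose overlaps would have to be controlled.\<close>

lemma nn_integral_ball_le_of_local:
  fixes h :: "complex \<Rightarrow> ennreal"
  assumes [measurable]: "h \<in> borel_measurable borel" and s: "s > 0" and R: "R \<ge> 0"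
    and local: "\<And>z. z \<in> ball 0 (R + s) \<Longrightarrow> (\<integral>\<^sup>+x. h x * indicator (ball z s) x \<partial>lborel) \<le> ennreal (pi * s\<^sup>2 * C)"
    and C: "C \<ge> 0"
  shows "(\<integral>\<^sup>+x. h x * indicator (ball 0 R) x \<partial>lborel) \<le> ennreal (pi * (R + s)\<^sup>2 * C)"
proof -
  have [measurable]: "Measurable.pred (borel \<Otimes>\<^sub>M borel) (\<lambda>p. cmod (fst p - snd p) < s)"
    by measurable
  have "ennreal (pi * s\<^sup>2) * (\<integral>\<^sup>+x. h x * indicator (ball 0 R) x \<partial>lborel)
      = (\<integral>\<^sup>+x. h x * indicator (ball 0 R) x * emeasure lborel (ball x s) \<partial>lborel)"
    using s by (subst nn_integral_cmult[symmetric]) (auto simp: emeasure_lborel_complex_ball mult_ac)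
  also have "\<dots> = (\<integral>\<^sup>+x. \<integral>\<^sup>+z. h x * indicator (ball 0 R) x * indicator {p. cmod (fst p - snd p) < s} (x, z) \<partial>lborel \<partial>lborel)"
  proof (intro nn_integral_cong)
    fix x
    have "(\<integral>\<^sup>+z. h x * indicator (ball 0 R) x * indicator {p. cmod (fst p - snd p) < s} (x, z) \<partial>lborel)
       = (\<integral>\<^sup>+z. h x * indicator (ball 0 R) x * indicator (ball x s) z \<partial>lborel)"
      by (intro nn_integral_cong) (auto simp: dist_norm indicator_def)
    also have "\<dots> = h x * indicator (ball 0 R) x * emeasure lborel (ball x s)"
      by (subst nn_integral_cmult_indicator) auto
    finally show "h x * indicator (ball 0 R) x * emeasure lborel (ball x s) =
       (\<integral>\<^sup>+z. h x * indicator (ball 0 R) x * indicator {p. cmod (fst p - snd p) < s} (x, z) \<partial>lborel)" ..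
  qed
  also have "\<dots> = (\<integral>\<^sup>+z. \<integral>\<^sup>+x. h x * indicator (ball 0 R) x * indicator {p. cmod (fst p - snd p) < s} (x, z) \<partial>lborel \<partial>lborel)"
    by (rule lborel_pair.Fubini'[of "\<lambda>x z. h x * indicator (ball 0 R) x * indicator {p. cmod (fst p - snd p) < s} (x, z)", symmetric])
       (simp add: case_prod_beta)
  also have "\<dots> \<le> (\<integral>\<^sup>+z. ennreal (pi * s\<^sup>2 * C) * indicator (ball (0::complex) (R + s)) z \<partial>lborel)"
  proof (intro nn_integral_mono)
    fix z :: complex
    show "(\<integral>\<^sup>+x. h x * indicator (ball 0 R) x * indicator {p. cmod (fst p - snd p) < s} (x, z) \<partial>lborel)
      \<le> ennreal (pi * s\<^sup>2 * C) * indicator (ball 0 (R + s)) z"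
    proof (cases "z \<in> ball 0 (R + s)")
      case True
      have "(\<integral>\<^sup>+x. h x * indicator (ball 0 R) x * indicator {p. cmod (fst p - snd p) < s} (x, z) \<partial>lborel)
         \<le> (\<integral>\<^sup>+x. h x * indicator (ball z s) x \<partial>lborel)"
        by (intro nn_integral_mono) (auto simp: dist_norm norm_minus_commute split: split_indicator)
      also have "\<dots> \<le> ennreal (pi * s\<^sup>2 * C)" by (rule local[OF True])
      finally show ?thesis using True by simp
    next
      case False
      have "h x * indicator (ball 0 R) x * indicator {p. cmod (fst p - snd p) < s} (x, z) = 0" for x
        using False norm_triangle_ineq2[of z x]
        by (auto simp: norm_minus_commute split: split_indicator)
      then have "(\<integral>\<^sup>+x. h x * indicator (ball 0 R) x * indicator {p. cmod (fst p - snd p) < s} (x, z) \<partial>lborel)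
          = (\<integral>\<^sup>+(x::complex). 0 \<partial>lborel)"
        by (intro nn_integral_cong)
      then show ?thesis by simp
    qed
  qed
  also have "\<dots> = ennreal (pi * s\<^sup>2 * C) * ennreal (pi * (R + s)\<^sup>2)"
    using s R by (subst nn_integral_cmult_indicator) (auto simp: emeasure_lborel_complex_ball)
  also have "\<dots> = ennreal (pi * s\<^sup>2) * ennreal (pi * (R + s)\<^sup>2 * C)"
    using s R C by (simp add: ennreal_mult[symmetric] mult_ac)
  finally show ?thesis
    using s by (subst (asm) ennreal_mult_le_mult_iff) auto
qed


section \<open>Convergence of disc means\<close>

lemma set_integrable_ball_continuous:
  fixes f :: "complex \<Rightarrow> real"
  assumes "continuous_on UNIV f"
  shows "set_integrable lborel (ball z r) f"
proof (rule set_integrable_subset)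
  show "set_integrable lborel (cball z r) f"
    unfolding set_integrable_def
    using assms by (intro borel_integrable_compact) (auto intro: continuous_on_subset)
qed auto

lemma measure_lborel_complex_ball: "r \<ge> 0 \<Longrightarrow> measure lborel (ball (z::complex) r) = pi * r\<^sup>2"
  by (simp add: measure_def emeasure_lborel_complex_ball)

text \<open>The upper bound makes \<open>h = \<phi> + \<epsilon> - V\<close> nonnegative almost
  everywhere, so only its integral has to be bounded from above. Near every point there is a good
  centre y, and \<open>submean\<close> at y bounds the integral of V from below over a disc
  containing the small disc in question.\<close>

lemma set_integral_log_potential_tendsto:
  fixes \<mu> :: "nat \<Rightarrow> complex measure" and c K :: "nat \<Rightarrow> real" and \<phi> :: "complex \<Rightarrow> real"
  assumes \<mu>: "\<And>n. subprob_complex (\<mu> n)" and bdd: "\<And>n. AE \<zeta> in \<mu> n. cmod \<zeta> \<le> K n"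
    and \<phi>: "continuous_on UNIV \<phi>"
    and upper: "\<And>R \<epsilon>. \<epsilon> > 0 \<Longrightarrow> \<forall>\<^sub>F n in sequentially.
      AE x in lborel. x \<in> ball 0 R \<longrightarrow> c n + log_potential (\<mu> n) x \<le> \<phi> x + \<epsilon>"
    and lower: "\<And>z r \<epsilon>. r > 0 \<Longrightarrow> \<epsilon> > 0 \<Longrightarrow> \<forall>\<^sub>F n in sequentially. \<exists>y\<in>ball z r.
      (AE \<zeta> in \<mu> n. \<zeta> \<noteq> y) \<and> integrable (\<mu> n) (\<lambda>\<zeta>. ln (cmod (y - \<zeta>))) \<and>
      \<phi> z - \<epsilon> \<le> c n + log_potential (\<mu> n) y"
    and r: "r > 0"
  shows "(\<lambda>n. LINT x:ball z r|lborel. c n + log_potential (\<mu> n) x) \<longlonglongrightarrow> (LINT x:ball z r|lborel. \<phi> x)"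
proof (rule LIMSEQ_I)
  fix \<delta> :: real assume \<delta>: "\<delta> > 0"
  define R where "R = cmod z + r"
  have R: "R > 0" using r unfolding R_def by (smt (verit) norm_ge_zero)
  \<comment> \<open>16 is 4 times 4: the discs about the good centres have radius 2 s, hence area 4
    pi s^2, and the mean of h over them is at most 4 \<epsilon>. The radius R + 1 leaves room for s
    \<le> 1.\<close>
  define A where "A = 16 * (pi * (R + 1)\<^sup>2)"
  have A: "A > 0" using R by (simp add: A_def)
  define \<epsilon> where "\<epsilon> = \<delta> / (2 * A)"
  have \<epsilon>: "\<epsilon> > 0" using A \<delta> by (simp add: \<epsilon>_def)
  have [measurable]: "\<phi> \<in> borel_measurable borel"
    using \<phi> by (rule borel_measurable_continuous_onI)
  have lp_meas [measurable]: "log_potential (\<mu> n) \<in> borel_measurable borel" for n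
    using subprob_complex.borel_measurable_log_potential[OF \<mu>] .
  have "uniformly_continuous_on (cball 0 (R + 4)) \<phi>"
    by (rule compact_uniformly_continuous[OF continuous_on_subset[OF \<phi>]]) auto
  then obtain d where d: "d > 0" "\<And>x y. x \<in> cball 0 (R + 4) \<Longrightarrow> y \<in> cball 0 (R + 4) \<Longrightarrow> dist y x < d \<Longrightarrow> dist (\<phi> y) (\<phi> x) < \<epsilon>"
    using \<epsilon> unfolding uniformly_continuous_on_def by metis
  \<comment> \<open>A disc of radius 2 s about a centre within s of \<open>z'\<close> stays within 3
    s of \<open>z'\<close>. Hence 3 s < d for the oscillation of \<phi>, and the radius R + 4, which
    is at least R + 1 + 3 s.\<close>
  define s where "s = min (d / 4) 1"
  have s: "s > 0" "s \<le> 1" "3 * s < d" using d(1) by (auto simp: s_def)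
  have \<phi>_close: "\<bar>\<phi> y - \<phi> x\<bar> < \<epsilon>" if "cmod x < R + 1" "cmod (y - x) < 3 * s" for x y
    using d(2)[of x y] that s norm_triangle_ineq[of x "y - x"] by (auto simp: dist_norm)
  have "\<forall>e>0. \<exists>k. finite k \<and> cball (0::complex) (R + 1) \<subseteq> (\<Union>x\<in>k. ball x e)"
    using compact_cball[of "0::complex" "R + 1"] unfolding compact_eq_totally_bounded by (rule conjunct2)
  moreover have "s / 2 > 0" using s by simp
  ultimately obtain k where k: "finite k" "cball (0::complex) (R + 1) \<subseteq> (\<Union>x\<in>k. ball x (s / 2))" by blast
  have "\<forall>\<^sub>F n in sequentially. \<forall>i\<in>k. \<exists>y\<in>ball i (s / 2).
      (AE \<zeta> in \<mu> n. \<zeta> \<noteq> y) \<and> integrable (\<mu> n) (\<lambda>\<zeta>. ln (cmod (y - \<zeta>))) \<and>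
      \<phi> i - \<epsilon> \<le> c n + log_potential (\<mu> n) y"
    using s \<epsilon> by (intro eventually_ball_finite k(1) ballI lower) auto
  moreover have "\<forall>\<^sub>F n in sequentially. AE x in lborel. x \<in> ball 0 (R + 4) \<longrightarrow> c n + log_potential (\<mu> n) x \<le> \<phi> x + \<epsilon>"
    by (rule upper[OF \<epsilon>])
  ultimately have "\<forall>\<^sub>F n in sequentially. norm ((LINT x:ball z r|lborel. c n + log_potential (\<mu> n) x) - (LINT x:ball z r|lborel. \<phi> x)) < \<delta>"
  proof eventually_elim
    case (elim n)
    interpret subprob_complex "\<mu> n" by (rule \<mu>)
    define V where "V x = c n + log_potential (\<mu> n) x" for x
    define h where "h x = \<phi> x + \<epsilon> - V x" for x
    have [measurable]: "V \<in> borel_measurable borel" unfolding V_def[abs_def] by measurable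
    have [measurable]: "h \<in> borel_measurable borel" unfolding h_def[abs_def] by measurable
    have ci: "set_integrable lborel (ball y t) (\<lambda>x. C)" for y :: complex and t C :: real
      by (rule set_integrable_ball_continuous) auto
    have Vi: "set_integrable lborel (ball y t) V" if "t > 0" for y t
      unfolding V_def[abs_def] by (intro set_integral_add ci log_potential_ball(2)[OF bdd that])
    have \<phi>i: "set_integrable lborel (ball y t) \<phi>" for y t
      by (rule set_integrable_ball_continuous[OF \<phi>])
    have hi: "set_integrable lborel (ball y t) h" if "t > 0" for y t
      unfolding h_def[abs_def] using that by (intro set_integral_diff set_integral_add Vi \<phi>i ci)
    have h_nonneg: "AE x in lborel. x \<in> ball 0 (R + 4) \<longrightarrow> h x \<ge> 0"
      using elim(2) by eventually_elim (auto simp: h_def V_def)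
    have nn: "(\<integral>\<^sup>+x. ennreal (h x) * indicator (ball y t) x \<partial>lborel) = ennreal (LINT x:ball y t|lborel. h x)"
      if "t > 0" "ball y t \<subseteq> ball 0 (R + 4)" for y t
    proof -
      have "(\<integral>\<^sup>+x. ennreal (h x) * indicator (ball y t) x \<partial>lborel)
          = (\<integral>\<^sup>+x. ennreal (indicator (ball y t) x *\<^sub>R h x) \<partial>lborel)"
        by (intro nn_integral_cong) (auto split: split_indicator)
      also have "\<dots> = ennreal (LINT x|lborel. indicator (ball y t) x *\<^sub>R h x)"
      proof (rule nn_integral_eq_integral)
        show "AE x in lborel. 0 \<le> indicator (ball y t) x *\<^sub>R h x"
          using h_nonneg by eventually_elim (use that in \<open>auto split: split_indicator\<close>)
      qed (use hi[OF that(1)] in \<open>simp add: set_integrable_def\<close>)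
      finally show ?thesis by (simp add: set_lebesgue_integral_def)
    qed
    have "(\<integral>\<^sup>+x. ennreal (h x) * indicator (ball 0 R) x \<partial>lborel) \<le> ennreal (pi * (R + s)\<^sup>2 * (16 * \<epsilon>))"
    proof (rule nn_integral_ball_le_of_local)
      fix z' :: complex assume z': "z' \<in> ball 0 (R + s)"
      then have z'1: "cmod z' < R + 1" using s by auto
      then obtain i where i: "i \<in> k" "dist i z' < s / 2" using k(2) by force
      then obtain y where y: "dist i y < s / 2" "AE \<zeta> in \<mu> n. \<zeta> \<noteq> y"
          "integrable (\<mu> n) (\<lambda>\<zeta>. ln (cmod (y - \<zeta>)))" "\<phi> i - \<epsilon> \<le> V y"
        using elim(1) unfolding V_def by auto
      have yz: "dist y z' < s" using i(2) y(1) by (metis dist_commute dist_triangle_half_r)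
      \<comment> \<open>One \<epsilon> is the loss at the net point i, the other the oscillation of
        \<phi> between i and \<open>z'\<close>.\<close>
      have Vy: "\<phi> z' - 2 * \<epsilon> \<le> V y"
        using \<phi>_close[OF z'1, of i] i(2) s(1) y(4) by (auto simp: dist_norm)
      have s2: "2 * s > 0" using s by simp
      have sub: "ball y (2 * s) \<subseteq> ball 0 (R + 4)"
      proof
        fix x assume "x \<in> ball y (2 * s)"
        then have "dist y x < 2 * s" by simp
        then have "dist 0 x < cmod z' + s + 2 * s"
          using yz dist_triangle[of 0 x y] dist_triangle[of 0 y z'] by (simp add: dist_commute)
        then show "x \<in> ball 0 (R + 4)" using z'1 s by simp
      qed
      have "ball z' s \<subseteq> ball y (2 * s)"
      proof
        fix x assume "x \<in> ball z' s"
        then have "dist z' x < s" by simp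
        then have "dist y x < 2 * s" using yz dist_triangle[of y x z'] by simp
        then show "x \<in> ball y (2 * s)" by simp
      qed
      then have "(\<integral>\<^sup>+x. ennreal (h x) * indicator (ball z' s) x \<partial>lborel)
          \<le> (\<integral>\<^sup>+x. ennreal (h x) * indicator (ball y (2 * s)) x \<partial>lborel)"
        by (intro nn_integral_mono) (auto split: split_indicator)
      also have "\<dots> = ennreal (LINT x:ball y (2 * s)|lborel. h x)"
        by (rule nn[OF s2 sub])
      also have "(LINT x:ball y (2 * s)|lborel. h x)
          = (LINT x:ball y (2 * s)|lborel. \<phi> x + \<epsilon>) - (LINT x:ball y (2 * s)|lborel. V x)"
        unfolding h_def by (intro set_integral_diff set_integral_add Vi[OF s2] \<phi>i ci)
      also have "\<dots> \<le> (LINT x:ball y (2 * s)|lborel. \<phi> z' + 2 * \<epsilon>) - pi * (2 * s)\<^sup>2 * V y"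
      proof (rule diff_mono)
        show "(LINT x:ball y (2 * s)|lborel. \<phi> x + \<epsilon>) \<le> (LINT x:ball y (2 * s)|lborel. \<phi> z' + 2 * \<epsilon>)"
        proof (rule set_integral_mono)
          fix x assume "x \<in> ball y (2 * s)"
          then have "dist x z' < 3 * s" using yz dist_triangle[of x z' y] by (simp add: dist_commute)
          then show "\<phi> x + \<epsilon> \<le> \<phi> z' + 2 * \<epsilon>"
            using \<phi>_close[OF z'1, of x] by (auto simp: dist_norm)
        qed (intro set_integral_add \<phi>i ci)+
        have "(LINT x:ball y (2 * s)|lborel. V x)
            = (LINT x:ball y (2 * s)|lborel. c n) + (LINT x:ball y (2 * s)|lborel. log_potential (\<mu> n) x)"
          unfolding V_def by (intro set_integral_add ci log_potential_ball(2)[OF bdd s2])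
        moreover have "(LINT x:ball y (2 * s)|lborel. c n) = pi * (2 * s)\<^sup>2 * c n"
          using s by (simp add: set_lebesgue_integral_def measure_lborel_complex_ball)
        ultimately show "pi * (2 * s)\<^sup>2 * V y \<le> (LINT x:ball y (2 * s)|lborel. V x)"
          using submean[OF bdd s2 y(2,3)] by (simp add: V_def distrib_left)
      qed
      also have "(LINT x:ball y (2 * s)|lborel. \<phi> z' + 2 * \<epsilon>) = pi * (2 * s)\<^sup>2 * (\<phi> z' + 2 * \<epsilon>)"
        using s by (simp add: set_lebesgue_integral_def measure_lborel_complex_ball)
      also have "pi * (2 * s)\<^sup>2 * (\<phi> z' + 2 * \<epsilon>) - pi * (2 * s)\<^sup>2 * V y = pi * (2 * s)\<^sup>2 * (\<phi> z' + 2 * \<epsilon> - V y)"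
        by (simp add: right_diff_distrib)
      also have "\<dots> \<le> pi * (2 * s)\<^sup>2 * (4 * \<epsilon>)"
        using Vy by (intro mult_left_mono) auto
      also have "\<dots> = pi * s\<^sup>2 * (16 * \<epsilon>)" by (simp add: power_mult_distrib)
      finally show "(\<integral>\<^sup>+x. ennreal (h x) * indicator (ball z' s) x \<partial>lborel) \<le> ennreal (pi * s\<^sup>2 * (16 * \<epsilon>))"
        by (simp add: ennreal_leI)
    qed (use s R \<epsilon> in auto)
    also have "\<dots> \<le> ennreal (A * \<epsilon>)"
    proof (rule ennreal_leI)
      have "(R + s)\<^sup>2 \<le> (R + 1)\<^sup>2" using s R by (intro power_mono) auto
      then show "pi * (R + s)\<^sup>2 * (16 * \<epsilon>) \<le> A * \<epsilon>"
        using \<epsilon> by (simp add: A_def)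
    qed
    finally have hR: "(\<integral>\<^sup>+x. ennreal (h x) * indicator (ball 0 R) x \<partial>lborel) \<le> ennreal (A * \<epsilon>)" .
    have sub: "ball z r \<subseteq> ball 0 R"
    proof
      fix x assume "x \<in> ball z r"
      then have "dist z x < r" by simp
      then have "dist 0 x < R" using dist_triangle[of 0 x z] by (simp add: R_def)
      then show "x \<in> ball 0 R" by simp
    qed
    have "ennreal (LINT x:ball z r|lborel. h x) = (\<integral>\<^sup>+x. ennreal (h x) * indicator (ball z r) x \<partial>lborel)"
      using sub by (intro nn[symmetric] r) (auto intro: subset_trans)
    also have "\<dots> \<le> (\<integral>\<^sup>+x. ennreal (h x) * indicator (ball 0 R) x \<partial>lborel)"
      using sub by (intro nn_integral_mono) (auto split: split_indicator)
    also note hR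
    finally have 1: "(LINT x:ball z r|lborel. h x) \<le> A * \<epsilon>"
      using A \<epsilon> by (subst (asm) ennreal_le_iff) auto
    have 2: "0 \<le> (LINT x:ball z r|lborel. h x)"
      unfolding set_lebesgue_integral_def
    proof (rule integral_nonneg_AE)
      show "AE x in lborel. 0 \<le> indicator (ball z r) x *\<^sub>R h x"
        using h_nonneg by eventually_elim (use sub in \<open>auto split: split_indicator\<close>)
    qed
    have "(LINT x:ball z r|lborel. h x) = (LINT x:ball z r|lborel. \<phi> x + \<epsilon>) - (LINT x:ball z r|lborel. V x)"
      unfolding h_def by (intro set_integral_diff set_integral_add Vi[OF r] \<phi>i ci)
    also have "(LINT x:ball z r|lborel. \<phi> x + \<epsilon>) = (LINT x:ball z r|lborel. \<phi> x) + (LINT x:ball z r|lborel. \<epsilon>)"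
      by (intro set_integral_add \<phi>i ci)
    also have "(LINT x:ball z r|lborel. \<epsilon>) = pi * r\<^sup>2 * \<epsilon>"
      using r by (simp add: set_lebesgue_integral_def measure_lborel_complex_ball)
    finally have 3: "(LINT x:ball z r|lborel. h x) = (LINT x:ball z r|lborel. \<phi> x) + pi * r\<^sup>2 * \<epsilon> - (LINT x:ball z r|lborel. V x)" .
    have "r\<^sup>2 \<le> (R + 1)\<^sup>2" using r by (intro power_mono) (auto simp: R_def)
    then have "pi * r\<^sup>2 \<le> pi * (R + 1)\<^sup>2" by simp
    also have "\<dots> \<le> A" unfolding A_def by simp
    finally have 4: "pi * r\<^sup>2 * \<epsilon> \<le> A * \<epsilon>" using \<epsilon> by (intro mult_right_mono) auto
    have 5: "0 \<le> pi * r\<^sup>2 * \<epsilon>" using \<epsilon> by simp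
    have "\<bar>(LINT x:ball z r|lborel. V x) - (LINT x:ball z r|lborel. \<phi> x)\<bar> \<le> A * \<epsilon>"
      using 1 2 3 4 5 unfolding abs_le_iff by linarith
    also have "A * \<epsilon> < \<delta>" using A \<delta> by (simp add: \<epsilon>_def)
    finally show ?case by (simp add: V_def)
  qed
  then show "\<exists>no. \<forall>n\<ge>no. norm ((LINT x:ball z r|lborel. c n + log_potential (\<mu> n) x) - (LINT x:ball z r|lborel. \<phi> x)) < \<delta>"
    by (simp add: eventually_sequentially)
qed

text \<open>Differences of disc means annihilate constants, so \<phi> has to match the potential of
  \<nu> only up to \<open>c'\<close>, and \<open>c n\<close> may vary freely with n. The radii
  \<open>K n\<close> need no uniformity: they secure integrability for each n separately.\<close>

theorem tendsto_integral_of_log_potential: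
  fixes \<mu> :: "nat \<Rightarrow> complex measure" and c K :: "nat \<Rightarrow> real" and \<phi> g :: "complex \<Rightarrow> real"
  assumes \<mu>: "\<And>n. subprob_complex (\<mu> n)" and bdd: "\<And>n. AE \<zeta> in \<mu> n. cmod \<zeta> \<le> K n"
    and \<mu>_ne: "AE z in lborel. \<forall>n. AE \<zeta> in \<mu> n. \<zeta> \<noteq> z"
    and \<nu>: "subprob_complex \<nu>" and \<nu>_bdd: "AE \<zeta> in \<nu>. cmod \<zeta> \<le> K'"
    and \<nu>_ne: "AE z in lborel. AE \<zeta> in \<nu>. \<zeta> \<noteq> z"
    and \<phi>: "continuous_on UNIV \<phi>"
    and \<phi>_eq: "AE x in lborel. log_potential \<nu> x = \<phi> x + c'"
    and upper: "\<And>R \<epsilon>. \<epsilon> > 0 \<Longrightarrow> \<forall>\<^sub>F n in sequentially.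
      AE x in lborel. x \<in> ball 0 R \<longrightarrow> c n + log_potential (\<mu> n) x \<le> \<phi> x + \<epsilon>"
    and lower: "\<And>z r \<epsilon>. r > 0 \<Longrightarrow> \<epsilon> > 0 \<Longrightarrow> \<forall>\<^sub>F n in sequentially. \<exists>y\<in>ball z r.
      (AE \<zeta> in \<mu> n. \<zeta> \<noteq> y) \<and> integrable (\<mu> n) (\<lambda>\<zeta>. ln (cmod (y - \<zeta>))) \<and>
      \<phi> z - \<epsilon> \<le> c n + log_potential (\<mu> n) y"
    and g: "continuous_on UNIV g" and supp: "compact (closure {z. g z \<noteq> 0})"
  shows "(\<lambda>n. integral\<^sup>L (\<mu> n) g) \<longlonglongrightarrow> integral\<^sup>L \<nu> g"
proof (rule tendsto_integral_of_tent_mean[OF \<mu> \<nu> _ g supp])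
  fix s :: real assume s: "s > 0"
  interpret \<nu>: subprob_complex \<nu> by fact
  have [measurable]: "\<phi> \<in> borel_measurable borel"
    using \<phi> by (rule borel_measurable_continuous_onI)
  define D where "D f z = (LINT x:ball z s|lborel. f x) / (pi * s\<^sup>2)
      - (LINT x:ball z (s / 2)|lborel. f x) / (pi * (s / 2)\<^sup>2)" for f :: "complex \<Rightarrow> real" and z
  have D_shift: "D (\<lambda>x. b + f x) z = D f z"
    if fi: "\<And>t. t > 0 \<Longrightarrow> set_integrable lborel (ball z t) f" for b f z
  proof -
    have "(LINT x:ball z t|lborel. b + f x) = pi * t\<^sup>2 * b + (LINT x:ball z t|lborel. f x)" if "t > 0" for t
    proof -
      have "(LINT x:ball z t|lborel. b + f x) = (LINT x:ball z t|lborel. b) + (LINT x:ball z t|lborel. f x)"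
        by (intro set_integral_add fi[OF that] set_integrable_ball_continuous) auto
      then show ?thesis using that
        by (simp add: set_lebesgue_integral_def measure_lborel_complex_ball)
    qed
    from this[of s] this[of "s / 2"] show ?thesis
      using s by (simp add: D_def field_simps)
  qed
  show "AE z in lborel. (\<lambda>n. tent_mean s (\<mu> n) z) \<longlonglongrightarrow> tent_mean s \<nu> z"
    using \<mu>_ne \<nu>_ne
  proof eventually_elim
    case (elim z)
    have "tent_mean s (\<mu> n) z = D (\<lambda>x. c n + log_potential (\<mu> n) x) z" for n
      using subprob_complex.tent_mean_eq[OF \<mu> bdd s] elim(1)
        subprob_complex.log_potential_ball(2)[OF \<mu> bdd]
      by (subst D_shift) (auto simp: D_def)
    moreover have "(\<lambda>n. D (\<lambda>x. c n + log_potential (\<mu> n) x) z) \<longlonglongrightarrow> D \<phi> z"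
      unfolding D_def using s
      by (intro tendsto_intros set_integral_log_potential_tendsto[OF \<mu> bdd \<phi> upper lower]) auto
    moreover have "D \<phi> z = D (\<lambda>x. c' + \<phi> x) z"
      by (rule D_shift[symmetric], rule set_integrable_ball_continuous[OF \<phi>])
    moreover have "(LINT x:ball z t|lborel. log_potential \<nu> x) = (LINT x:ball z t|lborel. c' + \<phi> x)" for t
      using \<phi>_eq by (intro set_lebesgue_integral_cong_AE) (auto simp: add.commute)
    then have "D (\<lambda>x. c' + \<phi> x) z = tent_mean s \<nu> z"
      by (simp add: D_def \<nu>.tent_mean_eq[OF \<nu>_bdd s elim(2)])
    ultimately show ?case by simp
  qed
qed

section \<open>Zero-counting measures of polynomials\<close>

lemma scale_measure_eq_density: "scale_measure r M = density M (\<lambda>_. r)"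
  by (rule measure_eqI) (auto simp: emeasure_density_const)

lemma zorder_poly_eq_order:
  fixes p :: "complex poly"
  assumes "p \<noteq> 0"
  shows "zorder (poly p) z = int (order z p)"
proof -
  obtain q where q: "p = [:- z, 1:] ^ order z p * q" "\<not> [:- z, 1:] dvd q"
    using order_decomp[OF assms] by blast
  show ?thesis
  proof (rule zorder_eqI[of UNIV _ "poly q"])
    show "poly q z \<noteq> 0" using q(2) by (simp add: poly_eq_0_iff_dvd)
    fix w assume "w \<noteq> z"
    have "poly p w = poly ([:- z, 1:] ^ order z p * q) w" using q(1) by simp
    then show "poly p w = poly q w * (w - z) powi int (order z p)"
      by (simp add: poly_power mult.commute)
  qed (auto intro!: holomorphic_intros)
qed

definition scaled_roots_measure :: "real \<Rightarrow> real \<Rightarrow> complex poly \<Rightarrow> complex measure" where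
  "scaled_roots_measure t c p = scale_measure (ennreal t) (rescaled_measure c (zero_measure (poly p)))"

lemma scaled_roots_measure_0:
  assumes [simp]: "p = 0"
  shows "scaled_roots_measure t c p = null_measure borel"
proof (rule measure_eqI)
  show "sets (scaled_roots_measure t c p) = sets (null_measure borel)"
    by (simp add: scaled_roots_measure_def rescaled_measure_def)
  have "(\<lambda>z::complex. z / of_real c) \<in> measurable (null_measure borel) borel"
    by (simp add: measurable_cong_sets[of "null_measure borel" borel borel borel])
  then show "emeasure (scaled_roots_measure t c p) A = emeasure (null_measure borel) A"
    if "A \<in> sets (scaled_roots_measure t c p)" for A
    using that
    by (simp add: scaled_roots_measure_def rescaled_measure_def zero_measure_def emeasure_distr)
qed

lemma scaled_roots_measure_eq:
  assumes p: "p \<noteq> 0"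
  shows "scaled_roots_measure t c p =
    density (distr (density (count_space {z. poly p z = 0}) (\<lambda>z. ennreal (real (order z p)))) borel
      (\<lambda>z. z / of_real c)) (\<lambda>_. ennreal t)"
proof -
  have "zero_measure (poly p) = distr (density (count_space {z. poly p z = 0}) (\<lambda>z. ennreal (real (order z p)))) borel (\<lambda>z. z)"
    using p by (simp add: zero_measure_def poly_all_0_iff_0 zorder_poly_eq_order[OF p] ennreal_of_nat_eq_real_of_nat)
  then show ?thesis
    by (simp add: scaled_roots_measure_def scale_measure_eq_density rescaled_measure_def)
       (subst distr_distr, auto simp: comp_def)
qed

lemma sets_scaled_roots_measure [simp, measurable_cong]: "sets (scaled_roots_measure t c p) = sets borel"
  by (simp add: scaled_roots_measure_def rescaled_measure_def)

lemma has_bochner_integral_scaled_roots_measure: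
  fixes F :: "complex \<Rightarrow> real"
  assumes p: "p \<noteq> 0" and t: "t \<ge> 0" and [measurable]: "F \<in> borel_measurable borel"
  shows "has_bochner_integral (scaled_roots_measure t c p) F
    (t * (\<Sum>z | poly p z = 0. real (order z p) * F (z / of_real c)))"
proof -
  let ?Z = "{z. poly p z = 0}"
  have fin: "finite ?Z" using p by (rule poly_roots_finite)
  have 1: "has_bochner_integral (count_space ?Z) (\<lambda>z. real (order z p) *\<^sub>R F (z / of_real c))
      (\<Sum>z\<in>?Z. real (order z p) * F (z / of_real c))"
    using fin by (simp add: has_bochner_integral_iff integrable_count_space lebesgue_integral_count_space_finite)
  have 2: "has_bochner_integral (density (count_space ?Z) (\<lambda>z. ennreal (real (order z p)))) (\<lambda>z. F (z / of_real c))
      (\<Sum>z\<in>?Z. real (order z p) * F (z / of_real c))"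
    by (rule has_bochner_integral_density[OF _ _ _ 1]) auto
  have 3: "has_bochner_integral (distr (density (count_space ?Z) (\<lambda>z. ennreal (real (order z p)))) borel
      (\<lambda>z. z / of_real c)) F (\<Sum>z\<in>?Z. real (order z p) * F (z / of_real c))"
    by (rule has_bochner_integral_distr) (use 2 in auto)
  have 4: "has_bochner_integral (distr (density (count_space ?Z) (\<lambda>z. ennreal (real (order z p)))) borel
      (\<lambda>z. z / of_real c)) (\<lambda>z. t *\<^sub>R F z) (t * (\<Sum>z\<in>?Z. real (order z p) * F (z / of_real c)))"
    using has_bochner_integral_mult_right[of t, OF 3] by simp
  show ?thesis unfolding scaled_roots_measure_eq[OF p]
    using t by (intro has_bochner_integral_density[OF _ _ _ 4]) auto
qed

lemma AE_scaled_roots_measure: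
  assumes p: "p \<noteq> 0" and P: "\<And>z. poly p z = 0 \<Longrightarrow> P (z / of_real c)" and [measurable]: "Measurable.pred borel P"
  shows "AE z in scaled_roots_measure t c p. P z"
  unfolding scaled_roots_measure_eq[OF p]
  by (subst AE_density, simp, subst AE_distr_iff)
     (auto simp: AE_density AE_count_space P)

lemma subprob_scaled_roots_measure:
  assumes t: "0 \<le> t" "t * real (degree p) \<le> 1"
  shows "subprob_complex (scaled_roots_measure t c p)"
proof (cases "p = 0")
  case True
  then show ?thesis
    unfolding scaled_roots_measure_0[OF True]
    by (intro subprob_complex.intro subprob_complex_axioms.intro finite_measureI) (simp_all add: measure_def)
next
  case False
  from has_bochner_integral_scaled_roots_measure[OF False t(1), of "\<lambda>_. 1" c]
  have i: "integrable (scaled_roots_measure t c p) (\<lambda>_. 1 :: real)"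
    and m: "measure (scaled_roots_measure t c p) UNIV = t * (\<Sum>z | poly p z = 0. real (order z p))"
    using sets_eq_imp_space_eq[OF sets_scaled_roots_measure[of t c p]]
    by (auto simp: has_bochner_integral_iff)
  have sp: "space (scaled_roots_measure t c p) = UNIV"
    using sets_eq_imp_space_eq[OF sets_scaled_roots_measure[of t c p]] by simp
  show ?thesis
  proof (intro subprob_complex.intro subprob_complex_axioms.intro finite_measureI)
    show "emeasure (scaled_roots_measure t c p) (space (scaled_roots_measure t c p)) \<noteq> \<infinity>"
      using i by (simp add: integrable_iff_bounded less_top)
    have "(\<Sum>z | poly p z = 0. real (order z p)) \<le> real (degree p)"
      using sum_order_le_degree[OF False] by (simp flip: of_nat_sum)
    then have "t * (\<Sum>z | poly p z = 0. real (order z p)) \<le> t * real (degree p)"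
      using t(1) by (rule mult_left_mono)
    with t(2) show "measure (scaled_roots_measure t c p) UNIV \<le> 1" unfolding m by linarith
  qed simp
qed

text \<open>Rescaling contributes ln c once per root, so everything except the last sum is
  independent of z; it becomes the additive constant that vague convergence does not see.\<close>

lemma ln_cmod_poly:
  assumes p: "p \<noteq> 0" and z: "poly p (of_real c * z) \<noteq> 0" and c: "c > 0"
  shows "ln (cmod (poly p (of_real c * z))) = ln (cmod (lead_coeff p)) + (\<Sum>\<zeta> | poly p \<zeta> = 0. real (order \<zeta> p) * ln c)
    + (\<Sum>\<zeta> | poly p \<zeta> = 0. real (order \<zeta> p) * ln (cmod (z - \<zeta> / of_real c)))"
proof -
  let ?Z = "{z. poly p z = 0}"
  have ne: "z - \<zeta> / of_real c \<noteq> 0" if "\<zeta> \<in> ?Z" for \<zeta>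
    using that z c by auto
  have "cmod (poly p (of_real c * z)) = cmod (poly (smult (lead_coeff p) (\<Prod>z\<in>?Z. [:-z, 1:] ^ order z p)) (of_real c * z))"
    by (simp only: complex_poly_decompose)
  also have "\<dots> = cmod (lead_coeff p) * (\<Prod>\<zeta>\<in>?Z. (c * cmod (z - \<zeta> / of_real c)) ^ order \<zeta> p)"
  proof -
    have "cmod (of_real c * z - \<zeta>) = c * cmod (z - \<zeta> / of_real c)" for \<zeta>
    proof -
      have "of_real c * z - \<zeta> = of_real c * (z - \<zeta> / of_real c)"
        using c by (simp add: field_simps)
      then show ?thesis using c by (simp add: norm_mult)
    qed
    then show ?thesis
      by (simp add: norm_mult poly_prod prod_norm[symmetric] norm_power poly_power)
  qed
  also have "ln \<dots> = ln (cmod (lead_coeff p)) + (\<Sum>\<zeta>\<in>?Z. ln ((c * cmod (z - \<zeta> / of_real c)) ^ order \<zeta> p))"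
  proof -
    have pos: "(c * cmod (z - \<zeta> / of_real c)) ^ order \<zeta> p > 0" if "\<zeta> \<in> ?Z" for \<zeta>
      using c ne[OF that] by simp
    then have "(\<Prod>\<zeta>\<in>?Z. (c * cmod (z - \<zeta> / of_real c)) ^ order \<zeta> p) > 0" by (rule prod_pos)
    moreover have "ln (\<Prod>\<zeta>\<in>?Z. (c * cmod (z - \<zeta> / of_real c)) ^ order \<zeta> p)
        = (\<Sum>\<zeta>\<in>?Z. ln ((c * cmod (z - \<zeta> / of_real c)) ^ order \<zeta> p))"
      by (rule ln_prod) (use poly_roots_finite[OF p] in simp, metis pos less_irrefl)
    ultimately show ?thesis using p by (simp only: ln_mult norm_ge_zero) (simp add: ln_mult)
  qed
  also have "(\<Sum>\<zeta>\<in>?Z. ln ((c * cmod (z - \<zeta> / of_real c)) ^ order \<zeta> p))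
      = (\<Sum>\<zeta>\<in>?Z. real (order \<zeta> p) * ln c + real (order \<zeta> p) * ln (cmod (z - \<zeta> / of_real c)))"
  proof (intro sum.cong refl)
    fix \<zeta> assume "\<zeta> \<in> ?Z"
    then show "ln ((c * cmod (z - \<zeta> / of_real c)) ^ order \<zeta> p) =
        real (order \<zeta> p) * ln c + real (order \<zeta> p) * ln (cmod (z - \<zeta> / of_real c))"
      using ne[of \<zeta>] c by (simp add: ln_realpow ln_mult distrib_left)
  qed
  finally show ?thesis by (simp add: sum.distrib)
qed

lemma random_poly_eq_poly:
  "random_poly \<xi> w n \<omega> = poly (\<Sum>k\<le>n. monom (\<xi> k \<omega> * w k) k)"
  by (rule ext) (simp add: random_poly_def poly_sum poly_monom)

lemma degree_sum_monom_le: "degree (\<Sum>k\<le>n. monom (a k) k) \<le> n"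
  by (intro degree_sum_le) (auto intro: order_trans[OF degree_monom_le])

section \<open>Anti-concentration\<close>

text \<open>A law that is not a point mass has two points a, b in its support, and a ball whose
  radius is a quarter of their distance misses the ball of that radius about a or about b. The
  support has full measure by Lindelof: its complement is covered by countably many null
  balls.\<close>

lemma nondegenerate_imp_small_ball:
  fixes \<mu> :: "'b::{metric_space, second_countable_topology} measure"
  assumes "prob_space \<mu>" and sets [measurable_cong]: "sets \<mu> = sets borel"
    and nondeg: "\<not> (\<exists>c. AE x in \<mu>. x = c)"
  obtains \<eta> q where "\<eta> > 0" "0 < q" "q < 1" "\<And>c. measure \<mu> (cball c \<eta>) \<le> q"
proof -
  interpret prob_space \<mu> by fact
  have sp: "space \<mu> = UNIV" using sets_eq_imp_space_eq[OF sets] by simp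
  define S where "S = {x. \<forall>r>0. measure \<mu> (ball x r) > 0}"
  have AE_S: "AE x in \<mu>. x \<in> S"
  proof -
    let ?\<F> = "{ball x r |x r. measure \<mu> (ball x r) = 0}"
    obtain \<F> where F: "\<F> \<subseteq> ?\<F>" "countable \<F>" "\<Union>\<F> = \<Union>?\<F>"
    proof (rule Lindelof[of ?\<F>])
      show "open S" if "S \<in> ?\<F>" for S using that by auto
    qed blast
    have null: "\<Union>\<F> \<in> null_sets \<mu>"
    proof -
      have "A \<in> null_sets \<mu>" if "A \<in> \<F>" for A
        using F(1) that by (auto simp: null_sets_def emeasure_eq_measure sets)
      then show ?thesis using null_sets_UN'[OF F(2), of "\<lambda>A. A" \<mu>] by simp
    qed
    have sub: "- S \<subseteq> \<Union>\<F>"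
      unfolding F(3)
    proof
      fix x assume "x \<in> - S"
      then obtain r where r: "r > 0" "\<not> measure \<mu> (ball x r) > 0" by (auto simp: S_def)
      then have "measure \<mu> (ball x r) = 0" using measure_nonneg[of \<mu> "ball x r"] by linarith
      with r(1) show "x \<in> \<Union>?\<F>" by (auto intro!: exI[of _ "ball x r"])
    qed
    from AE_not_in[OF null] show ?thesis
    proof (rule eventually_mono)
      fix x assume "x \<notin> \<Union>\<F>"
      with sub show "x \<in> S" by (metis ComplI subsetD)
    qed
  qed
  have "\<exists>a\<in>S. \<exists>b\<in>S. a \<noteq> b"
  proof (rule ccontr)
    assume *: "\<not> (\<exists>a\<in>S. \<exists>b\<in>S. a \<noteq> b)"
    have "\<exists>c. \<forall>x\<in>S. x = c" using * by blast
    then obtain c where c: "\<And>x. x \<in> S \<Longrightarrow> x = c" by blast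
    from AE_S have "AE x in \<mu>. x = c" by (rule eventually_mono) (rule c)
    with nondeg show False by blast
  qed
  then obtain a b where ab: "a \<in> S" "b \<in> S" "a \<noteq> b" by blast
  define \<eta> where "\<eta> = dist a b / 4"
  have \<eta>: "\<eta> > 0" using ab by (simp add: \<eta>_def)
  define p where "p = min (measure \<mu> (ball a \<eta>)) (measure \<mu> (ball b \<eta>))"
  have p: "p > 0" using ab \<eta> by (auto simp: p_def S_def)
  have le: "measure \<mu> (cball c \<eta>) \<le> 1 - p" for c
  proof -
    have *: "measure \<mu> (cball c \<eta>) \<le> 1 - measure \<mu> (ball x \<eta>)" if "cball c \<eta> \<inter> ball x \<eta> = {}" for x
    proof -
      have "measure \<mu> (cball c \<eta>) \<le> measure \<mu> (space \<mu> - ball x \<eta>)"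
        using that by (intro finite_measure_mono) (auto simp: sp sets)
      also have "\<dots> = 1 - measure \<mu> (ball x \<eta>)" by (rule prob_compl) (simp add: sets)
      finally show ?thesis .
    qed
    have "cball c \<eta> \<inter> ball a \<eta> = {} \<or> cball c \<eta> \<inter> ball b \<eta> = {}"
    proof (rule ccontr)
      assume "\<not> ?thesis"
      then obtain x y where "dist c x \<le> \<eta>" "dist a x < \<eta>" "dist c y \<le> \<eta>" "dist b y < \<eta>" by auto
      then have "dist a b < 4 * \<eta>"
        using dist_triangle[of a b c] dist_triangle[of a c x] dist_triangle[of c b y]
        by (simp add: dist_commute)
      then show False by (simp add: \<eta>_def)
    qed
    then show ?thesis using *[of a] *[of b] by (auto simp: p_def)
  qed
  \<comment> \<open>The maximum with 1/2 secures q > 0, so that q can be the base of real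
    powers.\<close>
  have "measure \<mu> (cball c \<eta>) \<le> max (1 - p) (1 / 2)" for c using le[of c] by simp
  moreover have "0 < max (1 - p) (1 / 2)" "max (1 - p) (1 / 2) < 1" using p by auto
  ultimately show ?thesis using that \<eta> by blast
qed

text \<open>Fibrewise over the coordinates outside \<open>W\<close>, the event is contained in a product of balls.\<close>

lemma emeasure_PiM_le_power:
  fixes \<mu> :: "'b::{metric_space, second_countable_topology} measure"
  assumes "prob_space \<mu>" and sets [measurable_cong]: "sets \<mu> = sets borel"
    and fin: "finite I" and W: "W \<subseteq> I" and E [measurable]: "E \<in> sets (PiM I (\<lambda>_. \<mu>))"
    and close: "\<And>x y i. x \<in> E \<Longrightarrow> y \<in> E \<Longrightarrow> (\<And>i. i \<in> I - W \<Longrightarrow> x i = y i) \<Longrightarrow> i \<in> W \<Longrightarrow> dist (x i) (y i) \<le> \<eta>"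
    and q: "q \<ge> 0" "\<And>c. measure \<mu> (cball c \<eta>) \<le> q"
  shows "emeasure (PiM I (\<lambda>_. \<mu>)) E \<le> ennreal (q ^ card W)"
proof -
  interpret p: prob_space \<mu> by fact
  interpret P: product_prob_space "\<lambda>_. \<mu>" I by unfold_locales
  have finW: "finite W" "finite (I - W)" using fin W finite_subset by auto
  have I: "(I - W) \<union> W = I" using W by auto
  have "emeasure (PiM I (\<lambda>_. \<mu>)) E = (\<integral>\<^sup>+x. indicator E x \<partial>PiM ((I - W) \<union> W) (\<lambda>_. \<mu>))"
    unfolding I by simp
  also have "\<dots> = (\<integral>\<^sup>+x. \<integral>\<^sup>+y. indicator E (merge (I - W) W (x, y)) \<partial>PiM W (\<lambda>_. \<mu>) \<partial>PiM (I - W) (\<lambda>_. \<mu>))"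
    by (rule P.product_nn_integral_fold) (use finW E in \<open>auto simp only: I intro: borel_measurable_indicator\<close>)
  also have "\<dots> \<le> (\<integral>\<^sup>+x. ennreal (q ^ card W) \<partial>PiM (I - W) (\<lambda>_. \<mu>))"
  proof (rule nn_integral_mono)
    fix x assume x: "x \<in> space (PiM (I - W) (\<lambda>_. \<mu>))"
    let ?S = "{y \<in> space (PiM W (\<lambda>_. \<mu>)). merge (I - W) W (x, y) \<in> E}"
    have "(\<integral>\<^sup>+y. indicator E (merge (I - W) W (x, y)) \<partial>PiM W (\<lambda>_. \<mu>)) \<le> ennreal (q ^ card W)"
    proof (cases "?S = {}")
      case True
      then have "(\<integral>\<^sup>+y. indicator E (merge (I - W) W (x, y)) \<partial>PiM W (\<lambda>_. \<mu>)) = (\<integral>\<^sup>+y. 0 \<partial>PiM W (\<lambda>_. \<mu>))"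
        by (intro nn_integral_cong) (auto simp: indicator_def)
      then show ?thesis by simp
    next
      case False
      \<comment> \<open>Any point of the fibre can serve as centre, since closeness is assumed for
        all pairs in \<open>E\<close> that agree off \<open>W\<close>.\<close>
      then obtain y0 where y0: "merge (I - W) W (x, y0) \<in> E" by auto
      let ?B = "Pi\<^sub>E W (\<lambda>i. cball (y0 i) \<eta>)"
      have B: "?B \<in> sets (PiM W (\<lambda>_. \<mu>))"
        by (intro sets_PiM_I_finite finW) (simp add: sets)
      have "(\<integral>\<^sup>+y. indicator E (merge (I - W) W (x, y)) \<partial>PiM W (\<lambda>_. \<mu>)) \<le> (\<integral>\<^sup>+y. indicator ?B y \<partial>PiM W (\<lambda>_. \<mu>))"
      proof (rule nn_integral_mono)
        fix y assume y: "y \<in> space (PiM W (\<lambda>_. \<mu>))"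
        have "y \<in> ?B" if "merge (I - W) W (x, y) \<in> E"
        proof
          fix i assume i: "i \<in> W"
          from close[OF y0 that _ i] i show "y i \<in> cball (y0 i) \<eta>" by (auto simp: merge_def)
        next
          fix i assume "i \<notin> W"
          with y show "y i = undefined" by (auto simp: space_PiM PiE_def extensional_def)
        qed
        then show "indicator E (merge (I - W) W (x, y)) \<le> (indicator ?B y :: ennreal)"
          by (auto split: split_indicator)
      qed
      also have "\<dots> = emeasure (PiM W (\<lambda>_. \<mu>)) ?B" using B by simp
      also have "\<dots> = (\<Prod>i\<in>W. emeasure \<mu> (cball (y0 i) \<eta>))"
        by (rule P.emeasure_PiM[OF finW(1)]) (simp add: sets)
      also have "\<dots> = ennreal (\<Prod>i\<in>W. measure \<mu> (cball (y0 i) \<eta>))"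
        by (simp add: p.emeasure_eq_measure prod_ennreal)
      also have "\<dots> \<le> ennreal (\<Prod>i\<in>W. q)"
        by (intro ennreal_leI prod_mono) (use q in auto)
      finally show ?thesis by simp
    qed
    then show "(\<integral>\<^sup>+y. indicator E (merge (I - W) W (x, y)) \<partial>PiM W (\<lambda>_. \<mu>)) \<le> ennreal (q ^ card W)" .
  qed
  also have "\<dots> = ennreal (q ^ card W) * emeasure (PiM (I - W) (\<lambda>_. \<mu>)) (space (PiM (I - W) (\<lambda>_. \<mu>)))"
    by simp
  also have "\<dots> \<le> ennreal (q ^ card W) * 1"
  proof (rule mult_left_mono)
    interpret J: product_prob_space "\<lambda>_. \<mu>" "I - W" by unfold_locales
    show "emeasure (PiM (I - W) (\<lambda>_. \<mu>)) (space (PiM (I - W) (\<lambda>_. \<mu>))) \<le> 1"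
      by (simp add: J.P.emeasure_space_1)
  qed simp
  finally show ?thesis by simp
qed

section \<open>Coefficients of polynomials that are small on a disc\<close>

lemma coeff_bound_sphere:
  fixes p :: "complex poly"
  assumes r: "r > 0" and B: "\<And>z. cmod z = r \<Longrightarrow> cmod (poly p z) \<le> B"
  shows "cmod (coeff p i) * r ^ i \<le> B"
proof -
  have hd: "(deriv ^^ i) (poly p) = poly ((pderiv ^^ i) p)" for i
  proof (induction i)
    case (Suc i)
    have "deriv (poly q) = poly (pderiv q)" for q :: "complex poly"
      by (rule ext) (rule DERIV_imp_deriv, rule poly_DERIV)
    with Suc show ?case by simp
  qed simp
  have "cmod ((deriv ^^ i) (poly p) 0) \<le> fact i * B / r ^ i"
  proof (rule Cauchy_inequality)
    show "cmod (poly p x) \<le> B" if "cmod (0 - x) = r" for x using B[of x] that by simp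
  qed (use r in \<open>auto intro!: holomorphic_intros continuous_intros\<close>)
  moreover have "(deriv ^^ i) (poly p) 0 = fact i * coeff p i"
    unfolding hd by (simp add: poly_0_coeff_0 coeff_higher_pderiv pochhammer_fact[symmetric])
  ultimately have "fact i * cmod (coeff p i) \<le> fact i * (B / r ^ i)"
    by (simp add: norm_mult)
  then have "cmod (coeff p i) \<le> B / r ^ i" by (rule mult_left_le_imp_le) simp
  then show ?thesis using r by (simp add: field_simps)
qed

text \<open>Re-expansion around \<open>z\<^sub>0\<close> and Cauchy's estimates, first at \<open>z\<^sub>0\<close> and then at \<open>0\<close>.\<close>

lemma coeff_bound_ball:
  fixes p :: "complex poly"
  assumes r: "0 < r" "r \<le> cmod z\<^sub>0" and deg: "degree p \<le> d"
    and B: "\<And>z. z \<in> cball z\<^sub>0 r \<Longrightarrow> cmod (poly p z) \<le> B"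
  shows "cmod (coeff p i) * cmod z\<^sub>0 ^ i \<le> real (d + 1) * B * (2 * cmod z\<^sub>0 / r) ^ d"
proof (rule coeff_bound_sphere)
  show "0 < cmod z\<^sub>0" using r by linarith
  have B0: "B \<ge> 0" using B[of z\<^sub>0] r(1) norm_ge_zero[of "poly p z\<^sub>0"] by (simp del: norm_ge_zero)
  fix z assume z: "cmod z = cmod z\<^sub>0"
  define p1 where "p1 = pcompose p [:z\<^sub>0, 1:]"
  have deg1: "degree p1 \<le> d" using deg by (simp add: p1_def degree_pcompose)
  have c: "cmod (coeff p1 i) * r ^ i \<le> B" for i
    using r(1) by (intro coeff_bound_sphere) (auto simp: p1_def poly_pcompose dist_norm intro!: B)
  have q1: "1 \<le> 2 * cmod z\<^sub>0 / r" using r by (simp add: field_simps)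
  have "poly p z = poly p1 (z - z\<^sub>0)" by (simp add: p1_def poly_pcompose)
  also have "\<dots> = (\<Sum>i\<le>d. coeff p1 i * (z - z\<^sub>0) ^ i)"
    unfolding poly_altdef using deg1
    by (intro sum.mono_neutral_left) (auto simp: coeff_eq_0)
  also have "cmod \<dots> \<le> (\<Sum>i\<le>d. B * (2 * cmod z\<^sub>0 / r) ^ d)"
  proof (rule sum_norm_le)
    fix i assume i: "i \<in> {..d}"
    have "cmod (z - z\<^sub>0) \<le> 2 * cmod z\<^sub>0" using norm_triangle_ineq4[of z z\<^sub>0] z by simp
    then have "cmod (coeff p1 i * (z - z\<^sub>0) ^ i) \<le> cmod (coeff p1 i) * (2 * cmod z\<^sub>0) ^ i"
      unfolding norm_mult norm_power by (intro mult_left_mono power_mono) auto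
    also have "\<dots> = cmod (coeff p1 i) * r ^ i * (2 * cmod z\<^sub>0 / r) ^ i"
      using r(1) by (simp add: power_divide)
    also have "\<dots> \<le> B * (2 * cmod z\<^sub>0 / r) ^ i"
      using c q1 by (intro mult_right_mono) auto
    also have "\<dots> \<le> B * (2 * cmod z\<^sub>0 / r) ^ d"
      using B0 q1 i by (intro mult_left_mono power_increasing) auto
    finally show "cmod (coeff p1 i * (z - z\<^sub>0) ^ i) \<le> B * (2 * cmod z\<^sub>0 / r) ^ d" .
  qed
  also have "\<dots> = real (d + 1) * B * (2 * cmod z\<^sub>0 / r) ^ d" by simp
  finally show "cmod (poly p z) \<le> real (d + 1) * B * (2 * cmod z\<^sub>0 / r) ^ d" .
qed

text \<open>Dividing by the lowest power leaves a polynomial of degree at most d, so the Cauchy loss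
  \<open>2 * cmod z\<^sub>0 / r\<close> is raised to the window length and not to the full degree.
  The division itself costs \<open>1 - r / cmod z\<^sub>0\<close> to the power
  \<open>k\<^sub>0\<close>, a rate that a small r makes negligible.\<close>

lemma window_coeff_bound:
  fixes b :: "nat \<Rightarrow> complex"
  assumes r: "0 < r" "r < cmod z\<^sub>0" and B0: "B \<ge> 0"
    and B: "\<And>z. z \<in> cball z\<^sub>0 r \<Longrightarrow> cmod (\<Sum>j\<le>d. b j * z ^ (k\<^sub>0 + j)) \<le> B" and j: "j \<le> d"
  shows "cmod (b j) * cmod z\<^sub>0 ^ (k\<^sub>0 + j)
    \<le> real (d + 1) * B * (2 * cmod z\<^sub>0 / r) ^ d / (1 - r / cmod z\<^sub>0) ^ k\<^sub>0"
proof -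
  define p where "p = (\<Sum>j\<le>d. monom (b j) j)"
  have poly: "poly p z = (\<Sum>j\<le>d. b j * z ^ j)" for z by (simp add: p_def poly_sum poly_monom)
  have deg: "degree p \<le> d"
    unfolding p_def by (intro degree_sum_le) (auto intro: order_trans[OF degree_monom_le])
  have co: "coeff p j = b j" using j by (simp add: p_def coeff_sum)
  define \<rho> where "\<rho> = cmod z\<^sub>0 - r"
  have \<rho>: "\<rho> > 0" using r by (simp add: \<rho>_def)
  have "cmod (poly p z) \<le> B / \<rho> ^ k\<^sub>0" if "z \<in> cball z\<^sub>0 r" for z
  proof -
    have "\<rho> \<le> cmod z" using that norm_triangle_ineq2[of z\<^sub>0 z] by (simp add: \<rho>_def dist_norm)
    then have "cmod (poly p z) * \<rho> ^ k\<^sub>0 \<le> cmod (poly p z) * cmod z ^ k\<^sub>0"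
      using \<rho> by (intro mult_left_mono power_mono) auto
    also have "\<dots> = cmod (\<Sum>j\<le>d. b j * z ^ (k\<^sub>0 + j))"
    proof -
      have "poly p z * z ^ k\<^sub>0 = (\<Sum>j\<le>d. b j * z ^ (k\<^sub>0 + j))"
        unfolding poly sum_distrib_right by (intro sum.cong) (auto simp: power_add)
      then show ?thesis by (metis norm_mult norm_power)
    qed
    also have "\<dots> \<le> B" by (rule B[OF that])
    finally show ?thesis using \<rho> by (simp add: field_simps)
  qed
  then have "cmod (b j) * cmod z\<^sub>0 ^ j \<le> real (d + 1) * (B / \<rho> ^ k\<^sub>0) * (2 * cmod z\<^sub>0 / r) ^ d"
    using coeff_bound_ball[of r z\<^sub>0 p d "B / \<rho> ^ k\<^sub>0" j] r deg by (simp add: co)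
  then have "cmod z\<^sub>0 ^ k\<^sub>0 * (cmod (b j) * cmod z\<^sub>0 ^ j)
      \<le> cmod z\<^sub>0 ^ k\<^sub>0 * (real (d + 1) * (B / \<rho> ^ k\<^sub>0) * (2 * cmod z\<^sub>0 / r) ^ d)"
    by (rule mult_left_mono) simp
  also have "\<dots> = real (d + 1) * B * (2 * cmod z\<^sub>0 / r) ^ d / (1 - r / cmod z\<^sub>0) ^ k\<^sub>0"
  proof -
    have z0: "cmod z\<^sub>0 > 0" using r by linarith
    have "1 - r / cmod z\<^sub>0 = \<rho> / cmod z\<^sub>0" using z0 by (simp add: \<rho>_def field_simps)
    then show ?thesis using z0 \<rho> by (simp add: power_divide mult_ac)
  qed
  finally show ?thesis by (simp add: power_add mult_ac)
qed

section \<open>Almost sure bounds by Borel-Cantelli\<close>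

context prob_space
begin

text \<open>All probabilities can be computed with \<open>Y 0\<close>; the sum of the indicators
  then counts the k below \<open>Y 0 \<omega> / \<epsilon>\<close>, of which there are at most
  \<open>Y 0 \<omega> / \<epsilon> + 1\<close>.\<close>

lemma summable_prob_ident_distr:
  fixes Y :: "nat \<Rightarrow> 'a \<Rightarrow> real"
  assumes [measurable]: "\<And>k. random_variable borel (Y k)"
    and ident: "\<And>k. distr M borel (Y k) = distr M borel (Y 0)"
    and int: "integrable M (Y 0)" and nonneg: "\<And>\<omega>. Y 0 \<omega> \<ge> 0" and \<epsilon>: "\<epsilon> > 0"
  shows "summable (\<lambda>k. prob {\<omega> \<in> space M. Y k \<omega> > \<epsilon> * real k})"
proof (rule summableI_nonneg_bounded)
  fix N
  have "prob {\<omega> \<in> space M. Y k \<omega> > \<epsilon> * real k} = prob {\<omega> \<in> space M. Y 0 \<omega> > \<epsilon> * real k}" for k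
  proof -
    have "prob {\<omega> \<in> space M. Y j \<omega> > \<epsilon> * real k} = measure (distr M borel (Y j)) {\<epsilon> * real k<..}" for j
      by (subst measure_distr) (auto intro!: arg_cong[where f=prob])
    from this[of k] this[of 0] show ?thesis by (simp only: ident[of k])
  qed
  then have "(\<Sum>k<N. prob {\<omega> \<in> space M. Y k \<omega> > \<epsilon> * real k})
      = (\<Sum>k<N. expectation (indicator {\<omega> \<in> space M. Y 0 \<omega> > \<epsilon> * real k}))" by simp
  also have "\<dots> = expectation (\<lambda>\<omega>. \<Sum>k<N. indicator {\<omega> \<in> space M. Y 0 \<omega> > \<epsilon> * real k} \<omega>)"
    by (rule Bochner_Integration.integral_sum[symmetric])
      (auto intro!: integrable_real_indicator simp: emeasure_eq_measure)
  also have "\<dots> \<le> expectation (\<lambda>\<omega>. Y 0 \<omega> / \<epsilon> + 1)"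
  proof (rule integral_mono)
    show "integrable M (\<lambda>\<omega>. \<Sum>k<N. indicator {\<omega> \<in> space M. Y 0 \<omega> > \<epsilon> * real k} \<omega> :: real)"
      by (intro Bochner_Integration.integrable_sum integrable_real_indicator) (auto simp: emeasure_eq_measure)
    show "integrable M (\<lambda>\<omega>. Y 0 \<omega> / \<epsilon> + 1)" using int by simp
    fix \<omega> assume \<omega>: "\<omega> \<in> space M"
    have "(\<Sum>k<N. indicator {\<omega> \<in> space M. Y 0 \<omega> > \<epsilon> * real k} \<omega> :: real) = real (card {k. k < N \<and> Y 0 \<omega> > \<epsilon> * real k})"
    proof -
      have "(\<Sum>k<N. indicator {\<omega> \<in> space M. Y 0 \<omega> > \<epsilon> * real k} \<omega> :: real)
          = (\<Sum>k\<in>{k. k < N \<and> Y 0 \<omega> > \<epsilon> * real k}. 1)"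
        by (rule sum.mono_neutral_cong_right) (use \<omega> in \<open>auto simp: indicator_def\<close>)
      then show ?thesis by simp
    qed
    also have "\<dots> \<le> real (card {..<nat \<lceil>Y 0 \<omega> / \<epsilon>\<rceil>})"
    proof (intro of_nat_mono card_mono subsetI)
      fix k assume "k \<in> {k. k < N \<and> Y 0 \<omega> > \<epsilon> * real k}"
      then have "real k < Y 0 \<omega> / \<epsilon>" using \<epsilon> by (simp add: field_simps)
      then show "k \<in> {..<nat \<lceil>Y 0 \<omega> / \<epsilon>\<rceil>}" by (simp add: zless_nat_eq_int_zless less_ceiling_iff)
    qed simp
    also have "\<dots> \<le> Y 0 \<omega> / \<epsilon> + 1"
      using nonneg[of \<omega>] \<epsilon> of_int_ceiling_le_add_one[of "Y 0 \<omega> / \<epsilon>"] by simp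
    finally show "(\<Sum>k<N. indicator {\<omega> \<in> space M. Y 0 \<omega> > \<epsilon> * real k} \<omega> :: real) \<le> Y 0 \<omega> / \<epsilon> + 1" .
  qed
  finally show "(\<Sum>k<N. prob {\<omega> \<in> space M. Y k \<omega> > \<epsilon> * real k}) \<le> expectation (\<lambda>\<omega>. Y 0 \<omega> / \<epsilon> + 1)" .
qed simp

text \<open>Borel-Cantelli is applied to the logarithms with slopes 1 / (m + 1), a countable family,
  so that one null set serves every \<epsilon>; the constant C absorbs the finitely many early
  indices.\<close>

lemma AE_subexponential_growth:
  fixes \<xi> :: "nat \<Rightarrow> 'a \<Rightarrow> complex"
  assumes [measurable]: "\<And>k. random_variable borel (\<xi> k)"
    and ident: "\<And>k. distr M borel (\<xi> k) = distr M borel (\<xi> 0)"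
    and int: "integrable M (\<lambda>\<omega>. ln (1 + cmod (\<xi> 0 \<omega>)))"
  shows "AE \<omega> in M. \<forall>\<epsilon>>0. \<exists>C. \<forall>k. cmod (\<xi> k \<omega>) \<le> C * exp (\<epsilon> * real k)"
proof -
  define Y where "Y k \<omega> = ln (1 + cmod (\<xi> k \<omega>))" for k \<omega>
  have [measurable]: "random_variable borel (Y k)" for k unfolding Y_def[abs_def] by measurable
  have identY: "distr M borel (Y k) = distr M borel (Y 0)" for k
  proof -
    have "distr M borel (Y j) = distr (distr M borel (\<xi> j)) borel (\<lambda>x. ln (1 + cmod x))" for j
      by (subst distr_distr) (auto simp: comp_def Y_def[abs_def])
    from this[of k] this[of 0] show ?thesis by (simp only: ident[of k])
  qed
  have "AE \<omega> in M. \<forall>\<^sub>F k in sequentially. Y k \<omega> \<le> 1 / real (Suc m) * real k" for m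
  proof -
    have "summable (\<lambda>k. prob {\<omega> \<in> space M. Y k \<omega> > 1 / real (Suc m) * real k})"
      using int by (intro summable_prob_ident_distr identY) (auto simp: Y_def[abs_def])
    then have "AE \<omega> in M. \<forall>\<^sub>F k in sequentially. \<omega> \<in> space M - {\<omega> \<in> space M. Y k \<omega> > 1 / real (Suc m) * real k}"
      by (intro borel_cantelli_AE1) (auto simp: emeasure_eq_measure)
    then show ?thesis by eventually_elim (auto elim!: eventually_mono)
  qed
  then have "AE \<omega> in M. \<forall>m. \<forall>\<^sub>F k in sequentially. Y k \<omega> \<le> 1 / real (Suc m) * real k"
    by (simp only: AE_all_countable) auto
  then show ?thesis
  proof eventually_elim
    case (elim \<omega>)
    show ?case
    proof (intro allI impI)
      fix \<epsilon> :: real assume "\<epsilon> > 0"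
      then obtain m where m: "1 / real (Suc m) < \<epsilon>"
        using reals_Archimedean by (auto simp: inverse_eq_divide)
      obtain N where N: "\<And>k. k \<ge> N \<Longrightarrow> Y k \<omega> \<le> 1 / real (Suc m) * real k"
        using elim[rule_format, of m] by (auto simp: eventually_sequentially)
      define C where "C = 1 + (\<Sum>k<N. cmod (\<xi> k \<omega>))"
      have C: "C \<ge> 1" by (simp add: C_def sum_nonneg)
      show "\<exists>C. \<forall>k. cmod (\<xi> k \<omega>) \<le> C * exp (\<epsilon> * real k)"
      proof (intro exI[of _ C] allI)
        fix k
        show "cmod (\<xi> k \<omega>) \<le> C * exp (\<epsilon> * real k)"
        proof (cases "k < N")
          case True
          then have "cmod (\<xi> k \<omega>) \<le> (\<Sum>k<N. cmod (\<xi> k \<omega>))" by (intro member_le_sum) auto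
          then have "cmod (\<xi> k \<omega>) \<le> C * 1" by (simp add: C_def)
          also have "\<dots> \<le> C * exp (\<epsilon> * real k)" using C \<open>\<epsilon> > 0\<close> by (intro mult_left_mono) auto
          finally show ?thesis .
        next
          case False
          have "Y k \<omega> \<le> 1 / real (Suc m) * real k" using False by (intro N) simp
          also have "\<dots> \<le> \<epsilon> * real k" using m by (intro mult_right_mono) auto
          finally have "exp (Y k \<omega>) \<le> exp (\<epsilon> * real k)" by simp
          moreover have "exp (Y k \<omega>) = 1 + cmod (\<xi> k \<omega>)"
            by (simp add: Y_def add_pos_nonneg)
          ultimately have "cmod (\<xi> k \<omega>) \<le> 1 * exp (\<epsilon> * real k)" by simp
          also have "\<dots> \<le> C * exp (\<epsilon> * real k)" using C by (intro mult_right_mono) auto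
          finally show ?thesis .
        qed
      qed
    qed
  qed
qed

text \<open>Two realisations that agree outside the window of indices and are both small near \<open>z\<^sub>0\<close>
  are close on the window, so by nondegeneracy smallness is exponentially unlikely.\<close>

lemma AE_eventually_large:
  fixes \<xi> :: "nat \<Rightarrow> 'a \<Rightarrow> complex" and a :: "nat \<Rightarrow> nat \<Rightarrow> complex" and z\<^sub>0 :: complex
  assumes indep: "indep_vars (\<lambda>_. borel) \<xi> UNIV"
    and ident: "\<And>k. distr M borel (\<xi> k) = distr M borel (\<xi> 0)"
    and nondeg: "\<not> (\<exists>c. AE \<omega> in M. \<xi> 0 \<omega> = c)"
    and z0: "z\<^sub>0 \<noteq> 0" and \<epsilon>: "\<epsilon> > 0" and r0: "r\<^sub>0 > 0"
    and window: "\<And>\<epsilon>'. \<epsilon>' > 0 \<Longrightarrow> \<exists>\<delta>. 0 < \<delta> \<and> \<delta> \<le> \<epsilon>' \<and> (\<forall>\<^sub>F n in sequentially. \<exists>k\<^sub>0 d.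
      k\<^sub>0 + d \<le> n \<and> \<delta> * real n - 1 \<le> real (d + 1) \<and> real d \<le> \<delta> * real n \<and>
      (\<forall>k\<in>{k\<^sub>0..k\<^sub>0+d}. exp (real n * (V - \<epsilon>')) \<le> cmod (a n k) * cmod z\<^sub>0 ^ k))"
  shows "AE \<omega> in M. \<forall>\<^sub>F n in sequentially. \<exists>y\<in>ball z\<^sub>0 r\<^sub>0.
    exp (real n * (V - \<epsilon>)) < cmod (\<Sum>k\<le>n. \<xi> k \<omega> * a n k * y ^ k)"
proof -
  have rv [measurable]: "random_variable borel (\<xi> k)" for k
    using indep by (auto simp: indep_vars_def)
  define \<mu> where "\<mu> = distr M borel (\<xi> 0)"
  have sets_\<mu> [measurable_cong]: "sets \<mu> = sets borel" by (simp add: \<mu>_def)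
  have prob_\<mu>: "prob_space \<mu>" unfolding \<mu>_def by (rule prob_space_distr) simp
  have "\<not> (\<exists>c. AE x in \<mu>. x = c)"
    using nondeg unfolding \<mu>_def by (subst AE_distr_iff) auto
  from nondegenerate_imp_small_ball[OF prob_\<mu> sets_\<mu> this] obtain \<eta> q where
    \<eta>: "\<eta> > 0" and q: "0 < q" "q < 1" "\<And>c. measure \<mu> (cball c \<eta>) \<le> q" by blast
  \<comment> \<open>Two demands: the closed disc of radius r lies inside the open one of radius
    \<open>r\<^sub>0\<close>, and r is so small that dividing out a power of exponent at most n
    costs no more than exp (n \<epsilon> / 8).\<close>
  define r where "r = min (r\<^sub>0 / 2) (cmod z\<^sub>0 * (1 - exp (- \<epsilon> / 8)))"
  have cz0: "cmod z\<^sub>0 > 0" using z0 by simp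
  have "1 - exp (- \<epsilon> / 8) > 0" using \<epsilon> by simp
  then have r: "0 < r" "r < r\<^sub>0" using r0 cz0 by (auto simp: r_def)
  have rz: "r / cmod z\<^sub>0 \<le> 1 - exp (- \<epsilon> / 8)"
    using cz0 by (simp add: r_def field_simps min_le_iff_disj)
  then have rz1: "exp (- \<epsilon> / 8) \<le> 1 - r / cmod z\<^sub>0" by simp
  have "r / cmod z\<^sub>0 < 1" using rz exp_gt_zero[of "- \<epsilon> / 8"] by linarith
  then have rz0: "r < cmod z\<^sub>0" using cz0 by (simp add: field_simps)
  define L where "L = ln (2 * cmod z\<^sub>0 / r)"
  have L: "L > 0" using rz0 r unfolding L_def by (intro ln_gt_zero) (simp add: field_simps)
  have expL: "exp L = 2 * cmod z\<^sub>0 / r" using r cz0 by (simp add: L_def)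
  \<comment> \<open>The factor \<open>(2 * cmod z\<^sub>0 / r) ^ d\<close>, which is exp (d L), may
    also cost at most exp (n \<epsilon> / 8). As L depends on r, the window length \<delta> n can be
    fixed only now, which is why \<open>window\<close> is assumed for every tolerance.\<close>
  define \<epsilon>' where "\<epsilon>' = min (\<epsilon> / 8) (\<epsilon> / (8 * L))"
  have \<epsilon>': "\<epsilon>' > 0" "\<epsilon>' \<le> \<epsilon> / 8" "\<epsilon>' * L \<le> \<epsilon> / 8"
    using \<epsilon> L by (auto simp: \<epsilon>'_def min_def field_simps)
  from window[OF \<epsilon>'(1)] obtain \<delta> where \<delta>: "0 < \<delta>" "\<delta> \<le> \<epsilon>'" and
    win: "\<forall>\<^sub>F n in sequentially. \<exists>k\<^sub>0 d.
      k\<^sub>0 + d \<le> n \<and> \<delta> * real n - 1 \<le> real (d + 1) \<and> real d \<le> \<delta> * real n \<and>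
      (\<forall>k\<in>{k\<^sub>0..k\<^sub>0+d}. exp (real n * (V - \<epsilon>')) \<le> cmod (a n k) * cmod z\<^sub>0 ^ k)" by blast
  have \<delta>L: "\<delta> * L \<le> \<epsilon> / 8"
    using \<delta> L \<epsilon>'(3) by (meson mult_right_mono less_imp_le order_trans)
  \<comment> \<open>Smallness is tested on a countable dense set to make \<open>E n\<close>
    measurable; continuity extends it to the whole disc.\<close>
  obtain D :: "complex set" where D: "countable D" "closure D = UNIV"
  proof -
    obtain D :: "complex set" where D: "countable D" "\<And>X. open X \<Longrightarrow> X \<noteq> {} \<Longrightarrow> \<exists>d\<in>D. d \<in> X"
      using countable_dense_setE by blast
    have "closure D = UNIV"
      using D(2)[of "- closure D"] closure_subset[of D] by auto
    with D(1) show ?thesis by (rule that)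
  qed
  define S where "S n x y = (\<Sum>k\<le>n. x k * a n k * y ^ k)" for n :: nat and x :: "nat \<Rightarrow> complex" and y
  define E where "E n = {x \<in> space (PiM {..n} (\<lambda>_. \<mu>)). \<forall>y\<in>D \<inter> ball z\<^sub>0 r\<^sub>0. cmod (S n x y) \<le> exp (real n * (V - \<epsilon>))}" for n
  have S_meas: "(\<lambda>x. S n x y) \<in> borel_measurable (PiM {..n} (\<lambda>_. \<mu>))" for n y
  proof -
    have "(\<lambda>x. x k) \<in> borel_measurable (PiM {..n} (\<lambda>_. \<mu>))" if "k \<le> n" for k
      using measurable_component_singleton[of k "{..n}" "\<lambda>_. \<mu>"] that
      by (simp add: measurable_cong_sets[OF refl sets_\<mu>])
    then show ?thesis unfolding S_def
      by (intro borel_measurable_sum borel_measurable_times) auto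
  qed
  have E_sets [measurable]: "E n \<in> sets (PiM {..n} (\<lambda>_. \<mu>))" for n
  proof -
    have 1: "{x \<in> space (PiM {..n} (\<lambda>_. \<mu>)). cmod (S n x y) \<le> exp (real n * (V - \<epsilon>))} \<in> sets (PiM {..n} (\<lambda>_. \<mu>))" for y
      using S_meas[of n y] by measurable
    show ?thesis
      unfolding E_def by (rule sets.sets_Collect_countable_All'[OF 1]) (use D(1) in auto)
  qed
  define X where "X n \<omega> = (\<lambda>k\<in>{..n}. \<xi> k \<omega>)" for n \<omega>
  have X_meas [measurable]: "X n \<in> measurable M (PiM {..n} (\<lambda>_. \<mu>))" for n
    unfolding X_def by (intro measurable_restrict) (simp add: measurable_cong_sets[OF refl sets_\<mu>])
  have distr_X: "distr M (PiM {..n} (\<lambda>_. \<mu>)) (X n) = PiM {..n} (\<lambda>_. \<mu>)" for n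
  proof -
    have "indep_vars (\<lambda>_. borel) \<xi> {..n}" by (rule indep_vars_subset[OF indep]) simp
    then have "distr M (PiM {..n} (\<lambda>_. borel)) (\<lambda>x. \<lambda>i\<in>{..n}. \<xi> i x) = PiM {..n} (\<lambda>i. distr M borel (\<xi> i))"
      by (subst (asm) indep_vars_iff_distr_eq_PiM) auto
    moreover have "sets (PiM {..n} (\<lambda>_. borel :: complex measure)) = sets (PiM {..n} (\<lambda>_. \<mu>))"
      by (intro sets_PiM_cong refl) (simp add: sets_\<mu>)
    moreover have "(\<lambda>i. distr M borel (\<xi> i)) = (\<lambda>_. \<mu>)"
      unfolding \<mu>_def by (rule ext) (rule ident)
    ultimately show ?thesis
      unfolding X_def[abs_def] by (simp only: restrict_def cong: distr_cong)
  qed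
  define A where "A n = {\<omega> \<in> space M. X n \<omega> \<in> E n}" for n
  have A_sets [measurable]: "A n \<in> sets M" for n unfolding A_def by measurable
  have prob_A: "emeasure M (A n) = emeasure (PiM {..n} (\<lambda>_. \<mu>)) (E n)" for n
  proof -
    have "A n = X n -` E n \<inter> space M" by (auto simp: A_def)
    then show ?thesis
      by (subst distr_X[symmetric], subst emeasure_distr) auto
  qed
  \<comment> \<open>The exponent budget: - \<epsilon> from smallness, then \<epsilon> / 8 each for
    the window length, for the division by the lowest power and for the lower bound on the weights.
    This leaves - 5 \<epsilon> / 8; the factor 2 comes from subtracting two realisations, n + 1 from
    the number of coefficients.\<close>
  have "(\<lambda>n. 2 * (real n + 1) * exp (- (real n * (5 * \<epsilon> / 8)))) \<longlonglongrightarrow> 0"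
    using \<epsilon> by real_asymp
  then have small: "\<forall>\<^sub>F n in sequentially. 2 * (real n + 1) * exp (- (real n * (5 * \<epsilon> / 8))) < \<eta>"
    using \<eta> by (rule order_tendstoD)
  have bound: "\<forall>\<^sub>F n in sequentially. norm (prob (A n)) \<le> q powr (\<delta> * real n - 1)"
    using win small
  proof eventually_elim
    case (elim n)
    then obtain k\<^sub>0 d where kd: "k\<^sub>0 + d \<le> n" "\<delta> * real n - 1 \<le> real (d + 1)" "real d \<le> \<delta> * real n"
      and big: "\<And>k. k \<in> {k\<^sub>0..k\<^sub>0+d} \<Longrightarrow> exp (real n * (V - \<epsilon>')) \<le> cmod (a n k) * cmod z\<^sub>0 ^ k" by blast
    have close: "dist (x i) (x' i) \<le> \<eta>"
      if x: "x \<in> E n" "x' \<in> E n" and eq: "\<And>i. i \<in> {..n} - {k\<^sub>0..k\<^sub>0+d} \<Longrightarrow> x i = x' i" and i: "i \<in> {k\<^sub>0..k\<^sub>0+d}" for x x' i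
    proof -
      define b where "b j = (x (k\<^sub>0 + j) - x' (k\<^sub>0 + j)) * a n (k\<^sub>0 + j)" for j
      define f where "f y = (\<Sum>j\<le>d. b j * y ^ (k\<^sub>0 + j))" for y
      have f_eq: "f y = S n x y - S n x' y" for y
      proof -
        have "S n x y - S n x' y = (\<Sum>k\<le>n. (x k - x' k) * a n k * y ^ k)"
          by (simp add: S_def left_diff_distrib sum_subtractf)
        also have "\<dots> = (\<Sum>k\<in>{k\<^sub>0..k\<^sub>0+d}. (x k - x' k) * a n k * y ^ k)"
          using kd(1) eq by (intro sum.mono_neutral_right) auto
        also have "\<dots> = f y"
          unfolding f_def b_def
          by (rule sum.reindex_bij_witness[of _ "\<lambda>j. k\<^sub>0 + j" "\<lambda>k. k - k\<^sub>0"]) auto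
        finally show ?thesis ..
      qed
      have fB: "cmod (f y) \<le> 2 * exp (real n * (V - \<epsilon>))" if y: "y \<in> ball z\<^sub>0 r\<^sub>0" for y
      proof -
        have "closed {y. cmod (f y) \<le> 2 * exp (real n * (V - \<epsilon>))}"
          unfolding f_def by (intro closed_Collect_le continuous_intros)
        moreover have "D \<inter> ball z\<^sub>0 r\<^sub>0 \<subseteq> {y. cmod (f y) \<le> 2 * exp (real n * (V - \<epsilon>))}"
        proof
          fix y assume "y \<in> D \<inter> ball z\<^sub>0 r\<^sub>0"
          then have "cmod (S n x y) \<le> exp (real n * (V - \<epsilon>))" "cmod (S n x' y) \<le> exp (real n * (V - \<epsilon>))"
            using x unfolding E_def by auto
          then show "y \<in> {y. cmod (f y) \<le> 2 * exp (real n * (V - \<epsilon>))}"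
            using norm_triangle_ineq4[of "S n x y" "S n x' y"] by (simp add: f_eq)
        qed
        ultimately have "closure (ball z\<^sub>0 r\<^sub>0 \<inter> D) \<subseteq> {y. cmod (f y) \<le> 2 * exp (real n * (V - \<epsilon>))}"
          by (intro closure_minimal) auto
        moreover have "y \<in> closure (ball z\<^sub>0 r\<^sub>0 \<inter> D)"
          using open_Int_closure_subset[of "ball z\<^sub>0 r\<^sub>0" D] y D(2) by auto
        ultimately show ?thesis by auto
      qed
      define j where "j = i - k\<^sub>0"
      have j: "j \<le> d" "k\<^sub>0 + j = i" using i by (auto simp: j_def)
      have nd: "real d \<le> real n" "real k\<^sub>0 \<le> real n" using kd(1) by auto
      have "cmod (b j) * cmod z\<^sub>0 ^ (k\<^sub>0 + j)
        \<le> real (d + 1) * (2 * exp (real n * (V - \<epsilon>))) * (2 * cmod z\<^sub>0 / r) ^ d / (1 - r / cmod z\<^sub>0) ^ k\<^sub>0"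
        using fB r by (intro window_coeff_bound[OF r(1) rz0 _ _ j(1)]) (auto simp: f_def)
      also have "\<dots> \<le> real (n + 1) * (2 * exp (real n * (V - \<epsilon>))) * exp (real n * (\<epsilon> / 8)) / exp (- (real n * (\<epsilon> / 8)))"
      proof (intro frac_le mult_mono)
        have "(2 * cmod z\<^sub>0 / r) ^ d = exp (real d * L)" by (simp add: expL[symmetric] exp_of_nat_mult[symmetric])
        also have "real d * L \<le> \<delta> * real n * L" using kd(3) L by (intro mult_right_mono) auto
        also have "\<delta> * real n * L \<le> real n * (\<epsilon> / 8)"
          using mult_left_mono[OF \<delta>L, of "real n"] by (simp add: mult_ac)
        finally show "(2 * cmod z\<^sub>0 / r) ^ d \<le> exp (real n * (\<epsilon> / 8))" by simp
        have "exp (- (real n * (\<epsilon> / 8))) \<le> exp (real k\<^sub>0 * (- \<epsilon> / 8))"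
          using nd(2) \<epsilon> by simp
        also have "\<dots> = exp (- \<epsilon> / 8) ^ k\<^sub>0" by (rule exp_of_nat_mult)
        also have "\<dots> \<le> (1 - r / cmod z\<^sub>0) ^ k\<^sub>0" using rz1 by (intro power_mono) auto
        finally show "exp (- (real n * (\<epsilon> / 8))) \<le> (1 - r / cmod z\<^sub>0) ^ k\<^sub>0" .
      qed (use nd r cz0 in auto)
      also have "\<dots> = 2 * (real n + 1) * exp (real n * (V - \<epsilon>) + real n * (\<epsilon> / 8) + real n * (\<epsilon> / 8))"
      proof -
        have "real (n + 1) * (2 * B) * F / exp (- u) = 2 * (real n + 1) * (B * F * exp u)" for B F u :: real
          by (simp add: exp_minus field_simps)
        then show ?thesis by (simp only: exp_add)
      qed
      also have "\<dots> = exp (real n * (V - \<epsilon> / 8)) * (2 * (real n + 1) * exp (- (real n * (5 * \<epsilon> / 8))))"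
      proof -
        have "real n * (V - \<epsilon>) + real n * (\<epsilon> / 8) + real n * (\<epsilon> / 8) = real n * (V - \<epsilon> / 8) + - (real n * (5 * \<epsilon> / 8))"
          by (simp add: field_simps)
        then show ?thesis by (simp only: exp_add) simp
      qed
      also have "\<dots> \<le> exp (real n * (V - \<epsilon> / 8)) * \<eta>"
        using elim(2) by (intro mult_left_mono) auto
      finally have 1: "cmod (x i - x' i) * (cmod (a n i) * cmod z\<^sub>0 ^ i) \<le> \<eta> * exp (real n * (V - \<epsilon> / 8))"
        by (simp add: b_def j(2) norm_mult mult_ac)
      have "exp (real n * (V - \<epsilon> / 8)) \<le> exp (real n * (V - \<epsilon>'))"
        using \<epsilon>'(2) by (auto intro!: mult_left_mono)
      also have "\<dots> \<le> cmod (a n i) * cmod z\<^sub>0 ^ i" by (rule big[OF i])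
      finally have "cmod (x i - x' i) * exp (real n * (V - \<epsilon> / 8)) \<le> cmod (x i - x' i) * (cmod (a n i) * cmod z\<^sub>0 ^ i)"
        by (rule mult_left_mono) simp
      also note 1
      finally show ?thesis by (simp add: dist_norm)
    qed
    have "emeasure (PiM {..n} (\<lambda>_. \<mu>)) (E n) \<le> ennreal (q ^ card {k\<^sub>0..k\<^sub>0+d})"
    proof (rule emeasure_PiM_le_power[OF prob_\<mu> sets_\<mu>, where \<eta>=\<eta>])
      show "dist (x i) (x' i) \<le> \<eta>"
        if "x \<in> E n" "x' \<in> E n" "\<And>i. i \<in> {..n} - {k\<^sub>0..k\<^sub>0+d} \<Longrightarrow> x i = x' i" "i \<in> {k\<^sub>0..k\<^sub>0+d}" for x x' i
        using that by (rule close)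
      show "{k\<^sub>0..k\<^sub>0+d} \<subseteq> {..n}" using kd(1) by auto
    qed (use q in auto)
    then have "prob (A n) \<le> q ^ (d + 1)"
      using q by (simp add: prob_A[symmetric] emeasure_eq_measure)
    also have "\<dots> = q powr real (d + 1)" using q by (simp only: powr_realpow)
    also have "\<dots> \<le> q powr (\<delta> * real n - 1)" using q kd(2) by (intro powr_mono') auto
    finally show ?case by simp
  qed
  \<comment> \<open>A geometric series; its prefactor 1 / q pays for the index lost when the window
    ends are rounded.\<close>
  have "summable (\<lambda>n. q powr (- 1) * (q powr \<delta>) ^ n)"
  proof -
    have "q powr \<delta> < q powr 0" using q \<delta> by (intro powr_less_mono') auto
    then show ?thesis using q by (intro summable_mult summable_geometric) auto
  qed
  moreover have "q powr (- 1) * (q powr \<delta>) ^ n = q powr (\<delta> * real n - 1)" for n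
    using q by (simp add: powr_diff powr_minus powr_powr[symmetric] powr_realpow field_simps)
  ultimately have "summable (\<lambda>n. q powr (\<delta> * real n - 1))" by (simp only:)
  then have "summable (\<lambda>n. prob (A n))"
    using bound by (rule summable_comparison_test_ev[rotated])
  then have "AE \<omega> in M. \<forall>\<^sub>F n in sequentially. \<omega> \<in> space M - A n"
    by (intro borel_cantelli_AE1) (auto simp: emeasure_eq_measure)
  then show ?thesis
  proof eventually_elim
    case (elim \<omega>)
    then show ?case
    proof (rule eventually_mono)
      fix n assume n: "\<omega> \<in> space M - A n"
      then have "X n \<omega> \<in> space (PiM {..n} (\<lambda>_. \<mu>))" using measurable_space[OF X_meas] by auto
      moreover have "X n \<omega> \<notin> E n" using n by (auto simp: A_def)
      ultimately obtain y where y: "y \<in> ball z\<^sub>0 r\<^sub>0" "\<not> cmod (S n (X n \<omega>) y) \<le> exp (real n * (V - \<epsilon>))"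
        unfolding E_def by auto
      have "S n (X n \<omega>) y = (\<Sum>k\<le>n. \<xi> k \<omega> * a n k * y ^ k)"
        unfolding S_def X_def by (intro sum.cong) auto
      with y show "\<exists>y\<in>ball z\<^sub>0 r\<^sub>0. exp (real n * (V - \<epsilon>)) < cmod (\<Sum>k\<le>n. \<xi> k \<omega> * a n k * y ^ k)"
        by (intro bexI[of _ y]) auto
    qed
  qed
qed

end

section \<open>Growth of the rescaled polynomials\<close>

text \<open>The limit of \<open>ln (cmod (\<^bold>W\<^sub>n (e\<^sup>\<beta> n\<^sup>\<alpha> z))) / n\<close>: the maximum over \<open>t \<in> [0, 1]\<close> of the
  exponential growth rate \<open>t ln (cmod z) - \<alpha> (t ln t - t)\<close> of the term with index \<open>t n\<close>.\<close>

definition growth_rate :: "real \<Rightarrow> complex \<Rightarrow> real" where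
  "growth_rate \<alpha> z = \<alpha> * min 1 (cmod z) powr (1 / \<alpha>) + ln (max 1 (cmod z))"

lemma continuous_on_growth_rate:
  assumes "\<alpha> > 0"
  shows "continuous_on UNIV (growth_rate \<alpha>)"
proof -
  have "continuous_on UNIV (\<lambda>z::complex. min 1 (cmod z) powr (1 / \<alpha>))"
    using assms by (intro continuous_on_powr' continuous_intros) auto
  moreover have "continuous_on UNIV (\<lambda>z::complex. ln (max 1 (cmod z)))"
    by (intro continuous_intros) auto
  ultimately show ?thesis
    unfolding growth_rate_def[abs_def] by (intro continuous_on_add continuous_on_mult continuous_on_const)
qed

lemma radial_potential_eq_growth_rate:
  assumes "\<alpha> > 0"
  shows "radial_potential (1 / \<alpha>) 1 (cmod z) = growth_rate \<alpha> z + (- \<alpha>)"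
  using assms by (auto simp: radial_potential_def growth_rate_def algebra_simps)

text \<open>Both cases come from ln x \<le> x - 1. For \<open>cmod z \<le> 1\<close> it is applied
  to v / t, where v is the critical point of the left side as a function of t; for larger z the
  critical point lies beyond 1 and the maximum over [0, 1] is at t = 1.\<close>

lemma growth_rate_ge:
  assumes \<alpha>: "\<alpha> > 0" and t: "0 \<le> t" "t \<le> 1" and z: "z \<noteq> 0"
  shows "t * ln (cmod z) + \<alpha> * t - \<alpha> * t * ln t \<le> growth_rate \<alpha> z"
proof (cases "t = 0")
  case True
  then show ?thesis using \<alpha> by (simp add: growth_rate_def add_nonneg_nonneg)
next
  case False
  then have t0: "t > 0" using t by simp
  show ?thesis
  proof (cases "cmod z \<le> 1")
    case True
    define v where "v = cmod z powr (1 / \<alpha>)"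
    have v: "v > 0" "ln v = ln (cmod z) / \<alpha>" using z by (simp_all add: v_def ln_powr)
    have "ln (v / t) \<le> v / t - 1" using v t0 by (intro ln_le_minus_one) simp
    then have "t * (ln v - ln t + 1) \<le> t * (v / t)"
      using v t0 by (intro mult_left_mono) (auto simp: ln_div)
    then have "\<alpha> * (t * (ln v - ln t + 1)) \<le> \<alpha> * v" using \<alpha> t0 by (intro mult_left_mono) auto
    also have "\<alpha> * (t * (ln v - ln t + 1)) = t * ln (cmod z) + \<alpha> * t - \<alpha> * t * ln t"
      using \<alpha> v by (simp add: algebra_simps)
    finally show ?thesis using True by (simp add: growth_rate_def v_def)
  next
    case False
    have "- ln t \<le> 1 / t - 1" using ln_le_minus_one[of "1 / t"] t0 by (simp add: ln_div)
    then have "t * (1 - ln t) \<le> t * (1 / t)" using t0 by (intro mult_left_mono) auto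
    then have "\<alpha> * (t * (1 - ln t)) \<le> \<alpha> * 1" using \<alpha> t0 by (intro mult_left_mono) auto
    moreover have "t * ln (cmod z) \<le> 1 * ln (cmod z)" using False t by (intro mult_right_mono) auto
    ultimately show ?thesis using False by (simp add: growth_rate_def algebra_simps)
  qed
qed

lemma growth_rate_attained:
  assumes \<alpha>: "\<alpha> > 0" and z: "z \<noteq> 0"
  defines "t \<equiv> min 1 (cmod z powr (1 / \<alpha>))"
  shows "0 < t" "t \<le> 1" "t * ln (cmod z) + \<alpha> * t - \<alpha> * t * ln t = growth_rate \<alpha> z"
proof -
  show "0 < t" "t \<le> 1" using z by (auto simp: t_def)
  show "t * ln (cmod z) + \<alpha> * t - \<alpha> * t * ln t = growth_rate \<alpha> z"
  proof (cases "cmod z \<le> 1")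
    case True
    then have "cmod z powr (1 / \<alpha>) \<le> 1 powr (1 / \<alpha>)" using \<alpha> by (intro powr_mono2) auto
    then have "t = cmod z powr (1 / \<alpha>)" by (simp add: t_def)
    moreover from this have "ln t = ln (cmod z) / \<alpha>" using z by (simp add: ln_powr)
    ultimately show ?thesis using True \<alpha> by (simp add: growth_rate_def)
  next
    case False
    then have "1 powr (1 / \<alpha>) \<le> cmod z powr (1 / \<alpha>)" using \<alpha> by (intro powr_mono2) auto
    then have "t = 1" by (simp add: t_def)
    then show ?thesis using False by (simp add: growth_rate_def)
  qed
qed

section \<open>Sizes of the individual terms\<close>

locale weights =
  fixes w :: "nat \<Rightarrow> complex" and \<alpha> \<beta> :: real
  assumes \<alpha>: "\<alpha> > 0" and w_nonzero: "\<And>k. w k \<noteq> 0"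
    and w_asymp: "(\<lambda>k. ln (cmod (w k)) - (- \<alpha> * (real k * ln (real k) - real k) - \<beta> * real k)) \<in> o(\<lambda>k. real k)"
begin

definition scale :: "nat \<Rightarrow> real" where "scale n = exp \<beta> * real n powr \<alpha>"

definition rem :: "nat \<Rightarrow> real" where
  "rem k = ln (cmod (w k)) - (- \<alpha> * (real k * ln (real k) - real k) - \<beta> * real k)"

text \<open>The error term is needed at all indices k \<le> n at once, not only at large ones; the
  finitely many early values go into a constant, which is negligible against n.\<close>

lemma rem_bound:
  assumes "\<epsilon> > 0"
  obtains C where "C \<ge> 0" "\<And>k. \<bar>rem k\<bar> \<le> \<epsilon> * real k + C"
proof -
  have "\<forall>\<^sub>F k in sequentially. norm (rem k) \<le> \<epsilon> * norm (real k)"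
    using landau_o.smallD[OF w_asymp assms] by (simp add: rem_def)
  then obtain N where N: "\<And>k. k \<ge> N \<Longrightarrow> \<bar>rem k\<bar> \<le> \<epsilon> * real k"
    by (auto simp: eventually_sequentially)
  show ?thesis
  proof (rule that)
    show "0 \<le> (\<Sum>k<N. \<bar>rem k\<bar>)" by (simp add: sum_nonneg)
    show "\<bar>rem k\<bar> \<le> \<epsilon> * real k + (\<Sum>k<N. \<bar>rem k\<bar>)" for k
    proof (cases "k < N")
      case True
      then have "\<bar>rem k\<bar> \<le> (\<Sum>k<N. \<bar>rem k\<bar>)" by (intro member_le_sum) auto
      then show ?thesis using assms by (simp add: add_increasing)
    next
      case False
      then have "\<bar>rem k\<bar> \<le> \<epsilon> * real k" by (intro N) simp
      moreover have "0 \<le> (\<Sum>k<N. \<bar>rem k\<bar>)" by (intro sum_nonneg) auto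
      ultimately show ?thesis by linarith
    qed
  qed
qed

lemma scale_pos: "n > 0 \<Longrightarrow> scale n > 0"
  by (simp add: scale_def)

text \<open>The origin of the scale: exp \<beta> cancels the linear term \<beta> k, and n to the
  power \<alpha> turns k ln k into k ln (k / n), so that the main part becomes n times a function of
  k / n.\<close>

lemma norm_term_eq:
  assumes n: "n > 0" and z: "z \<noteq> 0"
  defines "t \<equiv> \<lambda>k. real k / real n"
  shows "cmod (w k * of_real (scale n) ^ k) * cmod z ^ k
    = exp (rem k + real n * (t k * ln (cmod z) + \<alpha> * t k - \<alpha> * t k * ln (t k)))"
proof -
  have sp: "scale n > 0" using n by (rule scale_pos)
  have pos: "cmod (w k * of_real (scale n) ^ k) * cmod z ^ k > 0" using w_nonzero z sp by simp
  have "ln (cmod (w k * of_real (scale n) ^ k) * cmod z ^ k)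
      = ln (cmod (w k)) + real k * ln (scale n) + real k * ln (cmod z)"
    using w_nonzero[of k] z sp by (simp add: norm_mult norm_power ln_mult ln_realpow)
  also have "ln (scale n) = \<beta> + \<alpha> * ln (real n)"
    using n by (simp add: scale_def ln_mult ln_powr)
  also have "ln (cmod (w k)) = rem k + (- \<alpha> * (real k * ln (real k) - real k) - \<beta> * real k)"
    by (simp add: rem_def)
  also have "rem k + (- \<alpha> * (real k * ln (real k) - real k) - \<beta> * real k) + real k * (\<beta> + \<alpha> * ln (real n)) + real k * ln (cmod z)
      = rem k + real n * (t k * ln (cmod z) + \<alpha> * t k - \<alpha> * t k * ln (t k))"
  proof (cases "k = 0")
    case False
    then have "ln (t k) = ln (real k) - ln (real n)" using n by (simp add: t_def ln_div)
    moreover have "real n * t k = real k" using n by (simp add: t_def)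
    moreover have "real n * (t k * ln (cmod z) + \<alpha> * t k - \<alpha> * t k * ln (t k))
        = (real n * t k) * ln (cmod z) + \<alpha> * (real n * t k) - \<alpha> * (real n * t k) * ln (t k)"
      by (simp add: algebra_simps)
    ultimately have "real n * (t k * ln (cmod z) + \<alpha> * t k - \<alpha> * t k * ln (t k))
        = real k * ln (cmod z) + \<alpha> * real k - \<alpha> * real k * (ln (real k) - ln (real n))"
      by (simp only:)
    then show ?thesis by (simp add: algebra_simps)
  qed (simp add: t_def)
  finally have "ln (cmod (w k * of_real (scale n) ^ k) * cmod z ^ k)
      = rem k + real n * (t k * ln (cmod z) + \<alpha> * t k - \<alpha> * t k * ln (t k))" .
  then show ?thesis using pos by (metis exp_ln)
qed

lemma eventually_upper_bound:
  assumes x: "\<And>\<epsilon>. \<epsilon> > 0 \<Longrightarrow> \<exists>C. \<forall>k. cmod (x k) \<le> C * exp (\<epsilon> * real k)" and \<epsilon>: "\<epsilon> > 0"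
  shows "\<forall>\<^sub>F n in sequentially. \<forall>z. z \<noteq> 0 \<longrightarrow>
    cmod (\<Sum>k\<le>n. x k * (w k * of_real (scale n) ^ k) * z ^ k) \<le> exp (real n * (growth_rate \<alpha> z + \<epsilon>))"
proof -
  \<comment> \<open>One third each for the coefficients \<open>x k\<close>, for the remainder
    \<open>rem k\<close>, and for the prefactor made of n + 1 terms and the two constants.\<close>
  define e where "e = \<epsilon> / 3"
  have e: "e > 0" using \<epsilon> by (simp add: e_def)
  obtain C where C: "\<And>k. cmod (x k) \<le> C * exp (e * real k)" using x[OF e] by blast
  have C0: "C \<ge> 0" using order_trans[OF norm_ge_zero C[of 0]] by simp
  obtain C' where C': "C' \<ge> 0" "\<And>k. \<bar>rem k\<bar> \<le> e * real k + C'" using rem_bound[OF e] by blast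
  have "(\<lambda>n. (real n + 1) * (C * exp C') * exp (- (e * real n))) \<longlonglongrightarrow> 0"
    using e by real_asymp
  then have "\<forall>\<^sub>F n in sequentially. (real n + 1) * (C * exp C') * exp (- (e * real n)) < 1"
    by (rule order_tendstoD) simp
  then show ?thesis
    using eventually_gt_at_top[of 0]
  proof eventually_elim
    case (elim n)
    show ?case
    proof (intro allI impI)
      fix z :: complex assume z: "z \<noteq> 0"
      have "cmod (\<Sum>k\<le>n. x k * (w k * of_real (scale n) ^ k) * z ^ k)
          \<le> (\<Sum>k\<le>n. C * exp C' * exp (e * real n + e * real n + real n * growth_rate \<alpha> z))"
      proof (rule sum_norm_le)
        fix k assume k: "k \<in> {..n}"
        let ?t = "real k / real n"
        have "cmod (x k * (w k * of_real (scale n) ^ k) * z ^ k)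
            = cmod (x k) * (cmod (w k * of_real (scale n) ^ k) * cmod z ^ k)"
          by (simp add: norm_mult norm_power)
        also have "\<dots> \<le> (C * exp (e * real n)) * exp (e * real n + C' + real n * growth_rate \<alpha> z)"
        proof (rule mult_mono)
          have "cmod (x k) \<le> C * exp (e * real k)" by (rule C)
          also have "\<dots> \<le> C * exp (e * real n)" using k e C0 by (intro mult_left_mono) auto
          finally show "cmod (x k) \<le> C * exp (e * real n)" .
          have "rem k \<le> e * real n + C'"
          proof -
            have "rem k \<le> e * real k + C'" using C'(2)[of k] by simp
            also have "\<dots> \<le> e * real n + C'" using k e by simp
            finally show ?thesis .
          qed
          moreover have "real n * (?t * ln (cmod z) + \<alpha> * ?t - \<alpha> * ?t * ln ?t) \<le> real n * growth_rate \<alpha> z"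
            using k elim z \<alpha> by (intro mult_left_mono growth_rate_ge) auto
          ultimately show "cmod (w k * of_real (scale n) ^ k) * cmod z ^ k \<le> exp (e * real n + C' + real n * growth_rate \<alpha> z)"
            unfolding norm_term_eq[OF elim(2) z] exp_le_cancel_iff by (rule add_mono)
        qed (use C0 in auto)
        also have "\<dots> = C * exp C' * exp (e * real n + e * real n + real n * growth_rate \<alpha> z)"
          unfolding exp_add by (simp only: mult_ac)
        finally show "cmod (x k * (w k * of_real (scale n) ^ k) * z ^ k)
            \<le> C * exp C' * exp (e * real n + e * real n + real n * growth_rate \<alpha> z)" .
      qed
      also have "\<dots> = ((real n + 1) * (C * exp C') * exp (- (e * real n))) * exp (real n * (growth_rate \<alpha> z + \<epsilon>))"
      proof -
        have "e * real n + e * real n + real n * growth_rate \<alpha> z = - (e * real n) + real n * (growth_rate \<alpha> z + \<epsilon>)"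
          by (simp add: e_def field_simps)
        then show ?thesis by (simp only: exp_add) simp
      qed
      also have "\<dots> \<le> 1 * exp (real n * (growth_rate \<alpha> z + \<epsilon>))"
        using elim(1) by (intro mult_right_mono) auto
      finally show "cmod (\<Sum>k\<le>n. x k * (w k * of_real (scale n) ^ k) * z ^ k) \<le> exp (real n * (growth_rate \<alpha> z + \<epsilon>))"
        by simp
    qed
  qed
qed

text \<open>By continuity the rate stays near its maximum on a window of proportional length. The
  window ends at the maximiser t, so it stays inside [0, 1] also when t = 1.\<close>

lemma dominant_window:
  assumes z: "z \<noteq> 0" and \<epsilon>: "\<epsilon> > 0"
  shows "\<exists>\<delta>. 0 < \<delta> \<and> \<delta> \<le> \<epsilon> \<and> (\<forall>\<^sub>F n in sequentially. \<exists>k\<^sub>0 d.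
      k\<^sub>0 + d \<le> n \<and> \<delta> * real n - 1 \<le> real (d + 1) \<and> real d \<le> \<delta> * real n \<and>
      (\<forall>k\<in>{k\<^sub>0..k\<^sub>0+d}. exp (real n * (growth_rate \<alpha> z - \<epsilon>)) \<le> cmod (w k * of_real (scale n) ^ k) * cmod z ^ k))"
proof -
  define t where "t = min 1 (cmod z powr (1 / \<alpha>))"
  note t = growth_rate_attained[OF \<alpha> z, folded t_def]
  define \<psi> where "\<psi> s = s * ln (cmod z) + \<alpha> * s - \<alpha> * s * ln s" for s
  have "isCont \<psi> t" unfolding \<psi>_def[abs_def] using t(1) by (intro continuous_intros) auto
  then obtain d where d: "d > 0" "\<And>s. dist s t < d \<Longrightarrow> dist (\<psi> s) (\<psi> t) < \<epsilon> / 2"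
    using \<epsilon> unfolding continuous_at_eps_delta by (metis half_gt_zero dist_real_def real_norm_def)
  \<comment> \<open>d / 2 keeps the window strictly within the continuity radius, and t keeps its
    left end t - \<delta> nonnegative.\<close>
  define \<delta> where "\<delta> = min (min (d / 2) \<epsilon>) t"
  have \<delta>: "0 < \<delta>" "\<delta> \<le> \<epsilon>" "\<delta> < d" "\<delta> \<le> t" using d(1) \<epsilon> t(1) by (auto simp: \<delta>_def)
  have e4: "\<epsilon> / 4 > 0" using \<epsilon> by simp
  obtain C where C: "C \<ge> 0" "\<And>k. \<bar>rem k\<bar> \<le> \<epsilon> / 4 * real k + C" using rem_bound[OF e4] by blast
  \<comment> \<open>Rounding moves each end of the window inwards by less than 1, so \<delta> n
    \<ge> 2 guarantees \<open>k\<^sub>0 \<le> k\<^sub>1\<close>.\<close>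
  have "filterlim (\<lambda>n. \<delta> * real n) at_top sequentially" using \<delta> by real_asymp
  then have ev1: "\<forall>\<^sub>F n in sequentially. \<delta> * real n \<ge> 2" by (simp add: filterlim_at_top)
  have "filterlim (\<lambda>n. \<epsilon> / 4 * real n) at_top sequentially" using \<epsilon> by real_asymp
  then have ev2: "\<forall>\<^sub>F n in sequentially. \<epsilon> / 4 * real n \<ge> C" by (simp add: filterlim_at_top)
  have "\<forall>\<^sub>F n in sequentially. \<exists>k\<^sub>0 d.
      k\<^sub>0 + d \<le> n \<and> \<delta> * real n - 1 \<le> real (d + 1) \<and> real d \<le> \<delta> * real n \<and>
      (\<forall>k\<in>{k\<^sub>0..k\<^sub>0+d}. exp (real n * (growth_rate \<alpha> z - \<epsilon>)) \<le> cmod (w k * of_real (scale n) ^ k) * cmod z ^ k)"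
    using ev1 ev2 eventually_gt_at_top[of 0]
  proof eventually_elim
    case (elim n)
    define k\<^sub>0 where "k\<^sub>0 = nat \<lceil>(t - \<delta>) * real n\<rceil>"
    define k\<^sub>1 where "k\<^sub>1 = nat \<lfloor>t * real n\<rfloor>"
    have n0: "(t - \<delta>) * real n \<ge> 0" "t * real n \<ge> 0" using \<delta> t by auto
    have k0: "(t - \<delta>) * real n \<le> real k\<^sub>0" "real k\<^sub>0 < (t - \<delta>) * real n + 1"
    proof -
      have "real k\<^sub>0 = of_int \<lceil>(t - \<delta>) * real n\<rceil>" using n0 by (simp add: k\<^sub>0_def)
      then show "(t - \<delta>) * real n \<le> real k\<^sub>0" "real k\<^sub>0 < (t - \<delta>) * real n + 1" by linarith+
    qed
    have k1: "t * real n - 1 < real k\<^sub>1" "real k\<^sub>1 \<le> t * real n"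
    proof -
      have "real k\<^sub>1 = of_int \<lfloor>t * real n\<rfloor>" using n0 by (simp add: k\<^sub>1_def)
      then show "t * real n - 1 < real k\<^sub>1" "real k\<^sub>1 \<le> t * real n" by linarith+
    qed
    have "real k\<^sub>0 \<le> real k\<^sub>1" using k0 k1 elim(1) by (simp add: left_diff_distrib)
    then have k01: "k\<^sub>0 \<le> k\<^sub>1" by simp
    have "t * real n \<le> 1 * real n" using t by (intro mult_right_mono) auto
    with k1 have k1n: "k\<^sub>1 \<le> n" by simp
    show ?case
    proof (rule exI[of _ k\<^sub>0], rule exI[of _ "k\<^sub>1 - k\<^sub>0"], intro conjI ballI)
      show "k\<^sub>0 + (k\<^sub>1 - k\<^sub>0) \<le> n" using k01 k1n by simp
      show "\<delta> * real n - 1 \<le> real (k\<^sub>1 - k\<^sub>0 + 1)" "real (k\<^sub>1 - k\<^sub>0) \<le> \<delta> * real n"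
        using k0 k1 k01 by (auto simp: of_nat_diff left_diff_distrib)
      fix k assume "k \<in> {k\<^sub>0..k\<^sub>0 + (k\<^sub>1 - k\<^sub>0)}"
      then have k: "k\<^sub>0 \<le> k" "k \<le> k\<^sub>1" using k01 by auto
      define s where "s = real k / real n"
      have n: "real n > 0" using elim by simp
      have "real k\<^sub>0 \<le> real k" "real k \<le> real k\<^sub>1" using k by auto
      with k0 k1 have "(t - \<delta>) * real n \<le> real k" "real k \<le> t * real n" by auto
      then have "t - \<delta> \<le> s" "s \<le> t" using n by (auto simp: s_def field_simps)
      then have "dist s t < d" using \<delta> by (simp add: dist_real_def)
      then have "\<psi> s \<ge> \<psi> t - \<epsilon> / 2" using d(2)[of s] unfolding dist_real_def abs_less_iff by linarith
      then have 1: "\<psi> s \<ge> growth_rate \<alpha> z - \<epsilon> / 2" using t(3) by (simp add: \<psi>_def)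
      have "real k \<le> real n" using k k1n by simp
      then have "\<epsilon> / 4 * real k \<le> \<epsilon> / 4 * real n" using \<epsilon> by (intro mult_left_mono) auto
      then have 2: "rem k \<ge> - (\<epsilon> / 2 * real n)" using C(2)[of k] elim(2) by simp
      have "real n * (growth_rate \<alpha> z - \<epsilon>) = - (\<epsilon> / 2 * real n) + real n * (growth_rate \<alpha> z - \<epsilon> / 2)"
        by (simp add: algebra_simps)
      also have "\<dots> \<le> rem k + real n * \<psi> s"
        using 1 2 n by (intro add_mono mult_left_mono) auto
      finally show "exp (real n * (growth_rate \<alpha> z - \<epsilon>)) \<le> cmod (w k * of_real (scale n) ^ k) * cmod z ^ k"
        using elim(3) z by (subst norm_term_eq) (auto simp: \<psi>_def s_def)
    qed
  qed
  then show ?thesis using \<delta> by blast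
qed

end

section \<open>Convergence of the zeros\<close>

lemma prob_space_limit_measure:
  assumes "\<alpha> > 0"
  shows "prob_space (limit_measure \<alpha>)"
  using assms by (intro prob_spaceI) (simp add: limit_measure_eq_radial_measure emeasure_radial_measure)

lemma subprob_limit_measure:
  assumes "\<alpha> > 0"
  shows "subprob_complex (limit_measure \<alpha>)"
proof -
  interpret prob_space "limit_measure \<alpha>" by (rule prob_space_limit_measure[OF assms])
  show ?thesis
    by unfold_locales (use assms in \<open>simp_all add: limit_measure_eq_radial_measure emeasure_radial_measure measure_def\<close>)
qed

lemma AE_limit_measure_le_1: "AE z in limit_measure \<alpha>. cmod z \<le> 1"
  unfolding limit_measure_eq_radial_measure radial_measure_def
  by (subst AE_density) (auto simp: indicator_def)

lemma AE_limit_measure_neq: "AE \<zeta> in limit_measure \<alpha>. \<zeta> \<noteq> z"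
  using AE_radial_measure_cmod_neq[where k = "1 / \<alpha>" and r = 1 and a = "cmod z"]
  unfolding limit_measure_eq_radial_measure by (rule eventually_mono) auto

text \<open>Fubini gives integrability of the logarithm almost everywhere on each disc, and discs of
  integer radius exhaust the plane. An exceptional null set is harmless, since potentials enter only
  through integrals over discs.\<close>

lemma log_potential_limit_measure:
  assumes \<alpha>: "\<alpha> > 0"
  shows "AE x in lborel. log_potential (limit_measure \<alpha>) x = growth_rate \<alpha> x + (- \<alpha>)"
proof -
  interpret subprob_complex "limit_measure \<alpha>" by (rule subprob_limit_measure[OF \<alpha>])
  have "AE x in lborel. \<forall>N. x \<in> ball 0 (real (Suc N)) \<longrightarrow> integrable (limit_measure \<alpha>) (\<lambda>\<zeta>. ln (cmod (x - \<zeta>)))"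
    unfolding AE_all_countable
    by (intro allI log_potential_ball(1)[OF AE_limit_measure_le_1]) simp
  then show ?thesis
    using AE_lborel_singleton[of "0::complex"]
  proof eventually_elim
    case (elim x)
    obtain N where "cmod x < real N" using reals_Archimedean2 by blast
    then have "x \<in> ball 0 (real (Suc N))" by simp
    then have "integrable (radial_measure (1 / \<alpha>) 1) (\<lambda>\<zeta>. ln (cmod (\<zeta> - x)))"
      using elim(1) by (auto simp: limit_measure_eq_radial_measure norm_minus_commute)
    then have "log_potential (limit_measure \<alpha>) x = radial_potential (1 / \<alpha>) 1 (cmod x)"
      using \<alpha> elim(2) unfolding log_potential_def limit_measure_eq_radial_measure
      by (subst integral_ln_radial_measure[symmetric]) (auto simp: norm_minus_commute)
    then show ?case by (simp only: radial_potential_eq_growth_rate[OF \<alpha>])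
  qed
qed

lemma log_potential_scaled_roots_measure:
  fixes p :: "complex poly"
  assumes p: "p \<noteq> 0" and t: "t \<ge> 0" and c: "c > 0" and y: "poly p (of_real c * y) \<noteq> 0"
  defines "b \<equiv> t * (ln (cmod (lead_coeff p)) + (\<Sum>\<zeta> | poly p \<zeta> = 0. real (order \<zeta> p) * ln c))"
  shows "AE \<zeta> in scaled_roots_measure t c p. \<zeta> \<noteq> y"
    and "integrable (scaled_roots_measure t c p) (\<lambda>\<zeta>. ln (cmod (y - \<zeta>)))"
    and "b + log_potential (scaled_roots_measure t c p) y = t * ln (cmod (poly p (of_real c * y)))"
proof -
  show "AE \<zeta> in scaled_roots_measure t c p. \<zeta> \<noteq> y"
    by (rule AE_scaled_roots_measure[OF p]) (use y c in auto)
  have *: "has_bochner_integral (scaled_roots_measure t c p) (\<lambda>\<zeta>. ln (cmod (y - \<zeta>)))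
    (t * (\<Sum>z | poly p z = 0. real (order z p) * ln (cmod (y - z / of_real c))))"
    by (rule has_bochner_integral_scaled_roots_measure[OF p t]) simp
  then show "integrable (scaled_roots_measure t c p) (\<lambda>\<zeta>. ln (cmod (y - \<zeta>)))"
    by (simp add: has_bochner_integral_iff)
  show "b + log_potential (scaled_roots_measure t c p) y = t * ln (cmod (poly p (of_real c * y)))"
    unfolding log_potential_def has_bochner_integral_integral_eq[OF *] ln_cmod_poly[OF p y c] b_def
    by (simp add: algebra_simps)
qed

lemma scaled_roots_measure_bounded:
  obtains K where "AE \<zeta> in scaled_roots_measure t c p. cmod \<zeta> \<le> K"
proof (cases "p = 0")
  case True
  have "AE \<zeta> in scaled_roots_measure t c p. cmod \<zeta> \<le> 0"
    unfolding scaled_roots_measure_0[OF True] by (rule AE_I[of _ _ UNIV]) auto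
  then show ?thesis by (rule that)
next
  case False
  have "AE \<zeta> in scaled_roots_measure t c p. cmod \<zeta> \<le> (\<Sum>z | poly p z = 0. cmod (z / of_real c))"
    by (rule AE_scaled_roots_measure[OF False])
       (auto intro!: member_le_sum simp: poly_roots_finite[OF False])
  then show ?thesis by (rule that)
qed

lemma AE_scaled_roots_measure_neq:
  "AE z in lborel. AE \<zeta> in scaled_roots_measure t c p. \<zeta> \<noteq> z"
proof (cases "p = 0")
  case True
  have "AE \<zeta> in scaled_roots_measure t c p. \<zeta> \<noteq> z" for z
    unfolding scaled_roots_measure_0[OF True] by (rule AE_I[of _ _ UNIV]) auto
  then show ?thesis by simp
next
  case False
  have "finite ((\<lambda>z. z / of_real c) ` {z. poly p z = 0})"
    using poly_roots_finite[OF False] by simp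
  from AE_not_in[OF finite_imp_null_set_lborel[OF this]] show ?thesis
    by eventually_elim (rule AE_scaled_roots_measure[OF False], auto)
qed

section \<open>Deterministic convergence and the conclusion\<close>

context weights
begin

text \<open>The part for a fixed outcome: randomness has been used up in \<open>growth\<close> and
  \<open>large\<close>.\<close>

lemma vaguely_converges_scaled_roots:
  fixes x :: "nat \<Rightarrow> complex" and D :: "complex set"
  assumes growth: "\<And>\<epsilon>. \<epsilon> > 0 \<Longrightarrow> \<exists>C. \<forall>k. cmod (x k) \<le> C * exp (\<epsilon> * real k)"
    and dense: "closure D = UNIV"
    and large: "\<And>z j m. z \<in> D \<Longrightarrow> z \<noteq> 0 \<Longrightarrow> \<forall>\<^sub>F n in sequentially. \<exists>y\<in>ball z (1 / real (Suc j)).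
      exp (real n * (growth_rate \<alpha> z - 1 / real (Suc m)))
        < cmod (\<Sum>k\<le>n. x k * (w k * of_real (scale n) ^ k) * y ^ k)"
  shows "vaguely_converges
    (\<lambda>n. scaled_roots_measure (1 / real n) (scale n) (\<Sum>k\<le>n. monom (x k * w k) k)) (limit_measure \<alpha>)"
proof -
  define P where "P n = (\<Sum>k\<le>n. monom (x k * w k) k)" for n
  define \<mu> where "\<mu> n = scaled_roots_measure (1 / real n) (scale n) (P n)" for n
  have poly_P: "poly (P n) (of_real (scale n) * y) = (\<Sum>k\<le>n. x k * (w k * of_real (scale n) ^ k) * y ^ k)" for n y
    unfolding P_def poly_sum poly_monom by (intro sum.cong) (auto simp: power_mult_distrib mult_ac)
  have sub: "subprob_complex (\<mu> n)" for n
    unfolding \<mu>_def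
  proof (rule subprob_scaled_roots_measure)
    have "real (degree (P n)) \<le> real n" unfolding P_def using degree_sum_monom_le by simp
    then show "1 / real n * real (degree (P n)) \<le> 1" by (cases "n = 0") (auto simp: divide_le_eq_1)
  qed simp
  define b where "b n = 1 / real n * (ln (cmod (lead_coeff (P n))) +
    (\<Sum>\<zeta> | poly (P n) \<zeta> = 0. real (order \<zeta> (P n)) * ln (scale n)))" for n
  note potential = log_potential_scaled_roots_measure[where t = "1 / real n" and c = "scale n" and p = "P n" for n,
    folded \<mu>_def b_def]
  have lower: "\<forall>\<^sub>F n in sequentially. \<exists>y\<in>ball z r. poly (P n) (of_real (scale n) * y) \<noteq> 0 \<and>
      growth_rate \<alpha> z - \<epsilon> \<le> 1 / real n * ln (cmod (poly (P n) (of_real (scale n) * y)))"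
    if r: "r > 0" and \<epsilon>: "\<epsilon> > 0" for z r \<epsilon>
  proof -
    \<comment> \<open>\<open>large\<close> speaks only of nonzero points of \<open>D\<close>; by
      continuity of the growth rate such a point close to z can stand in for z.\<close>
    have "isCont (growth_rate \<alpha>) z"
      using continuous_on_growth_rate[OF \<alpha>] by (simp add: continuous_on_eq_continuous_at)
    then obtain d where d: "d > 0" "\<And>z'. dist z' z < d \<Longrightarrow> dist (growth_rate \<alpha> z') (growth_rate \<alpha> z) < \<epsilon> / 2"
      using \<epsilon> unfolding continuous_at_eps_delta by (metis half_gt_zero dist_norm real_norm_def dist_real_def)
    define d' where "d' = min d (r / 2)"
    have d': "d' > 0" "d' \<le> d" "d' \<le> r / 2" using d r by (auto simp: d'_def)
    have "ball z d' - {0} \<noteq> {}"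
    proof (cases "z = 0")
      case True
      then have "of_real (d' / 2) \<in> ball z d' - {0}" using d' by auto
      then show ?thesis by blast
    next
      case False
      then have "z \<in> ball z d' - {0}" using d' by simp
      then show ?thesis by blast
    qed
    then have "(ball z d' - {0}) \<inter> D \<noteq> {}"
      using open_Int_closure_eq_empty[of "ball z d' - {0}" D] dense by (auto simp: open_delete)
    then obtain z' where "z' \<in> (ball z d' - {0}) \<inter> D" by blast
    then have z': "z' \<in> D" "z' \<noteq> 0" "dist z z' < d'" by simp_all
    obtain j where j: "1 / real (Suc j) < r / 2" using reals_Archimedean[of "r / 2"] r by (auto simp: inverse_eq_divide)
    obtain m where m: "1 / real (Suc m) < \<epsilon> / 2" using reals_Archimedean[of "\<epsilon> / 2"] \<epsilon> by (auto simp: inverse_eq_divide)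
    have close: "growth_rate \<alpha> z - \<epsilon> / 2 < growth_rate \<alpha> z'"
      using d(2)[of z'] z'(3) d' unfolding dist_real_def abs_less_iff by (auto simp: dist_commute)
    from large[OF z'(1,2), of j m] eventually_gt_at_top[of 0] show ?thesis
    proof eventually_elim
      case (elim n)
      then obtain y where y: "dist z' y < 1 / real (Suc j)"
        "exp (real n * (growth_rate \<alpha> z' - 1 / real (Suc m))) < cmod (poly (P n) (of_real (scale n) * y))"
        by (auto simp: poly_P)
      let ?v = "cmod (poly (P n) (of_real (scale n) * y))"
      have v: "?v > 0" using y(2) by (rule less_trans[OF exp_gt_zero])
      have "real n * (growth_rate \<alpha> z' - 1 / real (Suc m)) < ln ?v"
        using y(2) v by (metis exp_less_cancel_iff exp_ln)
      then have "growth_rate \<alpha> z' - 1 / real (Suc m) < 1 / real n * ln ?v"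
        using elim(2) by (simp add: pos_less_divide_eq mult.commute)
      then have "growth_rate \<alpha> z - \<epsilon> \<le> 1 / real n * ln ?v"
        using close m by linarith
      moreover have "dist z y < r" using dist_triangle[of z y z'] y(1) z'(3) j d'(3) by linarith
      ultimately show ?case using v by (intro bexI[of _ y]) auto
    qed
  qed
  \<comment> \<open>A value bounded below by an exponential excludes the zero polynomial, for which
    the link between measure and potential fails.\<close>
  have P_nonzero: "\<forall>\<^sub>F n in sequentially. P n \<noteq> 0"
    using lower[of 1 1 0] by (rule eventually_mono) auto
  have conv: "(\<lambda>n. integral\<^sup>L (\<mu> n) g) \<longlonglongrightarrow> integral\<^sup>L (limit_measure \<alpha>) g"
    if g: "continuous_on UNIV g" and supp: "compact (closure {z. g z \<noteq> 0})" for g :: "complex \<Rightarrow> real"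
  proof -
    have "\<exists>K. AE \<zeta> in \<mu> n. cmod \<zeta> \<le> K" for n
      unfolding \<mu>_def using scaled_roots_measure_bounded by metis
    then obtain K where K: "\<And>n. AE \<zeta> in \<mu> n. cmod \<zeta> \<le> K n" by metis
    show ?thesis
    proof (rule tendsto_integral_of_log_potential[OF sub K _ subprob_limit_measure[OF \<alpha>] AE_limit_measure_le_1 _
          continuous_on_growth_rate[OF \<alpha>] log_potential_limit_measure[OF \<alpha>] _ _ g supp])
      show "AE z in lborel. \<forall>n. AE \<zeta> in \<mu> n. \<zeta> \<noteq> z"
        unfolding AE_all_countable \<mu>_def by (intro allI AE_scaled_roots_measure_neq)
      show "AE z in lborel. AE \<zeta> in limit_measure \<alpha>. \<zeta> \<noteq> z"
        by (intro AE_I2 AE_limit_measure_neq)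
      show "\<forall>\<^sub>F n in sequentially. AE y in lborel. y \<in> ball 0 R \<longrightarrow> b n + log_potential (\<mu> n) y \<le> growth_rate \<alpha> y + \<epsilon>"
        if \<epsilon>: "\<epsilon> > 0" for R \<epsilon>
      proof -
        have "\<forall>\<^sub>F n in sequentially. \<forall>z. z \<noteq> 0 \<longrightarrow>
            cmod (\<Sum>k\<le>n. x k * (w k * of_real (scale n) ^ k) * z ^ k) \<le> exp (real n * (growth_rate \<alpha> z + \<epsilon>))"
          using growth \<epsilon> by (rule eventually_upper_bound)
        with P_nonzero show ?thesis
          using eventually_gt_at_top[of 0]
        proof eventually_elim
          case (elim n)
          have sc: "scale n > 0" using elim by (intro scale_pos)
          \<comment> \<open>The finitely many rescaled zeros and the origin are discarded: at a zero
            the logarithm of 0 is a mere convention, and the bound on the sum is available for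
            nonzero points.\<close>
          have "finite ((\<lambda>z. z / of_real (scale n)) ` {z. poly (P n) z = 0})"
            using poly_roots_finite[OF elim(1)] by simp
          from AE_not_in[OF finite_imp_null_set_lborel[OF this]] AE_lborel_singleton[of "0::complex"] show ?case
          proof eventually_elim
            case y: (elim y)
            have ne: "poly (P n) (of_real (scale n) * y) \<noteq> 0"
            proof
              assume "poly (P n) (of_real (scale n) * y) = 0"
              then have "of_real (scale n) * y / of_real (scale n) \<in> (\<lambda>z. z / of_real (scale n)) ` {z. poly (P n) z = 0}"
                by (intro imageI) simp
              with y(1) sc show False by simp
            qed
            have "cmod (poly (P n) (of_real (scale n) * y)) \<le> exp (real n * (growth_rate \<alpha> y + \<epsilon>))"
              using elim(2) y(2) by (simp add: poly_P)
            then have "ln (cmod (poly (P n) (of_real (scale n) * y))) \<le> real n * (growth_rate \<alpha> y + \<epsilon>)"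
              using ne by (metis ln_exp ln_mono zero_less_norm_iff exp_gt_zero)
            then have "1 / real n * ln (cmod (poly (P n) (of_real (scale n) * y))) \<le> growth_rate \<alpha> y + \<epsilon>"
              using elim(3) by (simp add: pos_divide_le_eq mult.commute)
            then show ?case
              using potential(3)[OF elim(1) _ sc ne] by simp
          qed
        qed
      qed
      show "\<forall>\<^sub>F n in sequentially. \<exists>y\<in>ball z r. (AE \<zeta> in \<mu> n. \<zeta> \<noteq> y) \<and>
          integrable (\<mu> n) (\<lambda>\<zeta>. ln (cmod (y - \<zeta>))) \<and> growth_rate \<alpha> z - \<epsilon> \<le> b n + log_potential (\<mu> n) y"
        if r: "r > 0" and \<epsilon>: "\<epsilon> > 0" for z r \<epsilon>
        using lower[OF r \<epsilon>, of z] P_nonzero eventually_gt_at_top[of 0]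
      proof eventually_elim
        case (elim n)
        have sc: "scale n > 0" using elim by (intro scale_pos)
        from elim(1) obtain y where y: "y \<in> ball z r" "poly (P n) (of_real (scale n) * y) \<noteq> 0"
          "growth_rate \<alpha> z - \<epsilon> \<le> 1 / real n * ln (cmod (poly (P n) (of_real (scale n) * y)))" by blast
        show ?case
          using potential[OF elim(2) _ sc y(2)] y(1,3) by (intro bexI[of _ y]) auto
      qed
    qed
  qed
  have locfin: "locally_finite_measure m" if "subprob_complex m" for m
  proof -
    interpret subprob_complex m by fact
    show ?thesis by (simp add: locally_finite_measure_def less_top[symmetric])
  qed
  show ?thesis
    unfolding vaguely_converges_def P_def[symmetric] \<mu>_def[symmetric]
    using conv locfin sub subprob_limit_measure[OF \<alpha>] by blast
qed

end

theorem theorem2p3: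
  fixes M :: "'a measure"
    and \<xi> :: "nat \<Rightarrow> 'a \<Rightarrow> complex"
    and w :: "nat \<Rightarrow> complex"
    and \<alpha> \<beta> :: real
  assumes "prob_space M"
    and indep: "prob_space.indep_vars M (\<lambda>_. borel) \<xi> UNIV"
    and ident: "\<And>k. distr M borel (\<xi> k) = distr M borel (\<xi> 0)"
    and nondegenerate: "\<not> (\<exists>c. AE \<omega> in M. \<xi> 0 \<omega> = c)"
    and log_moment: "integrable M (\<lambda>\<omega>. ln (1 + cmod (\<xi> 0 \<omega>)))"
    and "\<alpha> > 0"
    and "\<And>k. w k \<noteq> 0"
    and "(\<lambda>k. ln (cmod (w k)) - (- \<alpha> * (real k * ln (real k) - real k) - \<beta> * real k)) \<in> o(\<lambda>k. real k)"
  shows "prob_space (limit_measure \<alpha>) \<and>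
    (AE \<omega> in M. vaguely_converges
       (\<lambda>n. scale_measure (ennreal (1 / real n)) (scaled_zero_measure \<alpha> \<beta> \<xi> w n \<omega>))
       (limit_measure \<alpha>))"
proof
  interpret prob_space M by fact
  interpret weights w \<alpha> \<beta> by unfold_locales fact+
  show "prob_space (limit_measure \<alpha>)" by (rule prob_space_limit_measure[OF \<alpha>])
  have rv: "random_variable borel (\<xi> k)" for k
    using indep by (auto simp: indep_vars_def)
  obtain D :: "complex set" where D: "countable D" "closure D = UNIV"
  proof -
    obtain D :: "complex set" where D: "countable D" "\<And>X. open X \<Longrightarrow> X \<noteq> {} \<Longrightarrow> \<exists>d\<in>D. d \<in> X"
      using countable_dense_setE by blast
    have "closure D = UNIV"
      using D(2)[of "- closure D"] closure_subset[of D] by auto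
    with D(1) show ?thesis by (rule that)
  qed
  \<comment> \<open>Centres in a countable set, radii 1 / (j + 1) and tolerances 1 / (m + 1) allow
    the quantifiers to move inside the almost sure statement.\<close>
  have "AE \<omega> in M. \<forall>z\<in>D - {0}. \<forall>j m. \<forall>\<^sub>F n in sequentially. \<exists>y\<in>ball z (1 / real (Suc j)).
      exp (real n * (growth_rate \<alpha> z - 1 / real (Suc m)))
        < cmod (\<Sum>k\<le>n. \<xi> k \<omega> * (w k * of_real (scale n) ^ k) * y ^ k)"
    unfolding AE_all_countable using D(1)
    by (subst AE_ball_countable)
       (auto simp: AE_all_countable simp del: of_nat_Suc
         intro!: AE_eventually_large[where \<xi> = \<xi>, OF indep ident nondegenerate] dominant_window)
  moreover have "AE \<omega> in M. \<forall>\<epsilon>>0. \<exists>C. \<forall>k. cmod (\<xi> k \<omega>) \<le> C * exp (\<epsilon> * real k)"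
    by (rule AE_subexponential_growth[where \<xi> = \<xi>, OF rv ident log_moment])
  ultimately show "AE \<omega> in M. vaguely_converges
       (\<lambda>n. scale_measure (ennreal (1 / real n)) (scaled_zero_measure \<alpha> \<beta> \<xi> w n \<omega>))
       (limit_measure \<alpha>)"
  proof eventually_elim
    case (elim \<omega>)
    have "scale_measure (ennreal (1 / real n)) (scaled_zero_measure \<alpha> \<beta> \<xi> w n \<omega>)
        = scaled_roots_measure (1 / real n) (scale n) (\<Sum>k\<le>n. monom (\<xi> k \<omega> * w k) k)" for n
      by (simp add: scaled_zero_measure_def scaled_roots_measure_def random_poly_eq_poly scale_def)
    then show ?case
      using vaguely_converges_scaled_roots[of "\<lambda>k. \<xi> k \<omega>" D] elim D(2) by simp
  qed
qed

end
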